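(* Let $s\in(1/2,1)$, $N>2s$, let $\mathcal{B}$ be the open unit ball of $\mathbb{R}^N$ centered at the origin, and let $h\in L^\infty(\mathcal{B})$ be radial. Suppose $0<S_{N,s,rad}(\mathcal{B},h)<S_{N,s}(\mathbb{R}^N)$. Then every minimizing sequence for $S_{N,s,rad}(\mathcal{B},h)$, normalized in $H^s_{0,rad}(\mathcal{B})$ (i.e. $Q_{N,s,\mathcal{B}}(u_k)+\int_{\mathcal{B}}hu_k^2dx=1$), is relatively compact in $H^s_{0,rad}(\mathcal{B})$. In particular, the infimum $S_{N,s,rad}(\mathcal{B},h)$ is achieved.
   Context: $c_{N,s}>0$ is the standard normalization constant of the fractional Laplacian on $\mathbb{R}^N$, $2^*_s=\frac{2N}{N-2s}$, and for an open set $U$, $Q_{N,s,U}(u)=\frac{c_{N,s}}{2}\int_U\int_U\frac{(u(x)-u(y))^2}{|x-y|^{N+2s}}dxdy$. $H^s_{0,rad}(\mathcal{B})$ is the completion of the radial functions in $C^\infty_c(\mathcal{B})$ under the norm $(\|u\|^2_{L^2(\mathcal{B})}+Q_{N,s,\mathcal{B}}(u))^{1/2}$. $S_{N,s,rad}(\mathcal{B},h)=\inf_{u\in H^s_{0,rad}(\mathcal{B}),u\neq0}\frac{Q_{N,s,\mathcal{B}}(u)+\int_{\mathcal{B}}hu^2dx}{\|u\|^2_{L^{2^*_s}(\mathcal{B})}}$, and $S_{N,s}(\mathbb{R}^N)=\inf_{u\in C^\infty_c(\mathbb{R}^N),u\neq0}\frac{Q_{N,s,\mathbb{R}^N}(u)}{\|u\|^2_{L^{2^*_s}(\mathbb{R}^N)}}$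 is the sharp fractional Sobolev constant. *)

theory Defs
  imports "HOL-Analysis.Analysis"
begin

text \<open>C-infinity: differentiable everywhere, and all partial derivatives are again C-infinity
  (coinductively, i.e. partial derivatives of all orders exist everywhere).\<close>
coinductive smooth_fun :: "('a::euclidean_space \<Rightarrow> real) \<Rightarrow> bool" where
  "(\<forall>x. f differentiable (at x)) \<Longrightarrow>
   (\<forall>i\<in>Basis. smooth_fun (\<lambda>x. frechet_derivative f (at x) i)) \<Longrightarrow> smooth_fun f"

definition Cc_inf :: "'a::euclidean_space set \<Rightarrow> ('a \<Rightarrow> real) set" where
  "Cc_inf U = {f. smooth_fun f \<and> compact (closure {x. f x \<noteq> 0}) \<and> closure {x. f x \<noteq> 0} \<subseteq> U}"

definition radial :: "('a::euclidean_space \<Rightarrow> real) \<Rightarrow> bool" where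
  "radial f \<longleftrightarrow> (\<forall>x y. norm x = norm y \<longrightarrow> f x = f y)"

abbreviation unitB :: "'a::euclidean_space set" where
  "unitB \<equiv> ball 0 1"

text \<open>Normalization constant c_{N,s} of the fractional Laplacian.\<close>
definition cNs :: "nat \<Rightarrow> real \<Rightarrow> real" where
  "cNs N s = s * 4 powr s * Gamma (real N / 2 + s) / (pi powr (real N / 2) * Gamma (1 - s))"

definition crit :: "nat \<Rightarrow> real \<Rightarrow> real" where
  "crit N s = 2 * real N / (real N - 2 * s)"

definition Qf :: "real \<Rightarrow> 'a::euclidean_space set \<Rightarrow> ('a \<Rightarrow> real) \<Rightarrow> ennreal" where
  "Qf s U u = ennreal (cNs DIM('a) s / 2) *
     (\<integral>\<^sup>+ x. (\<integral>\<^sup>+ y. ennreal ((u x - u y)\<^sup>2 / norm (x - y) powr (real DIM('a) + 2 * s))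
        * indicator U y \<partial>lborel) * indicator U x \<partial>lborel)"

definition Hsq :: "real \<Rightarrow> ('a::euclidean_space \<Rightarrow> real) \<Rightarrow> ennreal" where
  "Hsq s u = (\<integral>\<^sup>+ x. ennreal ((u x)\<^sup>2) * indicator unitB x \<partial>lborel) + Qf s unitB u"

text \<open>H^s_{0,rad}(B): completion of radial C_c^infinity(B) functions w.r.t. the H-norm,
  realised concretely as the functions (vanishing outside B) that are H-norm limits
  of radial C_c^infinity(B) functions.\<close>
definition Hrad :: "real \<Rightarrow> ('a::euclidean_space \<Rightarrow> real) set" where
  "Hrad s = {u. u \<in> borel_measurable lborel \<and> (\<forall>x. x \<notin> unitB \<longrightarrow> u x = 0) \<and> Hsq s u < \<infinity> \<and>
     (\<exists>\<phi>. (\<forall>k. \<phi> k \<in> Cc_inf unitB \<and> radial (\<phi> k)) \<and>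
          (\<lambda>k. Hsq s (\<lambda>x. \<phi> k x - u x)) \<longlonglongrightarrow> 0)}"

definition Lp_sq :: "real \<Rightarrow> 'a::euclidean_space set \<Rightarrow> ('a \<Rightarrow> real) \<Rightarrow> real" where
  "Lp_sq p U u = (enn2real (\<integral>\<^sup>+ x. ennreal (\<bar>u x\<bar> powr p) * indicator U x \<partial>lborel)) powr (2 / p)"

definition Rq :: "real \<Rightarrow> ('a::euclidean_space \<Rightarrow> real) \<Rightarrow> ('a \<Rightarrow> real) \<Rightarrow> real" where
  "Rq s h u = (enn2real (Qf s unitB u) + (LINT x:unitB|lborel. h x * (u x)\<^sup>2))
              / Lp_sq (crit DIM('a) s) unitB u"

definition S_rad :: "real \<Rightarrow> ('a::euclidean_space \<Rightarrow> real) \<Rightarrow> real" where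
  "S_rad s h = (INF u \<in> {u \<in> Hrad s. \<not> (AE x in lborel. u x = 0)}. Rq s h u)"

definition S_sob :: "real \<Rightarrow> 'a::euclidean_space itself \<Rightarrow> real" where
  "S_sob s (_::'a itself) = (INF u \<in> {u \<in> Cc_inf (UNIV::'a set). \<exists>x. u x \<noteq> 0}.
      enn2real (Qf s UNIV u) / Lp_sq (crit DIM('a) s) UNIV u)"

end

theory Submission
  imports Defs "HOL-Complex_Analysis.Great_Picard"
begin

text \<open>
  A minimizing sequence is bounded in the energy norm. A radial function has the same energy on all rotated
  copies of a small ball, so a ball of radius \<open>\<rho>\<close> carries only a fraction of order \<open>\<rho> ^ (N - 1)\<close> of it;
  as \<open>s > 1/2\<close>, radial functions are therefore Hoelder continuous and bounded away from the origin in terms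
  of their energy. Arzela--Ascoli gives a subsequence \<open>w k\<close> converging almost everywhere to some \<open>u\<close>,
  and \<open>u\<close> lies in the space by Mazur's argument. Put \<open>v k = w k - u\<close>. The energy splits
  asymptotically as energy of \<open>u\<close> plus energy of \<open>v k\<close>, and the squared \<open>L\<^sup>p\<close>-norm, \<open>p\<close> the critical exponent, is
  asymptotically subadditive (Brezis--Lieb). Since \<open>v k\<close> can only concentrate at the origin, its energy controls
  its \<open>L\<^sup>p\<close>-norm with the Sobolev constant of the whole space up to \<open>o(1)\<close>. That constant being strictly larger than
  the infimum, \<open>v k\<close> tends to 0 in \<open>L\<^sup>p\<close>, so \<open>u\<close> is a minimizer and the energy of \<open>v k\<close> tends to 0.
\<close>

section \<open>Smooth functions\<close>

text \<open>The exponent is critical, so a bounded sequence may lose mass at a point although it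
  converges almost everywhere; radial symmetry leaves the origin as the only such point. Two
  different energies have to be compared there: the one being minimised sees only pairs inside the
  ball, while the Sobolev constant belongs to pairs in the whole space, and the energy in the ball
  need not control that of the extension by zero with constant 1. Multiplication by
  \<open>bump\<close>, which vanishes from radius 1/2 on, bridges the gap at the price of a factor 1
  + e and a multiple of the squared \<open>L\<^sup>2\<close>-norm, which tends to 0 for
  \<open>v k\<close>; as \<open>bump\<close> is close to 1 near the origin, little is lost there.
  Positivity of the infimum also supplies the embedding into \<open>L\<^sup>p\<close> and
  coercivity, since \<open>h\<close> may be negative. Pointwise estimates are proved for smooth
  radial functions, which have point values, and carried to the completion by approximations
  converging almost everywhere.\<close>

inductive_set ring_gen :: "('a \<Rightarrow> real) set \<Rightarrow> ('a \<Rightarrow> real) set" for X where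
  base: "f \<in> X \<Longrightarrow> f \<in> ring_gen X"
| add: "f \<in> ring_gen X \<Longrightarrow> g \<in> ring_gen X \<Longrightarrow> (\<lambda>x. f x + g x) \<in> ring_gen X"
| mult: "f \<in> ring_gen X \<Longrightarrow> g \<in> ring_gen X \<Longrightarrow> (\<lambda>x. f x * g x) \<in> ring_gen X"

text \<open>Coinduction asks for a set of differentiable functions closed under partial derivatives.
  By the sum and product rules the ring generated by \<open>X\<close> is such a set as soon as the
  first partial derivatives of the generators stay in the ring. Used with all smooth functions as
  generators, and with the flat functions behind \<open>bump\<close>.\<close>

lemma ring_gen_smooth:
  fixes X :: "('a::euclidean_space \<Rightarrow> real) set"
  assumes diff: "\<And>f x. f \<in> X \<Longrightarrow> f differentiable (at x)"
    and deriv: "\<And>f i. f \<in> X \<Longrightarrow> i \<in> Basis \<Longrightarrow> (\<lambda>x. frechet_derivative f (at x) i) \<in> ring_gen X"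
    and f: "f \<in> ring_gen X"
  shows "smooth_fun f"
proof -
  have D: "f differentiable (at x)" if "f \<in> ring_gen X" for f x
    using that by induction (auto intro: diff)
  have P: "(\<lambda>x. frechet_derivative f (at x) i) \<in> ring_gen X" if "f \<in> ring_gen X" "i \<in> Basis" for f i
    using that
  proof induction
    case (base f)
    then show ?case by (rule deriv)
  next
    case (add f g)
    have "frechet_derivative (\<lambda>x. f x + g x) (at x) i
        = frechet_derivative f (at x) i + frechet_derivative g (at x) i" for x
    proof -
      have "((\<lambda>x. f x + g x) has_derivative
         (\<lambda>h. frechet_derivative f (at x) h + frechet_derivative g (at x) h)) (at x)"
        using D[OF add(1), of x] D[OF add(2), of x]
        by (intro has_derivative_add) (simp_all only: frechet_derivative_works)
      from frechet_derivative_at[OF this] show ?thesis by metis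
    qed
    with add show ?case by (simp add: ring_gen.add)
  next
    case (mult f g)
    have "frechet_derivative (\<lambda>x. f x * g x) (at x) i
        = f x * frechet_derivative g (at x) i + frechet_derivative f (at x) i * g x" for x
    proof -
      have "((\<lambda>x. f x * g x) has_derivative
         (\<lambda>h. f x * frechet_derivative g (at x) h + frechet_derivative f (at x) h * g x)) (at x)"
        using D[OF mult(1), of x] D[OF mult(2), of x]
      by (intro has_derivative_mult) (simp_all only: frechet_derivative_works)
      from frechet_derivative_at[OF this] show ?thesis by metis
    qed
    with mult show ?case by (simp add: ring_gen.add ring_gen.mult)
  qed
  from f show ?thesis
  proof (coinduction arbitrary: f)
    case smooth_fun
    show ?case
      using D[OF smooth_fun] P[OF smooth_fun] by (intro exI[of _ f]) auto
  qed
qed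

lemma smooth_differentiable: "smooth_fun f \<Longrightarrow> f differentiable (at x)"
  by (auto elim: smooth_fun.cases)

lemma smooth_partial: "smooth_fun f \<Longrightarrow> i \<in> Basis \<Longrightarrow> smooth_fun (\<lambda>x. frechet_derivative f (at x) i)"
  by (auto elim: smooth_fun.cases)

lemma smooth_ring_gen: "f \<in> ring_gen (Collect smooth_fun) \<Longrightarrow> smooth_fun f"
  by (rule ring_gen_smooth[of "Collect smooth_fun"])
     (auto simp: smooth_differentiable intro!: ring_gen.base smooth_partial)

lemma smooth_add: "smooth_fun f \<Longrightarrow> smooth_fun g \<Longrightarrow> smooth_fun (\<lambda>x. f x + g x)"
  and smooth_mult: "smooth_fun f \<Longrightarrow> smooth_fun g \<Longrightarrow> smooth_fun (\<lambda>x. f x * g x)"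
  by (rule smooth_ring_gen[OF ring_gen.add], (rule ring_gen.base, simp)+)
     (rule smooth_ring_gen[OF ring_gen.mult], (rule ring_gen.base, simp)+)

lemma smooth_const: "smooth_fun (\<lambda>x::'a::euclidean_space. c :: real)"
  by (coinduction arbitrary: c) (auto simp: frechet_derivative_const)

lemma smooth_inner: "smooth_fun (\<lambda>x::'a::euclidean_space. x \<bullet> v)"
proof -
  have "((\<lambda>x. x \<bullet> v) has_derivative (\<lambda>h. h \<bullet> v)) (at x)" for x :: 'a
    by (auto intro!: derivative_eq_intros)
  then have "frechet_derivative (\<lambda>x::'a. x \<bullet> v) (at x) = (\<lambda>h. h \<bullet> v)"
    "(\<lambda>x::'a. x \<bullet> v) differentiable (at x)" for x :: 'a
    by (auto simp: frechet_derivative_at[symmetric] differentiable_def)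
  then show ?thesis
    by (intro smooth_fun.intros) (auto simp: smooth_const)
qed

lemma smooth_scale_diff:
  "smooth_fun f \<Longrightarrow> smooth_fun (\<lambda>x. c * f x)"
  "smooth_fun f \<Longrightarrow> smooth_fun g \<Longrightarrow> smooth_fun (\<lambda>x. f x - g x)"
proof -
  show *: "smooth_fun f \<Longrightarrow> smooth_fun (\<lambda>x. c * f x)" for c and f :: "'a \<Rightarrow> real"
    by (intro smooth_mult smooth_const)
  assume "smooth_fun f" "smooth_fun g"
  from smooth_add[OF this(1) *[OF this(2), of "-1"]] show "smooth_fun (\<lambda>x. f x - g x)"
    by simp
qed

section \<open>The flat function exp (- 1 / t) and the radial cut-off built from it\<close>

definition flat_exp :: "nat \<Rightarrow> real \<Rightarrow> real" where
  "flat_exp k t = (if t > 0 then inverse t ^ k * exp (- inverse t) else 0)"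

lemma flat_exp_tendsto_0: "(flat_exp k \<longlongrightarrow> 0) (at 0)"
proof -
  have "((\<lambda>y. y ^ k / exp y) \<longlongrightarrow> 0) (at_top :: real filter)"
    by (rule tendsto_power_div_exp_0)
  then have "((\<lambda>t. inverse t ^ k / exp (inverse t)) \<longlongrightarrow> 0) (at_right (0::real))"
    by (rule filterlim_compose) (rule filterlim_inverse_at_top_right)
  then have R: "(flat_exp k \<longlongrightarrow> 0) (at_right 0)"
    by (rule Lim_transform_eventually)
       (auto simp: eventually_at_right_field flat_exp_def exp_minus divide_inverse intro: exI[of _ 1])
  have "(flat_exp k \<longlongrightarrow> 0) (at_left 0)"
    by (rule Lim_transform_eventually[of "\<lambda>_. 0"])
       (auto simp: eventually_at_left_field flat_exp_def intro: exI[of _ "-1"])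
  with R show ?thesis
    by (simp add: filterlim_split_at)
qed

text \<open>The classical flat function is \<open>flat_exp 0\<close>; the powers of
  \<open>inverse t\<close> are carried along because differentiation leads to them, and the whole
  family is closed under differentiation up to linear combinations.\<close>

lemma flat_exp_deriv:
  "(flat_exp k has_real_derivative (- real k * flat_exp (Suc k) t + flat_exp (k + 2) t)) (at t)"
proof -
  consider "t > 0" | "t < 0" | "t = 0" by linarith
  then show ?thesis
  proof cases
    case 1
    have "((\<lambda>t. inverse t ^ k * exp (- inverse t)) has_real_derivative
         real k * inverse t ^ (k - 1) * (- (inverse t)\<^sup>2) * exp (- inverse t)
         + inverse t ^ k * (exp (- inverse t) * (inverse t)\<^sup>2)) (at t)"
      using 1 by (auto intro!: derivative_eq_intros simp: power2_eq_square)
    also have "real k * inverse t ^ (k - 1) * (- (inverse t)\<^sup>2) = - real k * inverse t ^ Suc k"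
      by (cases k) (auto simp: power2_eq_square algebra_simps)
    finally have "((\<lambda>t. inverse t ^ k * exp (- inverse t)) has_real_derivative
         (- real k * flat_exp (Suc k) t + flat_exp (k + 2) t)) (at t)"
      using 1 by (simp add: flat_exp_def power2_eq_square algebra_simps)
    then show ?thesis
      by (rule has_field_derivative_transform_within_open[where S="{0<..}"])
         (use 1 in \<open>auto simp: flat_exp_def\<close>)
  next
    case 2
    have "((\<lambda>t::real. 0) has_real_derivative 0) (at t)" by auto
    then have "(flat_exp k has_real_derivative 0) (at t)"
      by (rule has_field_derivative_transform_within_open[where S="{..<0}"])
         (use 2 in \<open>auto simp: flat_exp_def\<close>)
    with 2 show ?thesis by (simp add: flat_exp_def)
  next
    case 3
    \<comment> \<open>The difference quotient of \<open>flat_exp k\<close> at 0 is exactly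
      \<open>flat_exp (Suc k)\<close>, so its limit is already known.\<close>
    have "((\<lambda>h. flat_exp (Suc k) h) \<longlongrightarrow> 0) (at 0)" by (rule flat_exp_tendsto_0)
    then have "((\<lambda>h. (flat_exp k h - flat_exp k 0) / (h - 0)) \<longlongrightarrow> 0) (at 0)"
      by (rule Lim_transform_eventually)
         (auto simp: eventually_at_filter flat_exp_def divide_inverse)
    then show ?thesis
      unfolding 3 has_field_derivative_iff by (simp add: flat_exp_def)
  qed
qed

text \<open>The factor 4 confines the function to the ball of radius 1/2, and \<open>exp 1\<close>
  normalises its value at the origin to 1. Depending on x only through the polynomial
  \<open>x \<bullet> x\<close>, it is radial and smooth at the origin as well.\<close>

definition bump :: "'a::euclidean_space \<Rightarrow> real" where
  "bump x = exp 1 * flat_exp 0 (1 - 4 * (x \<bullet> x))"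

lemma smooth_bump: "smooth_fun (bump :: 'a::euclidean_space \<Rightarrow> real)"
proof -
  let ?F = "\<lambda>k (x::'a). flat_exp k (1 - 4 * (x \<bullet> x))"
  \<comment> \<open>The chain rule produces constants and the factors
    \<open>- 8 * (x \<bullet> i)\<close>, so polynomials must be among the generators; taking all
    smooth functions covers them.\<close>
  let ?X = "range ?F \<union> {f. smooth_fun f}"
  have d: "(?F k has_derivative (\<lambda>h. (- real k * ?F (Suc k) x + ?F (k + 2) x) * (- 8 * (x \<bullet> h)))) (at x)"
    for k x
  proof -
    have "((\<lambda>x::'a. 1 - 4 * (x \<bullet> x)) has_derivative (\<lambda>h. - 8 * (x \<bullet> h))) (at x)"
      by (auto intro!: derivative_eq_intros simp: inner_commute)
    from has_derivative_compose[OF this flat_exp_deriv[of k, unfolded has_field_derivative_def]]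
    show ?thesis by simp
  qed
  have der: "frechet_derivative (?F k) (at x) h = (- real k * ?F (Suc k) x + ?F (k + 2) x) * (- 8 * (x \<bullet> h))"
    for k x h
    by (rule fun_cong[OF frechet_derivative_at[OF d[of k x]], of h, symmetric])
  have mem: "?F k \<in> ring_gen ?X" for k
    by (rule ring_gen.base) blast
  have mem': "f \<in> ring_gen ?X" if "smooth_fun f" for f
    by (rule ring_gen.base) (use that in blast)
  have "smooth_fun (?F k)" for k
  proof (rule ring_gen_smooth[of ?X])
    fix f x assume "f \<in> ?X"
    then consider k where "f = ?F k" | "smooth_fun f" by auto
    then show "f differentiable (at x)"
      by cases (use d smooth_differentiable in \<open>auto simp: differentiable_def\<close>)
  next
    fix f and i :: 'a assume f: "f \<in> ?X" and i: "i \<in> Basis"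
    show "(\<lambda>x. frechet_derivative f (at x) i) \<in> ring_gen ?X"
    proof (cases "smooth_fun f")
      case True
      then show ?thesis using smooth_partial[OF _ i] mem' by blast
    next
      case False
      with f obtain k where k: "f = ?F k" by auto
      have "(\<lambda>x. (- real k * ?F (Suc k) x + ?F (k + 2) x) * (- 8 * (x \<bullet> i))) \<in> ring_gen ?X"
        by (intro ring_gen.add ring_gen.mult mem mem'[OF smooth_const] mem'[OF smooth_inner])
      then show ?thesis unfolding k der .
    qed
  qed (rule mem)
  from smooth_mult[OF smooth_const this] show ?thesis
    unfolding bump_def[abs_def] .
qed

lemma bump_range: "0 \<le> bump x" "bump x \<le> 1"
proof -
  have "exp 1 * exp (- inverse t) \<le> (1::real)" if "0 < t" "t \<le> 1" for t :: real
    using that one_le_inverse[of t] by (simp flip: exp_add)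
  then show "0 \<le> bump x" "bump x \<le> 1"
    by (auto simp: bump_def flat_exp_def)
qed

lemma bump_0 [simp]: "bump 0 = 1"
  by (simp add: bump_def flat_exp_def flip: exp_add)

lemma bump_outside: "1/2 \<le> norm x \<Longrightarrow> bump x = 0"
  using power_mono[of "1/2" "norm x" 2]
  by (simp add: bump_def flat_exp_def power2_norm_eq_inner power_divide)

lemma radial_bump: "radial bump"
  by (auto simp: radial_def bump_def norm_eq)

section \<open>Smooth functions of compact support\<close>

lemma smooth_continuous: "smooth_fun f \<Longrightarrow> continuous_on A f"
  by (meson continuous_at_imp_continuous_on differentiable_imp_continuous_within smooth_differentiable)

lemma Cc_inf_continuous: "f \<in> Cc_inf U \<Longrightarrow> continuous_on A f"
  by (auto simp: Cc_inf_def smooth_continuous)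

lemma Cc_inf_measurable: "f \<in> Cc_inf U \<Longrightarrow> f \<in> borel_measurable borel"
  using Cc_inf_continuous borel_measurable_continuous_onI by blast

lemma Cc_inf_supportI:
  assumes "smooth_fun f" "compact K" "K \<subseteq> U" "\<And>x. x \<notin> K \<Longrightarrow> f x = 0"
  shows "f \<in> Cc_inf U"
proof -
  have "closure {x. f x \<noteq> 0} \<subseteq> K"
    using assms by (intro closure_minimal compact_imp_closed) auto
  then show ?thesis
    using assms compact_Int_closed[OF assms(2) closed_closure, of "{x. f x \<noteq> 0}"]
    unfolding Cc_inf_def by (auto simp: inf.absorb2)
qed

lemma Cc_inf_support:
  assumes "f \<in> Cc_inf U"
  shows "\<exists>K. compact K \<and> K \<subseteq> U \<and> (\<forall>x. x \<notin> K \<longrightarrow> f x = 0)"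
  using assms closure_subset[of "{x. f x \<noteq> 0}"] unfolding Cc_inf_def
  by (intro exI[of _ "closure {x. f x \<noteq> 0}"]) auto

lemma Cc_inf_outside: "f \<in> Cc_inf U \<Longrightarrow> x \<notin> U \<Longrightarrow> f x = 0"
  using Cc_inf_support by blast

lemma Cc_inf_smooth: "f \<in> Cc_inf U \<Longrightarrow> smooth_fun f"
  by (simp add: Cc_inf_def)

lemma Cc_inf_lincomb:
  assumes "f \<in> Cc_inf U" "g \<in> Cc_inf U"
  shows "(\<lambda>x. a * f x + b * g x) \<in> Cc_inf U"
proof -
  obtain K where K: "compact K" "K \<subseteq> U" "\<forall>x. x \<notin> K \<longrightarrow> f x = 0"
    using Cc_inf_support[OF assms(1)] by blast
  obtain L where L: "compact L" "L \<subseteq> U" "\<forall>x. x \<notin> L \<longrightarrow> g x = 0"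
    using Cc_inf_support[OF assms(2)] by blast
  show ?thesis
    by (rule Cc_inf_supportI[of _ "K \<union> L"])
       (use K L assms in \<open>auto intro!: smooth_add smooth_scale_diff dest: Cc_inf_smooth\<close>)
qed

lemma bump_mult_Cc_inf:
  assumes "f \<in> Cc_inf U" "U \<subseteq> V"
  shows "(\<lambda>x. bump x * f x) \<in> Cc_inf V"
proof -
  obtain K where K: "compact K" "K \<subseteq> U" "\<forall>x. x \<notin> K \<longrightarrow> f x = 0"
    using Cc_inf_support[OF assms(1)] by blast
  show ?thesis
    using K assms(2)
    by (intro Cc_inf_supportI[of _ "K"] smooth_mult smooth_bump Cc_inf_smooth[OF assms(1)]) auto
qed

lemma bump_Cc_inf: "bump \<in> Cc_inf unitB"
  by (rule Cc_inf_supportI[of _ "cball 0 (1/2)"]) (auto simp: smooth_bump bump_outside)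

lemma Cc_inf_bounded:
  assumes "f \<in> Cc_inf U"
  shows "\<exists>M>0. \<forall>x. \<bar>f x\<bar> \<le> M"
proof -
  obtain K where K: "compact K" "K \<subseteq> U" "\<forall>x. x \<notin> K \<longrightarrow> f x = 0"
    using Cc_inf_support[OF assms(1)] by blast
  have "bounded (f ` K)"
    using K(1) Cc_inf_continuous[OF assms] by (intro compact_imp_bounded compact_continuous_image)
  then obtain M where M: "M > 0" "\<forall>y\<in>f`K. norm y \<le> M"
    unfolding bounded_pos by blast
  then have "\<bar>f x\<bar> \<le> M" for x
    using K(3) by (cases "x \<in> K") auto
  with M(1) show ?thesis
    by blast
qed

lemma Cc_inf_partial:
  assumes "f \<in> Cc_inf U" "i \<in> Basis"
  shows "(\<lambda>x. frechet_derivative f (at x) i) \<in> Cc_inf U"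
proof -
  obtain K where K: "compact K" "K \<subseteq> U" "\<forall>x. x \<notin> K \<longrightarrow> f x = 0"
    using Cc_inf_support[OF assms(1)] by blast
  show ?thesis
  proof (rule Cc_inf_supportI[of _ K])
    fix x assume x: "x \<notin> K"
    have "((\<lambda>_. 0) has_derivative (\<lambda>_. 0)) (at x)" by simp
    then have "(f has_derivative (\<lambda>_. 0)) (at x)"
      by (rule has_derivative_transform_within_open[of _ _ _ UNIV "- K"])
         (use K x compact_imp_closed in auto)
    from fun_cong[OF frechet_derivative_at[OF this]] show "frechet_derivative f (at x) i = 0"
      by simp
  qed (use K assms in \<open>auto intro: smooth_partial dest: Cc_inf_smooth\<close>)
qed

text \<open>The partial derivatives are again in \<open>Cc_inf U\<close>, hence bounded, and the
  mean value inequality applies on the whole space.\<close>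

lemma Cc_inf_Lipschitz:
  assumes f: "f \<in> Cc_inf U"
  obtains L where "L > 0" "\<And>x y. \<bar>f x - f y\<bar> \<le> L * norm (x - y)"
proof -
  have "\<forall>i\<in>Basis. \<exists>M. \<forall>x. \<bar>frechet_derivative f (at x) i\<bar> \<le> M"
    using Cc_inf_bounded[OF Cc_inf_partial[OF f]] by blast
  then obtain M where M: "\<And>i x. i \<in> Basis \<Longrightarrow> \<bar>frechet_derivative f (at x) i\<bar> \<le> M i"
    by (metis (no_types, lifting))
  define L where "L = (\<Sum>i\<in>Basis. M i) + 1"
  have L0: "L > 0"
    unfolding L_def using M by (intro add_nonneg_pos sum_nonneg) (auto intro: order_trans[OF abs_ge_zero])
  have "norm (f x - f y) \<le> L * norm (x - y)" for x y
  proof (rule differentiable_bound[of UNIV f "\<lambda>x. frechet_derivative f (at x)"])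
    fix z
    have d: "(f has_derivative frechet_derivative f (at z)) (at z)"
      using frechet_derivative_works smooth_differentiable[OF Cc_inf_smooth[OF f]] by blast
    then show "(f has_derivative frechet_derivative f (at z)) (at z within UNIV)" by simp
    interpret bounded_linear "frechet_derivative f (at z)"
      using d has_derivative_bounded_linear by blast
    have "\<bar>frechet_derivative f (at z) v\<bar> \<le> L * norm v" for v
    proof -
      have "frechet_derivative f (at z) v = (\<Sum>i\<in>Basis. (v \<bullet> i) * frechet_derivative f (at z) i)"
        by (subst euclidean_representation[of v, symmetric]) (simp add: sum scaleR)
      also have "\<bar>\<dots>\<bar> \<le> (\<Sum>i\<in>Basis. norm v * M i)"
        by (rule order_trans[OF sum_abs]) (auto simp: abs_mult intro!: sum_mono mult_mono M Basis_le_norm)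
      also have "\<dots> = norm v * sum M Basis"
        by (rule sum_distrib_left[symmetric])
      also have "\<dots> \<le> L * norm v"
        unfolding mult.commute[of L "norm v"] by (rule mult_left_mono) (auto simp: L_def)
      finally show ?thesis .
    qed
    then show "onorm (frechet_derivative f (at z)) \<le> L"
      by (intro onorm_bound) (use L0 in auto)
  qed auto
  with L0 show thesis by (intro that) auto
qed

section \<open>Kernel and energy as an integral over pairs\<close>

lemma ball_borel_measurable [measurable]:
  "ball c r \<in> sets borel" "cball c r \<in> sets borel" for c :: "'a::metric_space"
  by (auto intro: borel_open borel_closed)

section \<open>Invariance of Lebesgue measure\<close>

lemma nn_integral_lborel_translate:
  fixes a :: "'a::euclidean_space"
  assumes [measurable]: "f \<in> borel_measurable borel"
  shows "(\<integral>\<^sup>+x. f (x + a) \<partial>lborel) = (\<integral>\<^sup>+x. f x \<partial>lborel)"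
proof -
  have "(\<integral>\<^sup>+x. f x \<partial>lborel) = (\<integral>\<^sup>+x. f x \<partial>distr lborel borel ((+) a))"
    by (simp add: lborel_distr_plus)
  then show ?thesis
    by (simp add: nn_integral_distr add.commute)
qed

lemma emeasure_lborel_ball:
  fixes c :: "'a::euclidean_space"
  shows "r \<ge> 0 \<Longrightarrow> emeasure lborel (ball c r) = ennreal (unit_ball_vol (real DIM('a)) * r ^ DIM('a))"
    and "r \<ge> 0 \<Longrightarrow> emeasure lborel (cball c r) = ennreal (unit_ball_vol (real DIM('a)) * r ^ DIM('a))"
  by (simp_all add: emeasure_ball emeasure_cball)

text \<open>A double count avoids determinants. The measure of the pairs (x, y) with T x in A and y
  within distance 1 of T x is computed twice. Integrating over y first gives the image measure of A
  times the volume of the unit ball. Shifting x by a preimage of y and then exchanging the order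
  gives the Lebesgue measure of A times the same volume, because T preserves the norm.\<close>

lemma orthogonal_distr_lborel:
  fixes T :: "'a::euclidean_space \<Rightarrow> 'a"
  assumes T: "orthogonal_transformation T"
  shows "distr lborel borel T = lborel"
proof (rule measure_eqI)
  have lin: "linear T" and nT: "norm (T x) = norm x" for x
    using T by (auto simp: orthogonal_transformation)
  have [measurable]: "T \<in> borel_measurable borel"
    using lin by (intro borel_measurable_continuous_onI linear_continuous_on) (simp add: linear_conv_bounded_linear)
  obtain S where S: "\<And>y. T (S y) = y"
    using orthogonal_transformation_surj[OF T] by (metis surjD)
  fix A :: "'a set" assume "A \<in> sets (distr lborel borel T)"
  then have [measurable]: "A \<in> sets borel" by simp
  let ?b = "ball 0 1 :: 'a set"
  let ?J = "\<integral>\<^sup>+y. \<integral>\<^sup>+x. indicator A (T x) * indicator ?b (y - T x) \<partial>lborel \<partial>lborel :: ennreal"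
  have "?J = (\<integral>\<^sup>+x. \<integral>\<^sup>+y. indicator A (T x) * indicator ?b (y - T x) \<partial>lborel \<partial>lborel)"
    by (subst lborel_pair.Fubini') simp_all
  also have "\<dots> = (\<integral>\<^sup>+x. indicator A (T x) * emeasure lborel ?b \<partial>lborel)"
  proof (intro nn_integral_cong)
    fix x
    have "(\<integral>\<^sup>+y. indicator ?b (y - T x) \<partial>lborel) = emeasure lborel ?b"
      using nn_integral_lborel_translate[of "indicator ?b" "- T x"] by simp
    then show "(\<integral>\<^sup>+y. indicator A (T x) * indicator ?b (y - T x) \<partial>lborel) = indicator A (T x) * emeasure lborel ?b"
      by (simp add: nn_integral_cmult)
  qed
  also have "\<dots> = emeasure (distr lborel borel T) A * emeasure lborel ?b"
    using nn_integral_distr[of T lborel borel "indicator A"] by (simp add: nn_integral_multc)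
  finally have 1: "?J = emeasure (distr lborel borel T) A * emeasure lborel ?b" .
  have "?J = (\<integral>\<^sup>+y. \<integral>\<^sup>+x. indicator A (T x + y) * indicator ?b x \<partial>lborel \<partial>lborel)"
  proof (rule nn_integral_cong)
    fix y
    have "(\<integral>\<^sup>+x. indicator A (T x) * indicator ?b (y - T x) \<partial>lborel)
        = (\<integral>\<^sup>+x. indicator A (T (x + S y)) * indicator ?b (y - T (x + S y)) \<partial>lborel :: ennreal)"
      by (rule nn_integral_lborel_translate[symmetric]) simp
    then show "(\<integral>\<^sup>+x. indicator A (T x) * indicator ?b (y - T x) \<partial>lborel)
        = (\<integral>\<^sup>+x. indicator A (T x + y) * indicator ?b x \<partial>lborel :: ennreal)"
      by (simp add: linear_add[OF lin] S indicator_def nT)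
  qed
  also have "\<dots> = (\<integral>\<^sup>+x. \<integral>\<^sup>+y. indicator A (T x + y) * indicator ?b x \<partial>lborel \<partial>lborel)"
    by (subst lborel_pair.Fubini') simp_all
  also have "\<dots> = (\<integral>\<^sup>+x. emeasure lborel A * indicator ?b x \<partial>lborel)"
  proof (intro nn_integral_cong)
    fix x
    have "(\<integral>\<^sup>+y. indicator A (T x + y) \<partial>lborel) = emeasure lborel A"
      using nn_integral_lborel_translate[of "indicator A" "T x"] by (simp add: add.commute)
    then show "(\<integral>\<^sup>+y. indicator A (T x + y) * indicator ?b x \<partial>lborel) = emeasure lborel A * indicator ?b x"
      by (simp add: nn_integral_multc)
  qed
  also have "\<dots> = emeasure lborel A * emeasure lborel ?b"
    by (simp add: nn_integral_cmult)
  finally have "emeasure (distr lborel borel T) A * emeasure lborel ?b = emeasure lborel A * emeasure lborel ?b"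
    using 1 by simp
  moreover have "emeasure lborel ?b \<noteq> 0" "emeasure lborel ?b \<noteq> \<infinity>"
    using unit_ball_vol_pos[of "real DIM('a)"]
    by (simp_all add: emeasure_lborel_ball del: unit_ball_vol_pos)
  ultimately show "emeasure (distr lborel borel T) A = emeasure lborel A"
    by (subst (asm) (1 2) mult.commute) (simp add: ennreal_mult_cancel_left)
qed simp

text \<open>The reflection along \<open>a - b\<close> exchanges two vectors of equal length.\<close>

lemma orthogonal_transformation_between:
  fixes a b :: "'a::euclidean_space"
  assumes "norm a = norm b"
  obtains T where "orthogonal_transformation T" "T a = b"
proof (cases "a = b")
  case True
  then show ?thesis using that[of id] by (simp add: orthogonal_transformation_id id_def)
next
  case False
  define n where "n = a - b"
  have nn: "n \<bullet> n \<noteq> 0" using False by (simp add: n_def)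
  have ab: "a \<bullet> a = b \<bullet> b" using assms by (simp add: norm_eq)
  define T where "T v = v - (2 * (v \<bullet> n) / (n \<bullet> n)) *\<^sub>R n" for v
  have "linear T"
    by (rule linearI) (simp_all add: T_def algebra_simps inner_simps add_divide_distrib)
  moreover have "T v \<bullet> T w = v \<bullet> w" for v w
    using nn by (simp add: T_def inner_simps inner_commute field_simps)
  ultimately have "orthogonal_transformation T"
    by (simp add: orthogonal_transformation_def)
  moreover have "2 * (a \<bullet> n) = n \<bullet> n"
    using ab by (simp add: n_def inner_simps inner_commute)
  then have "T a = b"
    using nn by (simp add: T_def) (simp add: n_def)
  ultimately show ?thesis using that by blast
qed

lemma nn_integral_lborel_orthogonal:
  fixes T :: "'a::euclidean_space \<Rightarrow> 'a"
  assumes T: "orthogonal_transformation T" and [measurable]: "f \<in> borel_measurable borel"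
  shows "(\<integral>\<^sup>+x. f (T x) \<partial>lborel) = (\<integral>\<^sup>+x. f x \<partial>lborel)"
proof -
  have [measurable]: "T \<in> borel_measurable borel"
    using orthogonal_transformation_linear[OF T]
    by (intro borel_measurable_continuous_onI linear_continuous_on) (simp add: linear_conv_bounded_linear)
  have "(\<integral>\<^sup>+x. f x \<partial>lborel) = (\<integral>\<^sup>+x. f x \<partial>distr lborel borel T)"
    by (simp add: orthogonal_distr_lborel[OF T])
  then show ?thesis
    by (simp add: nn_integral_distr)
qed

definition frac_ker :: "real \<Rightarrow> 'a::euclidean_space \<Rightarrow> real" where
  "frac_ker s z = norm z powr - (real DIM('a) + 2 * s)"

lemma frac_ker_measurable [measurable]: "frac_ker s \<in> borel_measurable borel"
  unfolding frac_ker_def by measurable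

lemma frac_ker_nonneg [simp]: "0 \<le> frac_ker s z"
  by (simp add: frac_ker_def)

lemma frac_ker_minus: "frac_ker s (x - y) = frac_ker s (y - x)"
  by (simp add: frac_ker_def norm_minus_commute)

lemma frac_ker_divide: "a / norm (x - y :: 'a) powr (real DIM('a::euclidean_space) + 2 * s) = a * frac_ker s (x - y)"
  unfolding frac_ker_def powr_minus divide_inverse ..

lemma frac_ker_antimono:
  fixes z w :: "'a::euclidean_space"
  assumes "0 < s" "0 < r" "r \<le> norm z"
  shows "frac_ker s z \<le> r powr - (real DIM('a) + 2 * s)"
  unfolding frac_ker_def using assms by (intro powr_mono2') auto

text \<open>Dyadic shells take the place of polar coordinates. A shell of radius r carries about
  \<open>r powr (2 - 2 * s)\<close> for r below 1 and \<open>r powr (- 2 * s)\<close> above, so the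
  two geometric series converge because of s < 1 and of 0 < s.\<close>

lemma frac_ker_truncated_finite:
  assumes s: "0 < s" "s < 1"
  shows "(\<integral>\<^sup>+z. ennreal (min 1 ((norm z)\<^sup>2) * frac_ker s (z::'a::euclidean_space)) \<partial>lborel) < \<infinity>"
proof -
  define n where "n = DIM('a)"
  define q where "q = real n + 2 * s"
  define w where "w = unit_ball_vol (real n)"
  have q: "q > 0" using s by (simp add: q_def)
  have w: "w \<ge> 0" by (simp add: w_def)
  have p2: "(2::real) ^ k = 2 powr k" "(1/2::real) ^ k = 2 powr - real k" for k
    by (rule powr_realpow[symmetric], simp) (simp only: powr_minus_divide powr_realpow power_one_over)
  \<comment> \<open>\<open>c k\<close> bounds the integrand where
    \<open>(1/2) ^ Suc k < norm z \<le> (1/2) ^ k\<close>, and \<open>d k\<close> where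
    \<open>2 ^ k \<le> norm z \<le> 2 ^ Suc k\<close>. The majorant uses full balls in place of
    shells; their volumes are of the same order.\<close>
  define c d where "c k = (1/4) ^ k * ((1/2) ^ Suc k) powr - q"
    and "d k = ((2::real) ^ k) powr - q" for k :: nat
  have ptw: "ennreal (min 1 ((norm z)\<^sup>2) * frac_ker s z)
      \<le> (\<Sum>k. ennreal (c k) * indicator (cball 0 ((1/2) ^ k)) z + ennreal (d k) * indicator (cball 0 (2 ^ Suc k)) z)"
    (is "?K z \<le> (\<Sum>k. ?g k z)") for z :: 'a
  proof -
    have le_sum: "?g k z \<le> (\<Sum>k. ?g k z)" for k
      using sum_le_suminf[OF summableI, of "{k}" "\<lambda>k. ?g k z"] by simp
    consider "z = 0" | "z \<noteq> 0" "norm z \<le> 1" | "norm z > 1" by linarith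
    then show ?thesis
    proof cases
      case 1 then show ?thesis by simp
    next
      case 2
      have ex: "\<exists>k. (1/2) ^ Suc k < norm z"
      proof -
        obtain k where k: "(1/2) ^ k < norm z"
          using real_arch_pow_inv[of "norm z" "1/2"] 2 by auto
        have "(1/2::real) ^ Suc k \<le> (1/2) ^ k" by simp
        with k have "(1/2) ^ Suc k < norm z" by linarith
        then show ?thesis ..
      qed
      define k where "k = (LEAST k. (1/2) ^ Suc k < norm z)"
      have k1: "(1/2) ^ Suc k < norm z" unfolding k_def by (rule LeastI_ex[OF ex])
      have k2: "norm z \<le> (1/2) ^ k"
      proof (cases k)
        case 0 then show ?thesis using 2 by simp
      next
        case (Suc j)
        then have "\<not> (1/2) ^ Suc j < norm z"
          using not_less_Least[of j "\<lambda>k. (1/2) ^ Suc k < norm z", folded k_def] by blast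
        then show ?thesis using Suc by simp
      qed
      have "min 1 ((norm z)\<^sup>2) \<le> (1/4) ^ k"
      proof -
        have "((1/2::real) ^ k)\<^sup>2 = (1/4) ^ k"
          by (simp add: power2_eq_square flip: power_mult_distrib)
        with power_mono[OF k2, of 2] show ?thesis by simp
      qed
      moreover have "frac_ker s z \<le> ((1/2) ^ Suc k) powr - q"
        using frac_ker_antimono[of s "(1/2) ^ Suc k" z] k1 s by (simp add: q_def n_def)
      ultimately have "?K z \<le> ennreal (c k)"
        unfolding c_def by (intro ennreal_leI mult_mono) auto
      also have "\<dots> \<le> ?g k z" using k2 by (simp add: add_increasing2)
      finally show ?thesis using le_sum order_trans by blast
    next
      case 3
      have ex: "\<exists>k. norm z \<le> 2 ^ Suc k"
      proof -
        obtain k where k: "norm z < 2 ^ k"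
          using real_arch_pow[of 2 "norm z"] by auto
        have "(2::real) ^ k \<le> 2 ^ Suc k" by simp
        with k have "norm z \<le> 2 ^ Suc k" by linarith
        then show ?thesis ..
      qed
      define k where "k = (LEAST k. norm z \<le> 2 ^ Suc k)"
      have k1: "norm z \<le> 2 ^ Suc k" unfolding k_def by (rule LeastI_ex[OF ex])
      have k2: "2 ^ k \<le> norm z"
      proof (cases k)
        case 0 then show ?thesis using 3 by simp
      next
        case (Suc j)
        then have "\<not> norm z \<le> 2 ^ Suc j"
          using not_less_Least[of j "\<lambda>k. norm z \<le> 2 ^ Suc k", folded k_def] by blast
        then show ?thesis using Suc by simp
      qed
      have "frac_ker s z \<le> (2 ^ k) powr - q"
        using frac_ker_antimono[of s "2 ^ k" z] k2 s by (simp add: q_def n_def)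
      then have "min 1 ((norm z)\<^sup>2) * frac_ker s z \<le> 1 * (2 ^ k) powr - q"
        by (intro mult_mono) auto
      then have "?K z \<le> ennreal (d k)"
        unfolding d_def by (intro ennreal_leI) simp
      also have "\<dots> \<le> ?g k z" using k1 by (simp add: add_increasing)
      finally show ?thesis using le_sum order_trans by blast
    qed
  qed
  have "(\<integral>\<^sup>+z. ?K z \<partial>lborel) \<le> (\<integral>\<^sup>+z. (\<Sum>k. ?g k z) \<partial>lborel)"
    by (intro nn_integral_mono ptw)
  also have "\<dots> = (\<Sum>k. \<integral>\<^sup>+z. ?g k z \<partial>lborel)"
    by (rule nn_integral_suminf) simp
  also have "\<dots> = (\<Sum>k. ennreal (c k * (w * ((1/2) ^ k) ^ n) + d k * (w * (2 ^ Suc k) ^ n)))"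
    by (intro suminf_cong)
       (simp add: nn_integral_add nn_integral_cmult emeasure_lborel_ball n_def w_def c_def d_def
         ennreal_mult[symmetric] ennreal_plus[symmetric] del: ennreal_plus)
  also have "\<dots> = (\<Sum>k. ennreal (w * 2 powr q * (2 powr (2 * s - 2)) ^ k + w * 2 ^ n * (2 powr (- 2 * s)) ^ k))"
  proof (intro suminf_cong arg_cong[where f=ennreal] arg_cong2[where f="(+)"])
    fix k
    have "c k * ((1/2) ^ k) ^ n = 2 powr (- 2 * real k) * 2 powr (q * (real k + 1)) * 2 powr (- (real k * real n))"
    proof -
      have "(1/4::real) ^ k = 2 powr (- 2 * real k)"
        using p2(2)[of "2 * k"] by (simp add: power_mult power2_eq_square)
      moreover have "((1/2::real) ^ Suc k) powr - q = 2 powr (q * (real k + 1))"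
        unfolding p2(2) powr_powr by (simp add: algebra_simps)
      moreover have "((1/2::real) ^ k) ^ n = 2 powr (- (real k * real n))"
        using p2(2)[of "k * n"] by (simp add: power_mult)
      ultimately show ?thesis unfolding c_def by metis
    qed
    also have "\<dots> = 2 powr q * 2 powr ((2 * s - 2) * real k)"
      by (simp flip: powr_add add: q_def algebra_simps)
    also have "\<dots> = 2 powr q * (2 powr (2 * s - 2)) ^ k"
      by (simp add: powr_powr flip: powr_realpow)
    finally show "c k * (w * ((1/2) ^ k) ^ n) = w * 2 powr q * (2 powr (2 * s - 2)) ^ k"
      by (simp add: mult_ac)
    have "(2 ^ k) powr - q = 2 powr (- (real k * q))"
      unfolding p2(1) powr_powr by simp
    moreover have "((2::real) ^ k) ^ n = 2 powr (real k * real n)"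
      using p2(1)[of "k * n"] by (simp add: power_mult)
    ultimately have "d k * (2 ^ k) ^ n = 2 powr (- (real k * q)) * 2 powr (real k * real n)"
      unfolding d_def by metis
    also have "\<dots> = 2 powr (- 2 * s * real k)"
      by (simp flip: powr_add add: q_def algebra_simps)
    also have "\<dots> = (2 powr (- 2 * s)) ^ k"
      by (simp add: powr_powr flip: powr_realpow)
    finally show "d k * (w * (2 ^ Suc k) ^ n) = w * 2 ^ n * (2 powr (- 2 * s)) ^ k"
      by (simp add: mult_ac power_mult_distrib)
  qed
  also have "\<dots> < \<infinity>"
  proof -
    have "2 powr (2 * s - 2) < (1::real)" "2 powr (- 2 * s) < (1::real)"
      using s by (simp_all add: powr_less_one)
    then have "summable (\<lambda>k. w * 2 powr q * (2 powr (2 * s - 2)) ^ k + w * 2 ^ n * (2 powr (- 2 * s)) ^ k)"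
      by (intro summable_add summable_mult summable_geometric) auto
    then show ?thesis
      using w by (subst suminf_ennreal2) auto
  qed
  finally show ?thesis .
qed

section \<open>The energy norm as an \<open>L\<^sup>2\<close>-norm over pairs of points\<close>

definition aux_ball :: "'a::euclidean_space set" where
  "aux_ball = ball (3 *\<^sub>R (SOME i. i \<in> Basis)) 1"

text \<open>On functions supported in the unit ball the \<open>L\<^sup>2\<close> part of the norm is an integral of
  squared differences too: \<open>y\<close> ranges over a second ball, on which the function vanishes.
  Thus \<open>Hsq\<close> is the \<open>L\<^sup>2\<close>-norm of \<open>u x - u y\<close> for a single measure on pairs.\<close>

definition pair_weight :: "real \<Rightarrow> 'a::euclidean_space \<times> 'a \<Rightarrow> real" where
  "pair_weight s z = cNs DIM('a) s / 2 * frac_ker s (fst z - snd z) * indicator unitB (fst z) * indicator unitB (snd z)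
     + indicator unitB (fst z) * indicator aux_ball (snd z) / unit_ball_vol (real DIM('a))"

definition pairM :: "real \<Rightarrow> ('a::euclidean_space \<times> 'a) measure" where
  "pairM s = density (lborel \<Otimes>\<^sub>M lborel) (\<lambda>z. ennreal (pair_weight s z))"

definition dif :: "('a \<Rightarrow> real) \<Rightarrow> 'a \<times> 'a \<Rightarrow> real" where
  "dif u z = u (fst z) - u (snd z)"

lemma sets_pairM [simp, measurable_cong]: "sets (pairM s) = sets (borel \<Otimes>\<^sub>M borel)"
  by (simp add: pairM_def cong: sets_pair_measure_cong)

lemma space_pairM [simp]: "space (pairM s) = UNIV"
  by (simp add: pairM_def space_pair_measure)

lemma aux_ball_measurable [measurable]: "aux_ball \<in> sets borel"
  by (simp add: aux_ball_def)

lemma pair_weight_measurable [measurable]: "pair_weight s \<in> borel_measurable (borel \<Otimes>\<^sub>M borel)"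
  unfolding pair_weight_def by measurable

lemma dif_measurable [measurable]:
  assumes [measurable]: "u \<in> borel_measurable borel"
  shows "dif u \<in> borel_measurable (borel \<Otimes>\<^sub>M borel)"
  unfolding dif_def[abs_def] by measurable

text \<open>The centre has norm 3 and the radius is 1, so all its points have norm above 2.\<close>

lemma aux_ball_disjoint: "x \<in> aux_ball \<Longrightarrow> x \<notin> (unitB :: 'a::euclidean_space set)"
proof -
  define i :: 'a where "i = (SOME i. i \<in> Basis)"
  have "i \<in> Basis" unfolding i_def by (simp add: some_in_eq)
  then have n: "norm (3 *\<^sub>R i) = 3" by simp
  assume "x \<in> aux_ball"
  then have "norm (3 *\<^sub>R i - x) < 1" by (simp add: aux_ball_def i_def dist_norm)
  then show ?thesis using norm_triangle_ineq2[of "3 *\<^sub>R i" x] n by (simp add: not_less)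
qed

lemma cNs_pos: "0 < s \<Longrightarrow> s < 1 \<Longrightarrow> 0 < cNs n s"
  unfolding cNs_def by (intro divide_pos_pos mult_pos_pos Gamma_real_pos) (auto intro: add_nonneg_pos)

lemma Qf_pair:
  fixes u :: "'a::euclidean_space \<Rightarrow> real"
  assumes [measurable]: "u \<in> borel_measurable borel" "U \<in> sets borel" and s: "0 < s" "s < 1"
  shows "Qf s U u = (\<integral>\<^sup>+z. ennreal ((dif u z)\<^sup>2 * (cNs DIM('a) s / 2 * frac_ker s (fst z - snd z)
            * indicator U (fst z) * indicator U (snd z))) \<partial>(lborel \<Otimes>\<^sub>M lborel))"
proof -
  have c: "cNs DIM('a) s / 2 \<ge> 0" using cNs_pos[OF s, of "DIM('a)"] by simp
  have "Qf s U u = (\<integral>\<^sup>+x. (\<integral>\<^sup>+y. ennreal ((dif u (x, y))\<^sup>2 * (cNs DIM('a) s / 2 * frac_ker s (x - y)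
            * indicator U x * indicator U y)) \<partial>lborel) \<partial>lborel)"
    unfolding Qf_def frac_ker_divide
    apply (subst nn_integral_cmult[symmetric], measurable)
    apply (intro nn_integral_cong)
    apply (subst nn_integral_multc[symmetric], measurable)
    apply (subst nn_integral_cmult[symmetric], measurable)
    apply (intro nn_integral_cong)
    using c by (simp add: dif_def ennreal_mult[symmetric] indicator_def mult_ac)
  also have "\<dots> = (\<integral>\<^sup>+z. ennreal ((dif u z)\<^sup>2 * (cNs DIM('a) s / 2 * frac_ker s (fst z - snd z)
            * indicator U (fst z) * indicator U (snd z))) \<partial>(lborel \<Otimes>\<^sub>M lborel))"
    by (subst lborel.nn_integral_fst[symmetric]) (simp_all add: dif_def)
  finally show ?thesis .
qed

lemma Hsq_pair:
  fixes u :: "'a::euclidean_space \<Rightarrow> real"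
  assumes m [measurable]: "u \<in> borel_measurable borel" and s: "0 < s" "s < 1"
    and out: "\<And>x. x \<notin> unitB \<Longrightarrow> u x = 0"
  shows "Hsq s u = (\<integral>\<^sup>+z. ennreal ((dif u z)\<^sup>2) \<partial>pairM s)"
proof -
  let ?v = "unit_ball_vol (real DIM('a))"
  have c: "cNs DIM('a) s / 2 \<ge> 0" using cNs_pos[OF s, of "DIM('a)"] by simp
  have v: "?v > 0" by simp
  have u0: "u y = 0" if "y \<in> aux_ball" for y
    using aux_ball_disjoint[OF that] by (rule out)
  let ?W = "\<lambda>z::'a\<times>'a. indicator unitB (fst z) * indicator aux_ball (snd z) / ?v"
  have "(\<integral>\<^sup>+z. ennreal ((dif u z)\<^sup>2) \<partial>pairM s)
      = (\<integral>\<^sup>+z. ennreal (pair_weight s z) * ennreal ((dif u z)\<^sup>2) \<partial>(lborel \<Otimes>\<^sub>M lborel))"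
    unfolding pairM_def by (rule nn_integral_density) auto
  also have "\<dots> = (\<integral>\<^sup>+z. ennreal ((dif u z)\<^sup>2 * (cNs DIM('a) s / 2 * frac_ker s (fst z - snd z)
            * indicator unitB (fst z) * indicator unitB (snd z))) + ennreal ((dif u z)\<^sup>2 * ?W z) \<partial>(lborel \<Otimes>\<^sub>M lborel))"
    using c v
    by (intro nn_integral_cong)
       (simp add: pair_weight_def distrib_left distrib_right mult.commute flip: ennreal_mult ennreal_plus)
  also have "\<dots> = Qf s unitB u + (\<integral>\<^sup>+z. ennreal ((dif u z)\<^sup>2 * ?W z) \<partial>(lborel \<Otimes>\<^sub>M lborel))"
    by (subst nn_integral_add) (simp_all add: Qf_pair[OF m _ s])
  \<comment> \<open>On this part of the weight \<open>u\<close> vanishes at the second point, so the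
    squared difference is \<open>(u x)\<^sup>2\<close>, and the weight integrates to 1 over the
    second point.\<close>
  also have "(\<integral>\<^sup>+z. ennreal ((dif u z)\<^sup>2 * ?W z) \<partial>(lborel \<Otimes>\<^sub>M lborel))
      = (\<integral>\<^sup>+x. \<integral>\<^sup>+y. ennreal ((u x)\<^sup>2) * indicator unitB x * (ennreal (1 / ?v) * indicator aux_ball (y::'a)) \<partial>lborel \<partial>lborel)"
    apply (subst lborel.nn_integral_fst[symmetric], measurable)
    apply (rule nn_integral_cong, rule nn_integral_cong)
    using v u0 by (auto simp: dif_def indicator_def ennreal_mult[symmetric] divide_inverse)
  also have "\<dots> = (\<integral>\<^sup>+x. ennreal ((u x)\<^sup>2) * indicator unitB x \<partial>lborel)"
  proof (intro nn_integral_cong)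
    fix x :: 'a
    have "(\<integral>\<^sup>+y. ennreal (1 / ?v) * indicator aux_ball (y::'a) \<partial>lborel) = 1"
      by (simp add: nn_integral_cmult aux_ball_def emeasure_lborel_ball v[THEN less_imp_neq, symmetric] flip: ennreal_mult)
    then show "(\<integral>\<^sup>+y. ennreal ((u x)\<^sup>2) * indicator unitB x * (ennreal (1 / ?v) * indicator aux_ball (y::'a)) \<partial>lborel)
        = ennreal ((u x)\<^sup>2) * indicator unitB x"
      by (subst nn_integral_cmult) simp_all
  qed
  finally show ?thesis
    by (simp add: Hsq_def add.commute)
qed

text \<open>If A is the exceptional null set, the pairs affected lie in
  \<open>A \<times> UNIV \<union> UNIV \<times> A\<close>, which is null for the product, hence for
  a measure with a density. This lets the results on square-integrable functions act on the
  energy.\<close>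

lemma AE_pairM_dif_tendsto:
  fixes u :: "'a::euclidean_space \<Rightarrow> real"
  assumes "AE x in lborel. (\<lambda>k. f k x) \<longlonglongrightarrow> u x"
  shows "AE z in pairM s. (\<lambda>k. dif (f k) z) \<longlonglongrightarrow> dif u z"
proof -
  obtain A where A: "\<And>x. x \<in> space lborel - A \<Longrightarrow> (\<lambda>k. f k x) \<longlonglongrightarrow> u x" "A \<in> null_sets lborel"
    using assms by (rule AE_E3) blast
  have "A \<times> UNIV \<in> null_sets (lborel \<Otimes>\<^sub>M lborel :: ('a \<times> 'a) measure)"
    "UNIV \<times> A \<in> null_sets (lborel \<Otimes>\<^sub>M lborel :: ('a \<times> 'a) measure)"
    using A(2) by (auto intro: lborel.times_in_null_sets1 lborel.times_in_null_sets2)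
  then have "A \<times> UNIV \<union> UNIV \<times> A \<in> null_sets (lborel \<Otimes>\<^sub>M lborel :: ('a \<times> 'a) measure)"
    by (rule null_sets.Un)
  then have "AE z in lborel \<Otimes>\<^sub>M lborel. z \<notin> A \<times> UNIV \<union> UNIV \<times> A"
    by (rule AE_not_in)
  then have "AE z in lborel \<Otimes>\<^sub>M lborel. (\<lambda>k. dif (f k) z) \<longlonglongrightarrow> dif u z"
    by (rule eventually_mono) (auto simp: dif_def intro!: tendsto_diff A(1))
  then show ?thesis
    unfolding pairM_def by (subst AE_density) (auto elim: eventually_mono)
qed

section \<open>Convergence in spaces of integrable functions\<close>

definition L2fun :: "'a measure \<Rightarrow> ('a \<Rightarrow> real) \<Rightarrow> bool" where
  "L2fun M F \<longleftrightarrow> F \<in> borel_measurable M \<and> integrable M (\<lambda>x. (F x)\<^sup>2)"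

lemma L2fun_measurable: "L2fun M F \<Longrightarrow> F \<in> borel_measurable M"
  and L2fun_integrable: "L2fun M F \<Longrightarrow> integrable M (\<lambda>x. (F x)\<^sup>2)"
  by (simp_all add: L2fun_def)

lemma L2fun_iff_nn_integral:
  "F \<in> borel_measurable M \<Longrightarrow> L2fun M F \<longleftrightarrow> (\<integral>\<^sup>+x. ennreal ((F x)\<^sup>2) \<partial>M) < \<infinity>"
  by (simp add: L2fun_def integrable_iff_bounded)

lemma L2fun_nn_integral:
  "L2fun M F \<Longrightarrow> (\<integral>\<^sup>+x. ennreal ((F x)\<^sup>2) \<partial>M) = ennreal (\<integral>x. (F x)\<^sup>2 \<partial>M)"
  by (rule nn_integral_eq_integral) (simp_all add: L2fun_def)

lemma L2fun_mult:
  assumes "L2fun M F" "L2fun M G"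
  shows "integrable M (\<lambda>x. F x * G x)"
proof (rule Bochner_Integration.integrable_bound)
  show "integrable M (\<lambda>x. (F x)\<^sup>2 + (G x)\<^sup>2)"
    using assms by (simp add: L2fun_def)
  show "(\<lambda>x. F x * G x) \<in> borel_measurable M"
    using assms by (auto simp: L2fun_def)
  have "\<bar>a * b\<bar> \<le> a\<^sup>2 + b\<^sup>2" for a b :: real
  proof -
    have "2 * (\<bar>a\<bar> * \<bar>b\<bar>) \<le> a\<^sup>2 + b\<^sup>2"
      using sum_squares_bound[of "\<bar>a\<bar>" "\<bar>b\<bar>"] by (simp add: mult.assoc)
    moreover have "0 \<le> \<bar>a\<bar> * \<bar>b\<bar>" by simp
    ultimately show ?thesis by (simp only: abs_mult)
  qed
  then show "AE x in M. norm (F x * G x) \<le> norm ((F x)\<^sup>2 + (G x)\<^sup>2)"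
    by simp
qed

lemma L2fun_lincomb:
  assumes "L2fun M F" "L2fun M G"
  shows "L2fun M (\<lambda>x. a * F x + b * G x)"
proof -
  have "integrable M (\<lambda>x. a\<^sup>2 * (F x)\<^sup>2 + (2 * a * b) * (F x * G x) + b\<^sup>2 * (G x)\<^sup>2)"
    using assms L2fun_mult[OF assms] by (simp add: L2fun_def)
  moreover have "(\<lambda>x. (a * F x + b * G x)\<^sup>2) = (\<lambda>x. a\<^sup>2 * (F x)\<^sup>2 + (2 * a * b) * (F x * G x) + b\<^sup>2 * (G x)\<^sup>2)"
    by (rule ext) (simp add: power2_eq_square algebra_simps)
  ultimately show ?thesis
    using assms by (auto simp: L2fun_def)
qed

lemma L2fun_diff: "L2fun M F \<Longrightarrow> L2fun M G \<Longrightarrow> L2fun M (\<lambda>x. F x - G x)"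
  using L2fun_lincomb[of M F G 1 "-1"] by simp

lemma integral_square_lincomb:
  assumes "L2fun M F" "L2fun M G"
  shows "(\<integral>x. (F x + t * G x)\<^sup>2 \<partial>M) = (\<integral>x. (F x)\<^sup>2 \<partial>M) + 2 * t * (\<integral>x. F x * G x \<partial>M) + t\<^sup>2 * (\<integral>x. (G x)\<^sup>2 \<partial>M)"
proof -
  have "(\<integral>x. (F x + t * G x)\<^sup>2 \<partial>M) = (\<integral>x. (F x)\<^sup>2 + (2 * t) * (F x * G x) + t\<^sup>2 * (G x)\<^sup>2 \<partial>M)"
    by (intro Bochner_Integration.integral_cong) (simp_all add: power2_eq_square algebra_simps)
  then show ?thesis
    using assms L2fun_mult[OF assms] by (simp add: L2fun_def)
qed

lemma integral_square_diff_le: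
  assumes "L2fun M F" "L2fun M G"
  shows "(\<integral>x. (F x - G x)\<^sup>2 \<partial>M) \<le> 2 * (\<integral>x. (F x)\<^sup>2 \<partial>M) + 2 * (\<integral>x. (G x)\<^sup>2 \<partial>M)"
proof -
  have "(a - b)\<^sup>2 \<le> 2 * a\<^sup>2 + 2 * b\<^sup>2" for a b :: real
    using zero_le_power2[of "a + b"] by (simp add: power2_eq_square algebra_simps)
  then have "(\<integral>x. (F x - G x)\<^sup>2 \<partial>M) \<le> (\<integral>x. 2 * (F x)\<^sup>2 + 2 * (G x)\<^sup>2 \<partial>M)"
    using L2fun_diff[OF assms] assms by (intro integral_mono) (auto simp: L2fun_def)
  then show ?thesis
    using assms by (simp add: L2fun_def)
qed

text \<open>Splitting at \<open>\<bar>F\<bar> = T \<bar>G\<bar>\<close> gives \<open>\<bar>F G\<bar> \<le> min \<bar>F G\<bar> (T G\<^sup>2) + F\<^sup>2 / T\<close>; the first term is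
  dominated and the second is small for large \<open>T\<close>.\<close>
lemma L2_bounded_AE_weak:
  assumes F: "\<And>k. L2fun M (F k)" and G: "L2fun M G"
    and ae: "AE x in M. (\<lambda>k. F k x) \<longlonglongrightarrow> 0"
    and C: "\<And>k. (\<integral>x. (F k x)\<^sup>2 \<partial>M) \<le> C"
  shows "(\<lambda>k. \<integral>x. F k x * G x \<partial>M) \<longlonglongrightarrow> 0"
proof (rule LIMSEQ_I)
  fix e :: real assume e: "e > 0"
  have [measurable]: "F k \<in> borel_measurable M" "G \<in> borel_measurable M" for k
    using F G by (auto simp: L2fun_def)
  \<comment> \<open>Large enough for the remainder \<open>C / T\<close> to fall below
    \<open>e / 2\<close>; the absolute value and the 1 keep \<open>T\<close> positive.\<close>
  define T where "T = 2 * (\<bar>C\<bar> + 1) / e"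
  have T: "T > 0" using e by (simp add: T_def)
  have CT: "C / T < e / 2"
  proof -
    have "C < T * e / 2" using e by (simp add: T_def)
    then show ?thesis using T by (simp add: field_simps)
  qed
  let ?m = "\<lambda>k x. min \<bar>F k x * G x\<bar> (T * (G x)\<^sup>2)"
  have "(\<lambda>k. \<integral>x. ?m k x \<partial>M) \<longlonglongrightarrow> (\<integral>x. 0 \<partial>M)"
  proof (rule integral_dominated_convergence[where w="\<lambda>x. T * (G x)\<^sup>2"])
    show "integrable M (\<lambda>x. T * (G x)\<^sup>2)" using G by (simp add: L2fun_def)
    show "AE x in M. (\<lambda>k. ?m k x) \<longlonglongrightarrow> 0"
      using ae
    proof (rule eventually_mono)
      fix x assume "(\<lambda>k. F k x) \<longlonglongrightarrow> 0"
      then have "(\<lambda>k. ?m k x) \<longlonglongrightarrow> min \<bar>0 * G x\<bar> (T * (G x)\<^sup>2)"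
        by (intro tendsto_intros)
      then show "(\<lambda>k. ?m k x) \<longlonglongrightarrow> 0" using T by simp
    qed
    show "AE x in M. norm (?m k x) \<le> T * (G x)\<^sup>2" for k using T by simp
  qed auto
  then have "\<forall>\<^sub>F k in sequentially. (\<integral>x. ?m k x \<partial>M) < e / 2"
    using e by (intro order_tendstoD(2)[where y=0]) auto
  then obtain K where K: "\<And>k. k \<ge> K \<Longrightarrow> (\<integral>x. ?m k x \<partial>M) < e / 2"
    unfolding eventually_sequentially by blast
  have "norm ((\<integral>x. F k x * G x \<partial>M) - 0) < e" if "k \<ge> K" for k
  proof -
    have FG: "integrable M (\<lambda>x. F k x * G x)" by (rule L2fun_mult[OF F G])
    have m: "integrable M (?m k)"
      by (rule Bochner_Integration.integrable_bound[OF FG]) (use T in auto)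
    have "\<bar>\<integral>x. F k x * G x \<partial>M\<bar> \<le> (\<integral>x. \<bar>F k x * G x\<bar> \<partial>M)"
      by (rule integral_abs_bound)
    also have "\<dots> \<le> (\<integral>x. ?m k x + (F k x)\<^sup>2 / T \<partial>M)"
    proof (rule integral_mono)
      show "\<bar>F k x * G x\<bar> \<le> ?m k x + (F k x)\<^sup>2 / T" for x
      proof (cases "\<bar>F k x\<bar> \<le> T * \<bar>G x\<bar>")
        case True
        then have "\<bar>F k x\<bar> * \<bar>G x\<bar> \<le> T * \<bar>G x\<bar> * \<bar>G x\<bar>" by (intro mult_right_mono) auto
        then have "\<bar>F k x * G x\<bar> \<le> T * (G x)\<^sup>2"
          by (simp add: abs_mult power2_eq_square mult.assoc)
        then show ?thesis using T by (simp only: min.absorb1) simp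
      next
        case False
        then have "\<bar>G x\<bar> \<le> \<bar>F k x\<bar> / T" using T by (simp add: field_simps)
        then have "\<bar>F k x\<bar> * \<bar>G x\<bar> \<le> \<bar>F k x\<bar> * (\<bar>F k x\<bar> / T)" by (intro mult_left_mono) auto
        then have "\<bar>F k x * G x\<bar> \<le> (F k x)\<^sup>2 / T"
          by (simp add: abs_mult power2_eq_square)
        moreover have "0 \<le> ?m k x" using T by simp
        ultimately show ?thesis by linarith
      qed
    qed (use FG m F in \<open>auto simp: L2fun_def\<close>)
    also have "\<dots> = (\<integral>x. ?m k x \<partial>M) + (\<integral>x. (F k x)\<^sup>2 \<partial>M) / T"
      using m F by (simp add: L2fun_def)
    also have "\<dots> < e / 2 + C / T"
      using K[OF that] divide_right_mono[OF C[of k], of T] T by simp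
    finally have "\<bar>\<integral>x. F k x * G x \<partial>M\<bar> < e"
      using CT by linarith
    then show ?thesis by simp
  qed
  then show "\<exists>K. \<forall>k\<ge>K. norm ((\<integral>x. F k x * G x \<partial>M) - 0) < e" by blast
qed

lemma L2_Fatou:
  assumes F: "\<And>k. L2fun M (F k)" and f [measurable]: "f \<in> borel_measurable M"
    and ae: "AE x in M. (\<lambda>k. F k x) \<longlonglongrightarrow> f x"
    and C: "\<And>k. (\<integral>x. (F k x)\<^sup>2 \<partial>M) \<le> C"
  shows "L2fun M f" "(\<integral>x. (f x)\<^sup>2 \<partial>M) \<le> C"
proof -
  have [measurable]: "F k \<in> borel_measurable M" for k using F by (auto simp: L2fun_def)
  have C0: "C \<ge> 0" using order_trans[OF _ C[of 0]] by simp
  have "(\<integral>\<^sup>+x. ennreal ((f x)\<^sup>2) \<partial>M) = (\<integral>\<^sup>+x. liminf (\<lambda>k. ennreal ((F k x)\<^sup>2)) \<partial>M)"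
  proof (rule nn_integral_cong_AE)
    show "AE x in M. ennreal ((f x)\<^sup>2) = liminf (\<lambda>k. ennreal ((F k x)\<^sup>2))"
      using ae
    proof (rule eventually_mono)
      fix x assume "(\<lambda>k. F k x) \<longlonglongrightarrow> f x"
      then have "(\<lambda>k. ennreal ((F k x)\<^sup>2)) \<longlonglongrightarrow> ennreal ((f x)\<^sup>2)" by (intro tendsto_intros)
      then show "ennreal ((f x)\<^sup>2) = liminf (\<lambda>k. ennreal ((F k x)\<^sup>2))"
        by (intro lim_imp_Liminf[symmetric]) simp_all
    qed
  qed
  also have "\<dots> \<le> liminf (\<lambda>k. \<integral>\<^sup>+x. ennreal ((F k x)\<^sup>2) \<partial>M)"
    by (rule nn_integral_liminf) simp
  also have "\<dots> \<le> liminf (\<lambda>k. ennreal C)"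
    by (intro Liminf_mono always_eventually allI) (simp add: L2fun_nn_integral[OF F] C ennreal_leI)
  finally have le: "(\<integral>\<^sup>+x. ennreal ((f x)\<^sup>2) \<partial>M) \<le> ennreal C"
    by (simp add: Liminf_const)
  then show 1: "L2fun M f"
    by (subst L2fun_iff_nn_integral) (auto simp: le_less_trans)
  show "(\<integral>x. (f x)\<^sup>2 \<partial>M) \<le> C"
    using le C0 by (simp add: L2fun_nn_integral[OF 1])
qed

text \<open>For squares the defect is exactly twice the pairing of \<open>F k - f\<close> with
  \<open>f\<close>, and this tends to 0 because \<open>F k - f\<close> is bounded in
  \<open>L\<^sup>2\<close> and tends to 0 almost everywhere.\<close>

lemma L2_Brezis_Lieb:
  assumes F: "\<And>k. L2fun M (F k)" and f: "f \<in> borel_measurable M"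
    and ae: "AE x in M. (\<lambda>k. F k x) \<longlonglongrightarrow> f x"
    and C: "\<And>k. (\<integral>x. (F k x)\<^sup>2 \<partial>M) \<le> C"
  shows "(\<lambda>k. (\<integral>x. (F k x)\<^sup>2 \<partial>M) - (\<integral>x. (f x)\<^sup>2 \<partial>M) - (\<integral>x. (F k x - f x)\<^sup>2 \<partial>M)) \<longlonglongrightarrow> 0"
proof -
  note L = L2_Fatou[OF F f ae C]
  have D: "L2fun M (\<lambda>x. F k x - f x)" for k by (rule L2fun_diff[OF F L(1)])
  have "(\<lambda>k. \<integral>x. (F k x - f x) * f x \<partial>M) \<longlonglongrightarrow> 0"
  proof (rule L2_bounded_AE_weak[OF D L(1)])
    show "AE x in M. (\<lambda>k. F k x - f x) \<longlonglongrightarrow> 0"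
      using ae by (rule eventually_mono) (simp add: LIM_zero)
    show "(\<integral>x. (F k x - f x)\<^sup>2 \<partial>M) \<le> 4 * C" for k
      using integral_square_diff_le[OF F[of k] L(1)] C[of k] L(2) by linarith
  qed
  then have "(\<lambda>k. 2 * (\<integral>x. (F k x - f x) * f x \<partial>M)) \<longlonglongrightarrow> 2 * 0"
    by (intro tendsto_intros)
  moreover have "(\<integral>x. (F k x)\<^sup>2 \<partial>M) - (\<integral>x. (f x)\<^sup>2 \<partial>M) - (\<integral>x. (F k x - f x)\<^sup>2 \<partial>M)
      = 2 * (\<integral>x. (F k x - f x) * f x \<partial>M)" for k
    using integral_square_lincomb[OF D[of k] L(1), of 1] by simp
  ultimately show ?thesis by simp
qed

text \<open>Mazur's theorem in \<open>L\<^sup>2\<close>, for sequences converging almost everywhere. A near-minimiser \<open>g\<close> of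
  the distance to \<open>V\<close> is nearly orthogonal to \<open>F k - g\<close>, whose product with \<open>f - g\<close> tends to
  the squared distance.\<close>
lemma L2_Mazur:
  assumes V: "\<And>g. g \<in> V \<Longrightarrow> L2fun M g" and lin: "\<And>g h t. g \<in> V \<Longrightarrow> h \<in> V \<Longrightarrow> (\<lambda>x. g x + t * h x) \<in> V"
    and F: "\<And>k. F k \<in> V" and f: "f \<in> borel_measurable M"
    and ae: "AE x in M. (\<lambda>k. F k x) \<longlonglongrightarrow> f x"
    and C: "\<And>k. (\<integral>x. (F k x)\<^sup>2 \<partial>M) \<le> C"
    and e: "e > 0"
  shows "\<exists>g\<in>V. (\<integral>x. (f x - g x)\<^sup>2 \<partial>M) < e"
proof (rule ccontr)
  assume *: "\<not> ?thesis"
  note L = L2_Fatou[OF V[OF F] f ae C]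
  let ?D = "\<lambda>g. \<integral>x. (f x - g x)\<^sup>2 \<partial>M"
  define d where "d = Inf (?D ` V)"
  have ne: "V \<noteq> {}" using F by auto
  have bdd: "bdd_below (?D ` V)" by (intro bdd_belowI[of _ 0]) auto
  have d: "d \<ge> e" unfolding d_def using * ne by (intro cInf_greatest) (auto simp: not_less)
  have dle: "d \<le> ?D g" if "g \<in> V" for g unfolding d_def using that bdd by (intro cInf_lower) auto
  have C0: "C \<ge> 0" using order_trans[OF _ C[of 0]] by simp
  \<comment> \<open>Bounds the squared norm of \<open>F k - g\<close>: it is at most
    \<open>2 * C\<close> plus twice that of \<open>g\<close>, itself at most
    \<open>2 * C + 2 * (d + 1)\<close>.\<close>
  define P where "P = 2 * C + 2 * (2 * C + 2 * (d + 1))"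
  have P: "P > 0" using C0 d e by (simp add: P_def)
  define \<delta> where "\<delta> = min 1 (d\<^sup>2 / (2 * P))"
  have \<delta>: "\<delta> > 0" using P d e by (simp add: \<delta>_def)
  obtain g where g: "g \<in> V" "?D g < d + \<delta>"
    using cInf_lessD[of "?D ` V" "d + \<delta>"] ne \<delta> unfolding d_def by auto
  note gL = V[OF g(1)]
  have fg: "L2fun M (\<lambda>x. f x - g x)" by (rule L2fun_diff[OF L(1) gL])
  have \<delta>1: "\<delta> \<le> 1" by (simp add: \<delta>_def)
  have gd: "?D g \<le> d + 1"
  proof -
    have "?D g < d + \<delta>" by (rule g(2))
    also have "d + \<delta> \<le> d + 1" using \<delta>1 by (rule add_left_mono)
    finally show ?thesis by (rule less_imp_le)
  qed
  have "(\<integral>x. (g x)\<^sup>2 \<partial>M) = (\<integral>x. (f x - (f x - g x))\<^sup>2 \<partial>M)" by simp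
  also have "\<dots> \<le> 2 * C + 2 * (d + 1)"
    by (rule order_trans[OF integral_square_diff_le[OF L(1) fg]]) (intro add_mono mult_left_mono L(2) gd; simp)
  finally have gC: "(\<integral>x. (g x)\<^sup>2 \<partial>M) \<le> 2 * C + 2 * (d + 1)" .
  have gP: "(\<integral>x. (F k x - g x)\<^sup>2 \<partial>M) \<le> P" for k
    unfolding P_def
    by (rule order_trans[OF integral_square_diff_le[OF V[OF F[of k]] gL]])
       (intro add_mono mult_left_mono C gC; simp)
  have kL: "L2fun M (\<lambda>x. F k x - g x)" for k by (rule L2fun_diff[OF V[OF F] gL])
  \<comment> \<open>This value maximises \<open>2 * t * d - t\<^sup>2 * P\<close>, with maximum
    \<open>d\<^sup>2 / P\<close>. Comparing the near-minimiser \<open>g\<close> with the competitors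
    \<open>g + t * (F k - g)\<close> shows that the maximum is at most \<open>\<delta>\<close>,
    which is at most half of it.\<close>
  define t where "t = d / P"
  have t: "t > 0" using d e P by (simp add: t_def)
  have key: "2 * t * (\<integral>x. (f x - g x) * (F k x - g x) \<partial>M) \<le> \<delta> + t\<^sup>2 * P" for k
  proof -
    have "(\<lambda>x. g x + t * (F k x + (-1) * g x)) \<in> V"
      by (intro lin g F)
    from dle[OF this] have "d \<le> (\<integral>x. ((f x - g x) + (- t) * (F k x - g x))\<^sup>2 \<partial>M)"
      by (simp add: algebra_simps)
    also have "\<dots> = ?D g + 2 * (- t) * (\<integral>x. (f x - g x) * (F k x - g x) \<partial>M) + (- t)\<^sup>2 * (\<integral>x. (F k x - g x)\<^sup>2 \<partial>M)"
      by (rule integral_square_lincomb[OF fg kL])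
    finally show ?thesis
      using g(2) mult_left_mono[OF gP[of k], of "t\<^sup>2"] by simp
  qed
  have "(\<lambda>k. \<integral>x. (F k x - f x) * (f x - g x) \<partial>M) \<longlonglongrightarrow> 0"
  proof (rule L2_bounded_AE_weak[OF L2fun_diff[OF V[OF F] L(1)] fg])
    show "AE x in M. (\<lambda>k. F k x - f x) \<longlonglongrightarrow> 0"
      using ae by (rule eventually_mono) (simp add: LIM_zero)
    show "(\<integral>x. (F k x - f x)\<^sup>2 \<partial>M) \<le> 4 * C" for k
      using order_trans[OF integral_square_diff_le[OF V[OF F[of k]] L(1)] add_mono[OF mult_left_mono[OF C[of k]] mult_left_mono[OF L(2)]]]
      by simp
  qed
  moreover have "(\<integral>x. (f x - g x) * (F k x - g x) \<partial>M) = ?D g + (\<integral>x. (F k x - f x) * (f x - g x) \<partial>M)" for k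
  proof -
    have "(\<integral>x. (f x - g x) * (F k x - g x) \<partial>M) = (\<integral>x. (f x - g x)\<^sup>2 + (F k x - f x) * (f x - g x) \<partial>M)"
      by (intro Bochner_Integration.integral_cong) (simp_all add: power2_eq_square algebra_simps)
    then show ?thesis
      using fg L2fun_mult[OF L2fun_diff[OF V[OF F[of k]] L(1)] fg] by (simp add: L2fun_def)
  qed
  ultimately have "(\<lambda>k. \<integral>x. (f x - g x) * (F k x - g x) \<partial>M) \<longlonglongrightarrow> ?D g"
    using tendsto_add[OF tendsto_const[of "?D g" sequentially]] by force
  then have "(\<lambda>k. 2 * t * (\<integral>x. (f x - g x) * (F k x - g x) \<partial>M)) \<longlonglongrightarrow> 2 * t * ?D g"
    by (intro tendsto_intros)
  then have "2 * t * ?D g \<le> \<delta> + t\<^sup>2 * P"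
    by (rule LIMSEQ_le_const2) (use key in auto)
  moreover have "2 * t * d \<le> 2 * t * ?D g"
    using dle[OF g(1)] t by simp
  ultimately have "2 * t * d \<le> \<delta> + t\<^sup>2 * P"
    by (rule order_trans[rotated])
  moreover have "2 * t * d = 2 * (d\<^sup>2 / P)" "t\<^sup>2 * P = d\<^sup>2 / P"
    using P by (simp_all add: t_def power2_eq_square)
  moreover have "\<delta> \<le> d\<^sup>2 / P / 2" unfolding \<delta>_def by simp
  ultimately have "2 * (d\<^sup>2 / P) \<le> d\<^sup>2 / P / 2 + d\<^sup>2 / P"
    by (metis add_right_mono order_trans)
  moreover have "d\<^sup>2 / P > 0" using d e P by simp
  ultimately show False by simp
qed

section \<open>Integrals of p-th powers\<close>

lemma powr_add_le:
  fixes p :: real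
  assumes p: "p > 0" and e: "e > 0"
  shows "\<exists>C\<ge>0. \<forall>a b. \<bar>a + b\<bar> powr p \<le> (1 + e) * \<bar>a\<bar> powr p + C * \<bar>b\<bar> powr p"
proof -
  \<comment> \<open>Chosen with \<open>(1 + d) powr p = 1 + e\<close>: where
    \<open>\<bar>b\<bar> \<le> d * \<bar>a\<bar>\<close> the sum costs only this factor, and
    elsewhere \<open>\<bar>a\<bar>\<close> is below \<open>\<bar>b\<bar> / d\<close>.\<close>
  define d where "d = (1 + e) powr (1 / p) - 1"
  have "(1::real) powr (1 / p) < (1 + e) powr (1 / p)"
    using p e by (intro powr_less_mono2) auto
  then have d: "d > 0" by (simp add: d_def)
  have dp: "(1 + d) powr p = 1 + e" using p e by (simp add: d_def powr_powr)
  have "\<bar>a + b\<bar> powr p \<le> (1 + e) * \<bar>a\<bar> powr p + (1 + 1 / d) powr p * \<bar>b\<bar> powr p" for a b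
  proof (cases "\<bar>b\<bar> \<le> d * \<bar>a\<bar>")
    case True
    then have "\<bar>a + b\<bar> \<le> (1 + d) * \<bar>a\<bar>" by (simp add: distrib_right)
    then have "\<bar>a + b\<bar> powr p \<le> ((1 + d) * \<bar>a\<bar>) powr p" using p by (intro powr_mono2) auto
    also have "\<dots> = (1 + e) * \<bar>a\<bar> powr p" using d dp by (simp add: powr_mult)
    finally show ?thesis by (simp add: add_increasing2)
  next
    case False
    then have "\<bar>a\<bar> \<le> \<bar>b\<bar> / d" using d by (simp add: field_simps)
    then have "\<bar>a + b\<bar> \<le> (1 + 1 / d) * \<bar>b\<bar>" by (simp add: distrib_right)
    then have "\<bar>a + b\<bar> powr p \<le> ((1 + 1 / d) * \<bar>b\<bar>) powr p" using p by (intro powr_mono2) auto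
    also have "\<dots> = (1 + 1 / d) powr p * \<bar>b\<bar> powr p" using d by (simp add: powr_mult)
    finally show ?thesis using e by (simp add: add_increasing)
  qed
  then show ?thesis by (intro exI[of _ "(1 + 1 / d) powr p"]) auto
qed

lemma ennreal_tendsto_0I:
  fixes f :: "nat \<Rightarrow> ennreal"
  assumes "\<And>e::real. e > 0 \<Longrightarrow> \<forall>\<^sub>F k in sequentially. f k \<le> ennreal e"
  shows "f \<longlonglongrightarrow> 0"
proof (rule order_tendstoI)
  fix a :: ennreal assume "0 < a"
  then obtain b where b: "0 < b" "b < a" using dense by blast
  then obtain r where r: "b = ennreal r" "r > 0" by (cases b) (auto simp: top_unique)
  show "\<forall>\<^sub>F k in sequentially. f k < a"
    using assms[OF r(2)] by (rule eventually_mono) (use b r in auto)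
qed simp

text \<open>The upper half of the Brezis--Lieb lemma, with a factor 1 + e. The part by which
  \<open>\<bar>F k\<bar> powr p\<close> exceeds \<open>(1 + e) * \<bar>F k - f\<bar> powr p\<close>
  is at most \<open>C * \<bar>f\<bar> powr p\<close> by \<open>powr_add_le\<close> and tends to
  \<open>\<bar>f\<bar> powr p\<close>, so dominated convergence applies.\<close>

lemma Lp_Brezis_Lieb_upper:
  fixes p :: real and f :: "'a \<Rightarrow> real"
  assumes [measurable]: "\<And>k. F k \<in> borel_measurable M" "f \<in> borel_measurable M"
    and ae: "AE x in M. (\<lambda>k. F k x) \<longlonglongrightarrow> f x"
    and fin: "(\<integral>\<^sup>+x. ennreal (\<bar>f x\<bar> powr p) \<partial>M) < \<infinity>"
    and p: "p > 0" and e: "e > 0"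
  shows "\<forall>\<^sub>F k in sequentially. (\<integral>\<^sup>+x. ennreal (\<bar>F k x\<bar> powr p) \<partial>M)
      \<le> ennreal (1 + e) * (\<integral>\<^sup>+x. ennreal (\<bar>F k x - f x\<bar> powr p) \<partial>M) + ((\<integral>\<^sup>+x. ennreal (\<bar>f x\<bar> powr p) \<partial>M) + ennreal e)"
proof -
  obtain C where C: "C \<ge> 0" "\<And>a b. \<bar>a + b\<bar> powr p \<le> (1 + e) * \<bar>a\<bar> powr p + C * \<bar>b\<bar> powr p"
    using powr_add_le[OF p e] by blast
  let ?g = "\<lambda>k x. max 0 (\<bar>F k x\<bar> powr p - (1 + e) * \<bar>F k x - f x\<bar> powr p)"
  have "(\<lambda>k. \<integral>\<^sup>+x. ennreal (?g k x) \<partial>M) \<longlonglongrightarrow> (\<integral>\<^sup>+x. ennreal (\<bar>f x\<bar> powr p) \<partial>M)"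
  proof (rule nn_integral_dominated_convergence[where w="\<lambda>x. ennreal C * ennreal (\<bar>f x\<bar> powr p)"])
    show "AE x in M. ennreal (?g k x) \<le> ennreal C * ennreal (\<bar>f x\<bar> powr p)" for k
    proof (rule AE_I2)
      fix x
      have "?g k x \<le> C * \<bar>f x\<bar> powr p" using C(1) C(2)[of "F k x - f x" "f x"] by simp
      then show "ennreal (?g k x) \<le> ennreal C * ennreal (\<bar>f x\<bar> powr p)"
        using C(1) by (subst ennreal_mult[symmetric]) (auto intro: ennreal_leI)
    qed
    show "(\<integral>\<^sup>+x. ennreal C * ennreal (\<bar>f x\<bar> powr p) \<partial>M) < \<infinity>"
      using fin by (subst nn_integral_cmult) (auto simp: ennreal_mult_less_top)
    show "AE x in M. (\<lambda>k. ennreal (?g k x)) \<longlonglongrightarrow> ennreal (\<bar>f x\<bar> powr p)"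
      using ae
    proof (rule eventually_mono)
      fix x assume x: "(\<lambda>k. F k x) \<longlonglongrightarrow> f x"
      have *: "(\<lambda>k. \<bar>g k\<bar> powr p) \<longlonglongrightarrow> \<bar>l\<bar> powr p" if "g \<longlonglongrightarrow> l" for g :: "nat \<Rightarrow> real" and l
        using p by (intro tendsto_powr' tendsto_rabs that tendsto_const) auto
      have "(\<lambda>k. \<bar>F k x\<bar> powr p) \<longlonglongrightarrow> \<bar>f x\<bar> powr p"
        by (rule *[OF x])
      moreover have "(\<lambda>k. \<bar>F k x - f x\<bar> powr p) \<longlonglongrightarrow> \<bar>f x - f x\<bar> powr p"
        by (rule *) (intro tendsto_intros x)
      ultimately have "(\<lambda>k. ?g k x) \<longlonglongrightarrow> max 0 (\<bar>f x\<bar> powr p - (1 + e) * \<bar>f x - f x\<bar> powr p)"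
        by (intro tendsto_max tendsto_diff tendsto_mult tendsto_const)
      then show "(\<lambda>k. ennreal (?g k x)) \<longlonglongrightarrow> ennreal (\<bar>f x\<bar> powr p)"
        by (intro tendsto_ennrealI) simp
    qed
  qed auto
  moreover have "(\<integral>\<^sup>+x. ennreal (\<bar>f x\<bar> powr p) \<partial>M) < (\<integral>\<^sup>+x. ennreal (\<bar>f x\<bar> powr p) \<partial>M) + ennreal e"
    using fin e by (cases "\<integral>\<^sup>+x. ennreal (\<bar>f x\<bar> powr p) \<partial>M") (auto simp flip: ennreal_plus intro!: ennreal_lessI)
  ultimately have "\<forall>\<^sub>F k in sequentially. (\<integral>\<^sup>+x. ennreal (?g k x) \<partial>M) < (\<integral>\<^sup>+x. ennreal (\<bar>f x\<bar> powr p) \<partial>M) + ennreal e"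
    by (rule order_tendstoD(2))
  then show ?thesis
  proof (rule eventually_mono)
    fix k
    assume k: "(\<integral>\<^sup>+x. ennreal (?g k x) \<partial>M) < (\<integral>\<^sup>+x. ennreal (\<bar>f x\<bar> powr p) \<partial>M) + ennreal e"
    have "(\<integral>\<^sup>+x. ennreal (\<bar>F k x\<bar> powr p) \<partial>M)
        \<le> (\<integral>\<^sup>+x. ennreal (1 + e) * ennreal (\<bar>F k x - f x\<bar> powr p) + ennreal (?g k x) \<partial>M)"
    proof (rule nn_integral_mono)
      fix x
      have "ennreal (\<bar>F k x\<bar> powr p) \<le> ennreal ((1 + e) * \<bar>F k x - f x\<bar> powr p + ?g k x)"
        by (rule ennreal_leI) simp
      then show "ennreal (\<bar>F k x\<bar> powr p) \<le> ennreal (1 + e) * ennreal (\<bar>F k x - f x\<bar> powr p) + ennreal (?g k x)"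
        using e by (simp add: ennreal_mult ennreal_plus)
    qed
    also have "\<dots> = ennreal (1 + e) * (\<integral>\<^sup>+x. ennreal (\<bar>F k x - f x\<bar> powr p) \<partial>M) + (\<integral>\<^sup>+x. ennreal (?g k x) \<partial>M)"
      by (simp add: nn_integral_add nn_integral_cmult)
    finally show "(\<integral>\<^sup>+x. ennreal (\<bar>F k x\<bar> powr p) \<partial>M)
      \<le> ennreal (1 + e) * (\<integral>\<^sup>+x. ennreal (\<bar>F k x - f x\<bar> powr p) \<partial>M) + ((\<integral>\<^sup>+x. ennreal (\<bar>f x\<bar> powr p) \<partial>M) + ennreal e)"
      using k by (meson add_left_mono less_imp_le order_trans)
  qed
qed

text \<open>Cut at height T. The truncated squares tend to 0 by dominated convergence, as the
  measure is finite; where \<open>\<bar>v\<bar> > T\<close> the square is at most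
  \<open>T powr (2 - p) * \<bar>v\<bar> powr p\<close>, whose integral is small for large T because
  p exceeds 2.\<close>

lemma L2_tendsto_0_of_Lp_bounded:
  fixes p C :: real
  assumes [measurable]: "\<And>k. v k \<in> borel_measurable M"
    and fin: "emeasure M (space M) < \<infinity>"
    and ae: "AE x in M. (\<lambda>k. v k x) \<longlonglongrightarrow> 0"
    and C: "\<And>k. (\<integral>\<^sup>+x. ennreal (\<bar>v k x\<bar> powr p) \<partial>M) \<le> ennreal C"
    and p: "p > 2"
  shows "(\<lambda>k. \<integral>\<^sup>+x. ennreal ((v k x)\<^sup>2) \<partial>M) \<longlonglongrightarrow> 0"
proof (rule ennreal_tendsto_0I)
  fix e :: real assume e: "e > 0"
  define T where "T = (2 * (\<bar>C\<bar> + 1) / e) powr (1 / (p - 2))"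
  have T: "T > 0" using e by (simp add: T_def)
  have "T powr (p - 2) = 2 * (\<bar>C\<bar> + 1) / e" using p e by (simp add: T_def powr_powr)
  then have Tp: "T powr (2 - p) = e / (2 * (\<bar>C\<bar> + 1))"
    using powr_minus_divide[of T "p - 2"] by simp
  have TC: "T powr (2 - p) * C \<le> e / 2"
  proof -
    have "T powr (2 - p) * C \<le> T powr (2 - p) * (\<bar>C\<bar> + 1)" by (intro mult_left_mono) auto
    also have "\<dots> = e / 2" unfolding Tp by (simp add: field_simps)
    finally show ?thesis .
  qed
  have pt: "a\<^sup>2 \<le> min (a\<^sup>2) (T\<^sup>2) + T powr (2 - p) * \<bar>a\<bar> powr p" for a
  proof (cases "\<bar>a\<bar> \<le> T")
    case True
    then have "a\<^sup>2 \<le> T\<^sup>2" using power_mono[of "\<bar>a\<bar>" T 2] by simp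
    then show ?thesis by simp
  next
    case False
    have "a\<^sup>2 = \<bar>a\<bar> powr (2 - p) * \<bar>a\<bar> powr p"
      using False T by (simp flip: powr_add)
    also have "\<dots> \<le> T powr (2 - p) * \<bar>a\<bar> powr p"
      using False T p by (intro mult_right_mono powr_mono2') auto
    finally show ?thesis by (simp add: add_increasing)
  qed
  have "(\<lambda>k. \<integral>\<^sup>+x. ennreal (min ((v k x)\<^sup>2) (T\<^sup>2)) \<partial>M) \<longlonglongrightarrow> (\<integral>\<^sup>+x. ennreal 0 \<partial>M)"
  proof (rule nn_integral_dominated_convergence[where w="\<lambda>x. ennreal (T\<^sup>2)"])
    show "(\<integral>\<^sup>+x. ennreal (T\<^sup>2) \<partial>M) < \<infinity>" using fin by (simp add: ennreal_mult_less_top)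
    show "AE x in M. (\<lambda>k. ennreal (min ((v k x)\<^sup>2) (T\<^sup>2))) \<longlonglongrightarrow> ennreal 0"
      using ae
    proof (rule eventually_mono)
      fix x assume "(\<lambda>k. v k x) \<longlonglongrightarrow> 0"
      then have "(\<lambda>k. min ((v k x)\<^sup>2) (T\<^sup>2)) \<longlonglongrightarrow> min (0\<^sup>2) (T\<^sup>2)" by (intro tendsto_intros)
      then show "(\<lambda>k. ennreal (min ((v k x)\<^sup>2) (T\<^sup>2))) \<longlonglongrightarrow> ennreal 0"
        by (intro tendsto_ennrealI) simp
    qed
  qed (auto intro: ennreal_leI)
  then have "\<forall>\<^sub>F k in sequentially. (\<integral>\<^sup>+x. ennreal (min ((v k x)\<^sup>2) (T\<^sup>2)) \<partial>M) < ennreal (e / 2)"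
    using e by (intro order_tendstoD(2)[where y=0]) (auto simp: ennreal_zero_less_divide)
  then show "\<forall>\<^sub>F k in sequentially. (\<integral>\<^sup>+x. ennreal ((v k x)\<^sup>2) \<partial>M) \<le> ennreal e"
  proof (rule eventually_mono)
    fix k assume k: "(\<integral>\<^sup>+x. ennreal (min ((v k x)\<^sup>2) (T\<^sup>2)) \<partial>M) < ennreal (e / 2)"
    have "(\<integral>\<^sup>+x. ennreal ((v k x)\<^sup>2) \<partial>M)
        \<le> (\<integral>\<^sup>+x. ennreal (min ((v k x)\<^sup>2) (T\<^sup>2)) + ennreal (T powr (2 - p)) * ennreal (\<bar>v k x\<bar> powr p) \<partial>M)"
    proof (rule nn_integral_mono)
      fix x
      show "ennreal ((v k x)\<^sup>2) \<le> ennreal (min ((v k x)\<^sup>2) (T\<^sup>2)) + ennreal (T powr (2 - p)) * ennreal (\<bar>v k x\<bar> powr p)"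
        using ennreal_leI[OF pt[of "v k x"]] by (simp add: ennreal_mult ennreal_plus)
    qed
    also have "\<dots> = (\<integral>\<^sup>+x. ennreal (min ((v k x)\<^sup>2) (T\<^sup>2)) \<partial>M) + ennreal (T powr (2 - p)) * (\<integral>\<^sup>+x. ennreal (\<bar>v k x\<bar> powr p) \<partial>M)"
      by (simp add: nn_integral_add nn_integral_cmult)
    also have "\<dots> \<le> ennreal (e / 2) + ennreal (T powr (2 - p)) * ennreal C"
      using k C[of k] by (intro add_mono mult_left_mono) auto
    also have "ennreal (T powr (2 - p)) * ennreal C = ennreal (T powr (2 - p) * C)"
      by (simp add: ennreal_mult')
    also have "ennreal (e / 2) + \<dots> \<le> ennreal (e / 2) + ennreal (e / 2)"
      using TC by (intro add_left_mono ennreal_leI)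
    also have "\<dots> = ennreal e" using e by (simp flip: ennreal_plus)
    finally show "(\<integral>\<^sup>+x. ennreal ((v k x)\<^sup>2) \<partial>M) \<le> ennreal e" .
  qed
qed

section \<open>Energy of radial functions on small balls\<close>

text \<open>The squared Gagliardo seminorm over U without the constant \<open>cNs\<close>; U stays a
  parameter so that the energy can be localised to small balls.\<close>

definition gag :: "real \<Rightarrow> 'a::euclidean_space set \<Rightarrow> ('a \<Rightarrow> real) \<Rightarrow> ennreal" where
  "gag s U u = (\<integral>\<^sup>+x. (\<integral>\<^sup>+y. ennreal ((u x - u y)\<^sup>2 * frac_ker s (x - y)) * indicator U y \<partial>lborel) * indicator U x \<partial>lborel)"

definition rtest :: "('a::euclidean_space \<Rightarrow> real) set" where
  "rtest = {\<phi>. \<phi> \<in> Cc_inf unitB \<and> radial \<phi>}"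

lemma Qf_gag: "Qf s U (u :: 'a::euclidean_space \<Rightarrow> real) = ennreal (cNs DIM('a) s / 2) * gag s U u"
  by (simp add: Qf_def gag_def frac_ker_divide)

lemma gag_mono: "U \<subseteq> V \<Longrightarrow> gag s U u \<le> gag s V u"
  unfolding gag_def by (intro nn_integral_mono mult_mono) (auto simp: indicator_def)

lemma gag_rotate:
  fixes u :: "'a::euclidean_space \<Rightarrow> real"
  assumes u [measurable]: "u \<in> borel_measurable borel" and r: "radial u" and T: "orthogonal_transformation T"
  shows "gag s (unitB \<inter> ball (T c) \<rho>) u = gag s (unitB \<inter> ball c \<rho>) u"
proof -
  have lin: "linear T" and nT: "norm (T x) = norm x" for x
    using T by (auto simp: orthogonal_transformation)
  have uT: "u (T x) = u x" for x
    using r nT[of x] unfolding radial_def by blast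
  have kT: "frac_ker s (T x - T y) = frac_ker s (x - y)" for x y
    using nT[of "x - y"] by (simp add: frac_ker_def linear_diff[OF lin])
  have iT: "indicator (unitB \<inter> ball (T c) \<rho>) (T x) = (indicator (unitB \<inter> ball c \<rho>) x :: ennreal)" for x
    using nT[of "c - x"] nT[of x] by (simp add: indicator_def dist_norm linear_diff[OF lin])
  let ?g = "\<lambda>x. \<integral>\<^sup>+y. ennreal ((u x - u y)\<^sup>2 * frac_ker s (x - y)) * indicator (unitB \<inter> ball (T c) \<rho>) y \<partial>lborel"
  have "gag s (unitB \<inter> ball (T c) \<rho>) u = (\<integral>\<^sup>+x. ?g (T x) * indicator (unitB \<inter> ball (T c) \<rho>) (T x) \<partial>lborel)"
    unfolding gag_def by (rule nn_integral_lborel_orthogonal[OF T, symmetric]) simp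
  also have "\<dots> = gag s (unitB \<inter> ball c \<rho>) u"
    unfolding gag_def
  proof (rule nn_integral_cong, rule arg_cong2[where f="(*)"])
    fix x
    have "?g (T x) = (\<integral>\<^sup>+y. ennreal ((u (T x) - u (T y))\<^sup>2 * frac_ker s (T x - T y)) * indicator (unitB \<inter> ball (T c) \<rho>) (T y) \<partial>lborel)"
      by (rule nn_integral_lborel_orthogonal[OF T, symmetric]) simp
    then show "?g (T x) = (\<integral>\<^sup>+y. ennreal ((u x - u y)\<^sup>2 * frac_ker s (x - y)) * indicator (unitB \<inter> ball c \<rho>) y \<partial>lborel)"
      by (simp add: uT kT iT)
  qed (rule iT)
  finally show ?thesis .
qed

text \<open>Exchange the integrals: a point x is counted only for centres z in
  \<open>ball x \<rho>\<close>, a set of the volume on the right, while the restriction on the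
  second point y is relaxed to the unit ball.\<close>

lemma gag_average:
  fixes u :: "'a::euclidean_space \<Rightarrow> real"
  assumes u [measurable]: "u \<in> borel_measurable borel" and \<rho>: "\<rho> \<ge> 0"
  shows "(\<integral>\<^sup>+z. gag s (unitB \<inter> ball z \<rho>) u \<partial>lborel) \<le> ennreal (unit_ball_vol (real DIM('a)) * \<rho> ^ DIM('a)) * gag s unitB u"
proof -
  let ?f = "\<lambda>x. (\<integral>\<^sup>+y. ennreal ((u x - u y)\<^sup>2 * frac_ker s (x - y)) * indicator unitB y \<partial>lborel) * indicator unitB x"
  have ind: "(indicator (ball z \<rho>) x :: ennreal) = indicator (ball x \<rho>) z" for x z :: 'a
    by (simp add: indicator_def dist_commute)
  have [measurable]: "(\<lambda>(z, x). indicator (ball x \<rho>) z :: ennreal) \<in> borel_measurable (borel \<Otimes>\<^sub>M (borel :: 'a measure))"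
  proof -
    have "Measurable.pred (borel \<Otimes>\<^sub>M borel) (\<lambda>w::'a\<times>'a. dist (snd w) (fst w) < \<rho>)" by measurable
    then show ?thesis
      by (simp add: indicator_def[abs_def] split_beta')
  qed
  have "(\<integral>\<^sup>+z. gag s (unitB \<inter> ball z \<rho>) u \<partial>lborel) \<le> (\<integral>\<^sup>+z. \<integral>\<^sup>+x. ?f x * indicator (ball x \<rho>) z \<partial>lborel \<partial>lborel)"
    unfolding gag_def
  proof (intro nn_integral_mono)
    fix z x :: 'a
    have "(\<integral>\<^sup>+y. ennreal ((u x - u y)\<^sup>2 * frac_ker s (x - y)) * indicator (unitB \<inter> ball z \<rho>) y \<partial>lborel)
       \<le> (\<integral>\<^sup>+y. ennreal ((u x - u y)\<^sup>2 * frac_ker s (x - y)) * indicator unitB y \<partial>lborel)"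
      by (intro nn_integral_mono mult_left_mono) (auto simp: indicator_def)
    then show "(\<integral>\<^sup>+y. ennreal ((u x - u y)\<^sup>2 * frac_ker s (x - y)) * indicator (unitB \<inter> ball z \<rho>) y \<partial>lborel)
        * indicator (unitB \<inter> ball z \<rho>) x \<le> ?f x * indicator (ball x \<rho>) z"
      by (auto simp: indicator_def dist_commute)
  qed
  also have "\<dots> = (\<integral>\<^sup>+x. \<integral>\<^sup>+z. ?f x * indicator (ball x \<rho>) z \<partial>lborel \<partial>lborel)"
    by (rule lborel_pair.Fubini') (simp add: split_beta')
  also have "\<dots> = (\<integral>\<^sup>+x. ?f x * ennreal (unit_ball_vol (real DIM('a)) * \<rho> ^ DIM('a)) \<partial>lborel)"
    by (intro nn_integral_cong) (simp add: nn_integral_cmult emeasure_lborel_ball \<rho>)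
  also have "\<dots> = ennreal (unit_ball_vol (real DIM('a)) * \<rho> ^ DIM('a)) * gag s unitB u"
    unfolding gag_def by (subst nn_integral_multc) (simp_all add: mult.commute)
  finally show ?thesis .
qed

text \<open>A radial function has the same energy on all rotated copies of a ball of radius \<open>\<rho>\<close>, so such a ball
  only carries a fraction of order \<open>\<rho> ^ (N - 1)\<close> of the total energy. With \<open>s > 1/2\<close> this
  makes the oscillation over dyadic balls summable.\<close>
lemma gag_radial_ball:
  fixes u :: "'a::euclidean_space \<Rightarrow> real"
  assumes u [measurable]: "u \<in> borel_measurable borel" and r: "radial u" and c: "c \<noteq> 0" and \<rho>: "\<rho> > 0"
  shows "ennreal (\<rho> * norm c ^ (DIM('a) - 1)) * gag s (unitB \<inter> ball c \<rho>) u
      \<le> ennreal ((2 * \<rho>) ^ DIM('a)) * gag s unitB u"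
proof -
  define t where "t = norm c"
  define n where "n = DIM('a)"
  define w where "w = unit_ball_vol (real n)"
  have t: "t > 0" and n: "n > 0" and w: "w > 0" using c by (simp_all add: t_def n_def w_def)
  \<comment> \<open>For z in this shell, c can be rotated onto the ray through z, to a point closer
    than \<open>\<rho>\<close> to z. The rotated ball lies in \<open>ball z (2 * \<rho>)\<close>, so
    every such z contributes at least the energy on the ball around c to the average.\<close>
  let ?A = "ball 0 (t + \<rho>) - ball (0::'a) t"
  have A: "ennreal (w * (\<rho> * t ^ (n - 1))) \<le> emeasure lborel ?A"
  proof -
    have "emeasure lborel ?A = emeasure lborel (ball (0::'a) (t + \<rho>)) - emeasure lborel (ball (0::'a) t)"
      using \<rho> t by (intro emeasure_Diff) (auto simp: emeasure_lborel_ball)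
    also have "\<dots> = ennreal (w * (t + \<rho>) ^ n - w * t ^ n)"
      using \<rho> t w by (simp add: emeasure_lborel_ball n_def[symmetric] w_def[symmetric] ennreal_minus)
    finally have eq: "emeasure lborel ?A = ennreal (w * (t + \<rho>) ^ n - w * t ^ n)" .
    have "t ^ n + \<rho> * t ^ (n - 1) \<le> (t + \<rho>) ^ n"
    proof -
      have "t ^ n + \<rho> * t ^ (n - 1) = (t + \<rho>) * t ^ (n - 1)"
        using n by (cases n) (simp_all add: distrib_right)
      also have "\<dots> \<le> (t + \<rho>) * (t + \<rho>) ^ (n - 1)"
        using t \<rho> by (intro mult_left_mono power_mono) auto
      also have "\<dots> = (t + \<rho>) ^ n" using n by (cases n) simp_all
      finally show ?thesis .
    qed
    then have "w * (\<rho> * t ^ (n - 1)) \<le> w * ((t + \<rho>) ^ n - t ^ n)"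
      using w by (intro mult_left_mono) auto
    then show ?thesis unfolding eq by (intro ennreal_leI) (simp add: right_diff_distrib)
  qed
  have le: "gag s (unitB \<inter> ball c \<rho>) u * indicator ?A z \<le> gag s (unitB \<inter> ball z (2 * \<rho>)) u" for z
  proof (cases "z \<in> ?A")
    case True
    then have z: "t \<le> norm z" "norm z < t + \<rho>" by auto
    have z0: "norm z > 0" using z t by linarith
    have "norm c = norm ((t / norm z) *\<^sub>R z)" using z0 t by (simp add: t_def)
    then obtain T where T: "orthogonal_transformation T" "T c = (t / norm z) *\<^sub>R z"
      by (rule orthogonal_transformation_between)
    have "z - T c = (1 - t / norm z) *\<^sub>R z" unfolding T(2) by (simp add: algebra_simps)
    then have "dist z (T c) = \<bar>1 - t / norm z\<bar> * norm z" by (simp add: dist_norm)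
    also have "\<dots> = norm z - t" using z z0 t by (simp add: abs_if field_simps)
    finally have "dist z (T c) < \<rho>" using z by simp
    then have "ball (T c) \<rho> \<subseteq> ball z (2 * \<rho>)"
      by (auto simp: subset_iff) (smt (verit) dist_triangle)
    then have "gag s (unitB \<inter> ball (T c) \<rho>) u \<le> gag s (unitB \<inter> ball z (2 * \<rho>)) u"
      by (intro gag_mono) auto
    then show ?thesis using gag_rotate[OF u r T(1)] True by simp
  qed simp
  have "ennreal w * (ennreal (\<rho> * t ^ (n - 1)) * gag s (unitB \<inter> ball c \<rho>) u)
      = ennreal (w * (\<rho> * t ^ (n - 1))) * gag s (unitB \<inter> ball c \<rho>) u"
    using w \<rho> t by (simp add: ennreal_mult mult.assoc)
  also have "\<dots> \<le> emeasure lborel ?A * gag s (unitB \<inter> ball c \<rho>) u"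
    by (intro mult_right_mono A) simp
  also have "\<dots> = (\<integral>\<^sup>+z. gag s (unitB \<inter> ball c \<rho>) u * indicator ?A z \<partial>lborel)"
    by (subst nn_integral_cmult) (simp_all add: mult.commute)
  also have "\<dots> \<le> (\<integral>\<^sup>+z. gag s (unitB \<inter> ball z (2 * \<rho>)) u \<partial>lborel)"
    by (intro nn_integral_mono le)
  also have "\<dots> \<le> ennreal (w * (2 * \<rho>) ^ n) * gag s unitB u"
    unfolding w_def n_def using \<rho> by (intro gag_average u) simp
  also have "\<dots> = ennreal w * (ennreal ((2 * \<rho>) ^ n) * gag s unitB u)"
    using w \<rho> by (simp add: ennreal_mult mult.assoc)
  finally show ?thesis
    using w unfolding t_def n_def by (simp add: ennreal_mult_le_mult_iff)
qed

section \<open>Averages over balls and their oscillation\<close>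

definition avg :: "'a::euclidean_space set \<Rightarrow> ('a \<Rightarrow> real) \<Rightarrow> real" where
  "avg D f = (\<integral>x. f x * indicator D x \<partial>lborel) / measure lborel D"

text \<open>Jensen's inequality for the square, by integrating its tangent line at
  \<open>avg D f - a\<close>; the pointwise bound is the non-negativity of
  \<open>(f x - avg D f)\<^sup>2\<close>.\<close>

lemma avg_Jensen:
  fixes f :: "'a::euclidean_space \<Rightarrow> real"
  assumes [measurable]: "f \<in> borel_measurable borel" "D \<in> sets borel"
    and b: "\<And>x. \<bar>f x\<bar> \<le> K" and fin: "emeasure lborel D < \<infinity>" and pos: "measure lborel D > 0"
  shows "ennreal ((avg D f - a)\<^sup>2 * measure lborel D) \<le> (\<integral>\<^sup>+x. ennreal ((f x - a)\<^sup>2) * indicator D x \<partial>lborel)"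
proof -
  let ?m = "avg D f" and ?\<mu> = "measure lborel D"
  have iD: "integrable lborel (indicator D :: 'a \<Rightarrow> real)"
    using fin by (simp add: integrable_indicator_iff less_top)
  have if1: "integrable lborel (\<lambda>x. f x * indicator D x)"
  proof (rule Bochner_Integration.integrable_bound)
    show "integrable lborel (\<lambda>x. K * indicator D x)" using iD by simp
    show "AE x in lborel. norm (f x * indicator D x) \<le> norm (K * indicator D x)"
      using b order_trans[OF b abs_ge_self] by (intro AE_I2) (auto simp: indicator_def)
  qed simp
  have if2: "integrable lborel (\<lambda>x. (f x - a)\<^sup>2 * indicator D x)"
  proof (rule Bochner_Integration.integrable_bound)
    show "integrable lborel (\<lambda>x. (K + \<bar>a\<bar>)\<^sup>2 * indicator D x)" using iD by simp
    have "(f x - a)\<^sup>2 \<le> (K + \<bar>a\<bar>)\<^sup>2" for x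
      using b[of x] by (intro abs_le_square_iff[THEN iffD1]) linarith
    then show "AE x in lborel. norm ((f x - a)\<^sup>2 * indicator D x) \<le> norm ((K + \<bar>a\<bar>)\<^sup>2 * indicator D x)"
      by (intro AE_I2) (auto simp: indicator_def)
  qed simp
  have "(?m - a)\<^sup>2 * ?\<mu> = (\<integral>x. 2 * (?m - a) * (f x * indicator D x) - ((?m - a)\<^sup>2 + 2 * (?m - a) * a) * indicator D x \<partial>lborel)"
  proof -
    have "(\<integral>x. f x * indicator D x \<partial>lborel) = ?m * ?\<mu>" using pos by (simp add: avg_def)
    then have "(\<integral>x. 2 * (?m - a) * (f x * indicator D x) - ((?m - a)\<^sup>2 + 2 * (?m - a) * a) * indicator D x \<partial>lborel)
       = 2 * (?m - a) * (?m * ?\<mu>) - ((?m - a)\<^sup>2 + 2 * (?m - a) * a) * ?\<mu>"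
      using if1 iD by simp
    then show ?thesis by (simp add: power2_eq_square algebra_simps)
  qed
  also have "\<dots> \<le> (\<integral>x. (f x - a)\<^sup>2 * indicator D x \<partial>lborel)"
  proof (rule integral_mono)
    fix x
    have "0 \<le> (f x - ?m)\<^sup>2" by simp
    then have "2 * (?m - a) * f x - ((?m - a)\<^sup>2 + 2 * (?m - a) * a) \<le> (f x - a)\<^sup>2"
      by (simp add: power2_eq_square algebra_simps)
    then show "2 * (?m - a) * (f x * indicator D x) - ((?m - a)\<^sup>2 + 2 * (?m - a) * a) * indicator D x \<le> (f x - a)\<^sup>2 * indicator D x"
      by (auto simp: indicator_def)
  qed (use if1 iD if2 in auto)
  finally have "ennreal ((?m - a)\<^sup>2 * ?\<mu>) \<le> ennreal (\<integral>x. (f x - a)\<^sup>2 * indicator D x \<partial>lborel)"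
    by (rule ennreal_leI)
  also have "\<dots> = (\<integral>\<^sup>+x. ennreal ((f x - a)\<^sup>2 * indicator D x) \<partial>lborel)"
    using if2 by (intro nn_integral_eq_integral[symmetric]) auto
  also have "\<dots> = (\<integral>\<^sup>+x. ennreal ((f x - a)\<^sup>2) * indicator D x \<partial>lborel)"
    by (intro nn_integral_cong) (auto simp: indicator_def)
  finally show ?thesis .
qed

text \<open>Jensen in each of the two variables bounds the left side by the double integral of
  \<open>(f x - f y)\<^sup>2\<close> over D and E. Two points of a ball of radius R are at most
  \<open>2 * R\<close> apart, which bounds the kernel from below.\<close>

lemma avg_diff_gag:
  fixes f :: "'a::euclidean_space \<Rightarrow> real"
  assumes [measurable]: "f \<in> borel_measurable borel" "D \<in> sets borel" "E \<in> sets borel"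
    and b: "\<And>x. \<bar>f x\<bar> \<le> K"
    and pos: "measure lborel D > 0" "measure lborel E > 0"
    and sub: "D \<subseteq> unitB \<inter> ball c R" "E \<subseteq> unitB \<inter> ball c R" and s: "s > 0" and R: "R > 0"
  shows "ennreal ((avg D f - avg E f)\<^sup>2 * measure lborel D * measure lborel E)
     \<le> ennreal ((2 * R) powr (real DIM('a) + 2 * s)) * gag s (unitB \<inter> ball c R) f"
proof -
  let ?W = "unitB \<inter> ball c R"
  let ?q = "real DIM('a) + 2 * s"
  have fin: "emeasure lborel D < \<infinity>" "emeasure lborel E < \<infinity>"
    using emeasure_mono[of D "ball c R" lborel] emeasure_mono[of E "ball c R" lborel] sub emeasure_lborel_ball_finite[of c R]
    by (auto intro: le_less_trans)
  have "ennreal ((avg D f - avg E f)\<^sup>2 * measure lborel D * measure lborel E)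
      = ennreal ((avg D f - avg E f)\<^sup>2 * measure lborel D) * ennreal (measure lborel E)"
    by (simp add: ennreal_mult)
  also have "\<dots> \<le> (\<integral>\<^sup>+x. ennreal ((f x - avg E f)\<^sup>2) * indicator D x \<partial>lborel) * ennreal (measure lborel E)"
    by (intro mult_right_mono avg_Jensen[OF _ _ b fin(1) pos(1)]) auto
  also have "\<dots> = (\<integral>\<^sup>+x. ennreal ((avg E f - f x)\<^sup>2 * measure lborel E) * indicator D x \<partial>lborel)"
    by (subst nn_integral_multc[symmetric])
       (auto intro!: nn_integral_cong simp: ennreal_mult power2_commute mult_ac)
  also have "\<dots> \<le> (\<integral>\<^sup>+x. (\<integral>\<^sup>+y. ennreal ((f y - f x)\<^sup>2) * indicator E y \<partial>lborel) * indicator D x \<partial>lborel)"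
    by (intro nn_integral_mono mult_right_mono avg_Jensen[OF _ _ b fin(2) pos(2)]) auto
  also have "\<dots> \<le> (\<integral>\<^sup>+x. ennreal ((2 * R) powr ?q) * ((\<integral>\<^sup>+y. ennreal ((f x - f y)\<^sup>2 * frac_ker s (x - y)) * indicator ?W y \<partial>lborel) * indicator ?W x) \<partial>lborel)"
  proof (rule nn_integral_mono)
    fix x :: 'a
    show "(\<integral>\<^sup>+y. ennreal ((f y - f x)\<^sup>2) * indicator E y \<partial>lborel) * indicator D x
       \<le> ennreal ((2 * R) powr ?q) * ((\<integral>\<^sup>+y. ennreal ((f x - f y)\<^sup>2 * frac_ker s (x - y)) * indicator ?W y \<partial>lborel) * indicator ?W x)"
    proof (cases "x \<in> D")
      case True
      then have x: "x \<in> ?W" using sub by auto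
      have "(\<integral>\<^sup>+y. ennreal ((f y - f x)\<^sup>2) * indicator E y \<partial>lborel)
         \<le> (\<integral>\<^sup>+y. ennreal ((2 * R) powr ?q) * (ennreal ((f x - f y)\<^sup>2 * frac_ker s (x - y)) * indicator ?W y) \<partial>lborel)"
      proof (rule nn_integral_mono)
        fix y :: 'a
        show "ennreal ((f y - f x)\<^sup>2) * indicator E y
          \<le> ennreal ((2 * R) powr ?q) * (ennreal ((f x - f y)\<^sup>2 * frac_ker s (x - y)) * indicator ?W y)"
        proof (cases "y \<in> E \<and> x \<noteq> y")
          case True
          then have y: "y \<in> ?W" using sub by auto
          have "norm (x - y) \<le> 2 * R"
            using x y dist_triangle[of x y c] by (auto simp: dist_norm[symmetric] dist_commute)
          then have "norm (x - y) powr ?q \<le> (2 * R) powr ?q" using s by (intro powr_mono2) auto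
          then have "1 \<le> (2 * R) powr ?q * frac_ker s (x - y)"
          proof -
            have "norm (x - y) powr ?q > 0" using True by simp
            moreover have "frac_ker s (x - y) = inverse (norm (x - y) powr ?q)"
              unfolding frac_ker_def by (rule powr_minus)
            ultimately show ?thesis
              using \<open>norm (x - y) powr ?q \<le> (2 * R) powr ?q\<close> by (simp only: divide_inverse[symmetric] le_divide_eq_1_pos)
          qed
          then have "(f y - f x)\<^sup>2 * 1 \<le> (f y - f x)\<^sup>2 * ((2 * R) powr ?q * frac_ker s (x - y))"
            by (intro mult_left_mono) auto
          then have "ennreal ((f y - f x)\<^sup>2) \<le> ennreal ((2 * R) powr ?q * ((f x - f y)\<^sup>2 * frac_ker s (x - y)))"
            by (intro ennreal_leI) (simp add: power2_commute mult_ac)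
          then show ?thesis using True y by (simp add: ennreal_mult)
        qed auto
      qed
      also have "\<dots> = ennreal ((2 * R) powr ?q) * (\<integral>\<^sup>+y. ennreal ((f x - f y)\<^sup>2 * frac_ker s (x - y)) * indicator ?W y \<partial>lborel)"
        by (rule nn_integral_cmult) simp
      finally show ?thesis using True x by simp
    qed simp
  qed
  also have "\<dots> = ennreal ((2 * R) powr ?q) * gag s ?W f"
    unfolding gag_def by (rule nn_integral_cmult) simp
  finally show ?thesis .
qed

text \<open>Origin of the numbers, in \<open>avg_ball_diff\<close>: 4 bounds
  \<open>2 powr (2 * s)\<close>; 64 collects a 2 from the diameter in the kernel, a 2 from the
  doubled ball in \<open>gag_radial_ball\<close> and two 4s from radii as small as
  \<open>R / 4\<close>; the square comes from the volumes of two balls.\<close>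

definition osc_const :: "nat \<Rightarrow> real" where
  "osc_const n = 4 * 64 ^ n / (unit_ball_vol (real n))\<^sup>2"

text \<open>Count the powers of R in the squared difference of the averages: the kernel gives N + 2
  s, the radial gain N - 1, the two volumes - 2 N, which leaves 2 s - 1. Half of it is the Hoelder
  exponent, positive exactly for s > 1/2.\<close>

lemma avg_ball_diff:
  fixes f :: "'a::euclidean_space \<Rightarrow> real"
  assumes f: "f \<in> borel_measurable borel" and r: "radial f" and b: "\<And>x. \<bar>f x\<bar> \<le> K"
    and G: "gag s unitB f \<le> ennreal G" "G \<ge> 0" and s: "1/2 < s" "s < 1"
    and R: "R > 0" "r1 \<ge> R / 4" "r2 \<ge> R / 4" and \<tau>: "\<tau> > 0" "\<tau> \<le> norm c"
    and sub: "ball c1 r1 \<subseteq> unitB \<inter> ball c R" "ball c2 r2 \<subseteq> unitB \<inter> ball c R"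
  shows "\<bar>avg (ball c1 r1) f - avg (ball c2 r2) f\<bar>
      \<le> sqrt (osc_const DIM('a) * G / \<tau> ^ (DIM('a) - 1)) * R powr (s - 1/2)"
proof -
  define n where "n = DIM('a)"
  define w where "w = unit_ball_vol (real n)"
  define X where "X = (avg (ball c1 r1) f - avg (ball c2 r2) f)\<^sup>2"
  have w: "w > 0" by (simp add: w_def)
  have r0: "r1 > 0" "r2 > 0" using R by auto
  have c: "c \<noteq> 0" using \<tau> by auto
  have m: "measure lborel (ball c1 r1) = w * r1 ^ n" "measure lborel (ball c2 r2) = w * r2 ^ n"
    using r0 w by (simp_all add: measure_def emeasure_lborel_ball w_def n_def)
  have "ennreal (X * (w * r1 ^ n) * (w * r2 ^ n)) \<le> ennreal ((2 * R) powr (real n + 2 * s)) * gag s (unitB \<inter> ball c R) f"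
    using avg_diff_gag[OF f _ _ b _ _ sub, of s] r0 w s R by (simp add: m X_def n_def)
  then have "ennreal (\<tau> ^ (n - 1) * R) * ennreal (X * (w * r1 ^ n) * (w * r2 ^ n))
     \<le> ennreal (R * norm c ^ (n - 1)) * (ennreal ((2 * R) powr (real n + 2 * s)) * gag s (unitB \<inter> ball c R) f)"
    using \<tau> R by (intro mult_mono) (auto intro!: ennreal_leI mult_mono power_mono simp: mult.commute)
  also have "\<dots> = ennreal ((2 * R) powr (real n + 2 * s)) * (ennreal (R * norm c ^ (n - 1)) * gag s (unitB \<inter> ball c R) f)"
    by (simp add: mult_ac)
  also have "\<dots> \<le> ennreal ((2 * R) powr (real n + 2 * s)) * (ennreal ((2 * R) ^ n) * ennreal G)"
    using order_trans[OF gag_radial_ball[OF f r c R(1), of s] mult_left_mono[OF G(1)]]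
    by (intro mult_left_mono) (simp_all add: n_def)
  finally have f1: "\<tau> ^ (n - 1) * R * (X * (w * r1 ^ n) * (w * r2 ^ n)) \<le> (2 * R) powr (real n + 2 * s) * ((2 * R) ^ n * G)"
    using \<tau> R G w r0 by (simp add: X_def flip: ennreal_mult)
  have f2: "\<tau> ^ (n - 1) * R * (X * (w * (R / 4) ^ n) * (w * (R / 4) ^ n)) \<le> \<tau> ^ (n - 1) * R * (X * (w * r1 ^ n) * (w * r2 ^ n))"
    using \<tau> R w by (intro mult_left_mono mult_mono power_mono) (auto simp: X_def)
  have f3: "(2 * R) powr (real n + 2 * s) = (2 * R) ^ n * (2 powr (2 * s) * R powr (2 * s))"
    using R by (simp add: powr_add powr_realpow powr_mult)
  have f4: "2 powr (2 * s) \<le> (4::real)"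
    using powr_mono[of "2 * s" 2 "2::real"] s by simp
  have "\<tau> ^ (n - 1) * R * (X * (w * (R / 4) ^ n) * (w * (R / 4) ^ n)) \<le> (2 * R) ^ n * (2 powr (2 * s) * R powr (2 * s)) * ((2 * R) ^ n * G)"
    by (rule order_trans[OF f2 f1[unfolded f3]])
  also have "\<dots> \<le> (2 * R) ^ n * (4 * R powr (2 * s)) * ((2 * R) ^ n * G)"
    using R G f4 by (intro mult_right_mono mult_left_mono) auto
  also have "R powr (2 * s) = R * R powr (2 * s - 1)"
    using R by (simp add: powr_diff)
  finally have "\<tau> ^ (n - 1) * R * (X * (w * (R ^ n / 4 ^ n)) * (w * (R ^ n / 4 ^ n)))
      \<le> (2 ^ n * R ^ n) * (4 * (R * R powr (2 * s - 1))) * ((2 ^ n * R ^ n) * G)"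
    by (simp only: power_mult_distrib power_divide)
  then have "\<tau> ^ (n - 1) * R * (X * (w * (R ^ n / 4 ^ n)) * (w * (R ^ n / 4 ^ n))) * (4 ^ n * 4 ^ n)
      \<le> (2 ^ n * R ^ n) * (4 * (R * R powr (2 * s - 1))) * ((2 ^ n * R ^ n) * G) * (4 ^ n * 4 ^ n)"
    by (rule mult_right_mono) simp
  also have "\<tau> ^ (n - 1) * R * (X * (w * (R ^ n / 4 ^ n)) * (w * (R ^ n / 4 ^ n))) * (4 ^ n * 4 ^ n)
      = R * R ^ n * R ^ n * (\<tau> ^ (n - 1) * X * w\<^sup>2)"
    by (simp add: power2_eq_square)
  also have "(2 ^ n * R ^ n) * (4 * (R * R powr (2 * s - 1))) * ((2 ^ n * R ^ n) * G) * (4 ^ n * 4 ^ n)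
      = R * R ^ n * R ^ n * (4 * (2 ^ n * 2 ^ n * 4 ^ n * 4 ^ n) * R powr (2 * s - 1) * G)"
    by (simp only: mult_ac)
  also have "2 ^ n * 2 ^ n * 4 ^ n * 4 ^ n = (64::real) ^ n"
    by (simp flip: power_mult_distrib)
  finally have "R * R ^ n * R ^ n * (\<tau> ^ (n - 1) * X * w\<^sup>2) \<le> R * R ^ n * R ^ n * (4 * 64 ^ n * R powr (2 * s - 1) * G)" .
  then have "\<tau> ^ (n - 1) * X * w\<^sup>2 \<le> 4 * 64 ^ n * R powr (2 * s - 1) * G"
    using R by (subst (asm) mult_le_cancel_left_pos) auto
  then have "X \<le> osc_const n * G / \<tau> ^ (n - 1) * R powr (2 * s - 1)"
    using \<tau> w by (simp add: osc_const_def w_def[symmetric] field_simps)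
  then have "sqrt X \<le> sqrt (osc_const n * G / \<tau> ^ (n - 1) * R powr (2 * s - 1))"
    by simp
  also have "\<dots> = sqrt (osc_const n * G / \<tau> ^ (n - 1)) * R powr (s - 1/2)"
  proof -
    have "R powr (2 * s - 1) = (R powr (s - 1/2))\<^sup>2"
      by (simp add: power2_eq_square flip: powr_add)
    then show ?thesis by (simp only: real_sqrt_mult real_sqrt_abs abs_of_nonneg powr_ge_zero)
  qed
  finally show ?thesis by (simp add: X_def n_def)
qed

section \<open>Hoelder continuity away from the origin\<close>

lemma rtest_props:
  assumes "\<phi> \<in> rtest"
  shows "\<phi> \<in> Cc_inf unitB" "radial \<phi>" "\<phi> \<in> borel_measurable borel" "\<And>x. x \<notin> unitB \<Longrightarrow> \<phi> x = 0"
    "\<exists>K>0. \<forall>x. \<bar>\<phi> x\<bar> \<le> K"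
  using assms Cc_inf_measurable Cc_inf_bounded by (auto simp: rtest_def dest: Cc_inf_outside)

text \<open>For \<open>\<rho> \<le> norm x\<close> this ball touches the sphere through x from
  inside at x. It stays in the unit ball even if x lies on the boundary, so the estimates reach up
  to there.\<close>

definition tangent_ball :: "'a::euclidean_space \<Rightarrow> real \<Rightarrow> 'a set" where
  "tangent_ball x \<rho> = ball ((1 - \<rho> / norm x) *\<^sub>R x) \<rho>"

lemma tangent_ball_dist:
  fixes x :: "'a::euclidean_space"
  assumes "0 < \<rho>" "\<rho> \<le> norm x"
  shows "norm ((1 - \<rho> / norm x) *\<^sub>R x) = norm x - \<rho>"
    and "dist ((1 - \<rho> / norm x) *\<^sub>R x) x = \<rho>"
proof -
  have x: "norm x > 0" using assms by linarith
  have "norm ((1 - \<rho> / norm x) *\<^sub>R x) = \<bar>1 - \<rho> / norm x\<bar> * norm x" by simp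
  also have "\<bar>1 - \<rho> / norm x\<bar> = 1 - \<rho> / norm x" using assms x by (intro abs_of_nonneg) simp
  also have "(1 - \<rho> / norm x) * norm x = norm x - \<rho>" using x by (simp add: left_diff_distrib)
  finally show "norm ((1 - \<rho> / norm x) *\<^sub>R x) = norm x - \<rho>" .
  have "(1 - \<rho> / norm x) *\<^sub>R x - x = - ((\<rho> / norm x) *\<^sub>R x)" by (simp add: scaleR_diff_left)
  then show "dist ((1 - \<rho> / norm x) *\<^sub>R x) x = \<rho>"
    using assms x by (simp add: dist_norm)
qed

lemma tangent_ball_subset:
  fixes x :: "'a::euclidean_space"
  assumes "0 < \<rho>" "\<rho> \<le> norm x" "norm x \<le> 1"
  shows "tangent_ball x \<rho> \<subseteq> unitB"
proof
  fix y assume "y \<in> tangent_ball x \<rho>"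
  then have "dist ((1 - \<rho> / norm x) *\<^sub>R x) y < \<rho>" by (simp add: tangent_ball_def)
  then have "norm y < norm ((1 - \<rho> / norm x) *\<^sub>R x) + \<rho>"
    using norm_triangle_sub[of y "(1 - \<rho> / norm x) *\<^sub>R x"] by (simp add: dist_norm norm_minus_commute)
  then show "y \<in> unitB"
    using tangent_ball_dist(1)[OF assms(1,2)] assms(3) by simp
qed

text \<open>Telescoping over the dyadic tangent balls at \<open>x\<close>, whose averages converge to \<open>f x\<close>.\<close>
lemma avg_tangent_ball:
  fixes f :: "'a::euclidean_space \<Rightarrow> real"
  assumes f: "f \<in> rtest" and G: "gag s unitB f \<le> ennreal G" "G \<ge> 0" and s: "1/2 < s" "s < 1"
    and \<tau>: "\<tau> > 0" and x: "2 * \<tau> \<le> norm x" "norm x \<le> 1" and \<rho>: "0 < \<rho>" "\<rho> \<le> \<tau>"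
  shows "\<bar>f x - avg (tangent_ball x \<rho>) f\<bar>
    \<le> sqrt (osc_const DIM('a) * G / \<tau> ^ (DIM('a) - 1)) * \<rho> powr (s - 1/2) / (1 - (1/2) powr (s - 1/2))"
proof -
  note ft = rtest_props[OF f]
  obtain K where K: "\<And>x. \<bar>f x\<bar> \<le> K" using ft(5) by blast
  obtain L where L: "L > 0" "\<And>x y. \<bar>f x - f y\<bar> \<le> L * norm (x - y)" by (rule Cc_inf_Lipschitz[OF ft(1)]) blast
  define H where "H = sqrt (osc_const DIM('a) * G / \<tau> ^ (DIM('a) - 1))"
  define q where "q = (1/2::real) powr (s - 1/2)"
  have H: "H \<ge> 0" unfolding H_def using G \<tau> by (simp add: osc_const_def)
  have q: "0 < q" "q < 1"
    using powr_less_mono2[of "s - 1/2" "1/2" "1::real"] s by (simp_all add: q_def)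
  define a where "a j = avg (tangent_ball x (\<rho> / 2 ^ j)) f" for j :: nat
  have rj: "0 < \<rho> / 2 ^ j" "\<rho> / 2 ^ j \<le> \<rho>" for j
    using \<rho> by (simp_all add: divide_le_eq)
  have nx: "\<rho> / 2 ^ j \<le> norm x" for j using rj(2)[of j] \<rho> x \<tau> by linarith
  have step: "\<bar>a j - a (Suc j)\<bar> \<le> H * \<rho> powr (s - 1/2) * q ^ j" for j
  proof -
    let ?c = "\<lambda>j. (1 - \<rho> / 2 ^ j / norm x) *\<^sub>R x"
    \<comment> \<open>Halving the radius moves the centre towards x by exactly the new radius, so
      the balls are nested.\<close>
    have sub: "tangent_ball x (\<rho> / 2 ^ Suc j) \<subseteq> tangent_ball x (\<rho> / 2 ^ j)"
    proof
      fix y assume "y \<in> tangent_ball x (\<rho> / 2 ^ Suc j)"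
      then have y: "dist (?c (Suc j)) y < \<rho> / 2 ^ Suc j" by (simp add: tangent_ball_def)
      have x0: "norm x > 0" using x \<tau> by linarith
      have "?c j - ?c (Suc j) = (\<rho> / 2 ^ Suc j / norm x - \<rho> / 2 ^ j / norm x) *\<^sub>R x"
        by (simp add: scaleR_diff_left[symmetric] del: power_Suc)
      also have "\<dots> = - ((\<rho> / 2 ^ Suc j / norm x) *\<^sub>R x)"
        by (simp add: scaleR_diff_left[symmetric] scaleR_minus_left[symmetric] del: scaleR_minus_left)
      finally have "dist (?c j) (?c (Suc j)) = \<rho> / 2 ^ Suc j"
        using \<rho> x0 by (simp add: dist_norm)
      then have "dist (?c j) y < \<rho> / 2 ^ Suc j + \<rho> / 2 ^ Suc j"
        using y dist_triangle[of "?c j" y "?c (Suc j)"] by linarith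
      then show "y \<in> tangent_ball x (\<rho> / 2 ^ j)" by (simp add: tangent_ball_def)
    qed
    have "\<bar>a j - a (Suc j)\<bar> \<le> sqrt (osc_const DIM('a) * G / \<tau> ^ (DIM('a) - 1)) * (\<rho> / 2 ^ j) powr (s - 1/2)"
      unfolding a_def tangent_ball_def
    proof (rule avg_ball_diff[OF ft(3,2) K G s, where c="?c j"])
      show "\<tau> \<le> norm (?c j)"
        using tangent_ball_dist(1)[OF rj(1) nx, of j] rj(2)[of j] \<rho> x by linarith
      show "ball (?c j) (\<rho> / 2 ^ j) \<subseteq> unitB \<inter> ball (?c j) (\<rho> / 2 ^ j)"
        using tangent_ball_subset[OF rj(1) nx x(2), of j] by (auto simp: tangent_ball_def)
      then show "ball (?c (Suc j)) (\<rho> / 2 ^ Suc j) \<subseteq> unitB \<inter> ball (?c j) (\<rho> / 2 ^ j)"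
        using sub unfolding tangent_ball_def by blast
      have quarter: "r / 4 \<le> r" "r / 4 \<le> r / 2" if "r > 0" for r :: real using that by simp_all
      show "\<rho> / 2 ^ j / 4 \<le> \<rho> / 2 ^ j" by (rule quarter(1)[OF rj(1)])
      have "\<rho> / 2 ^ Suc j = \<rho> / 2 ^ j / 2" by simp
      then show "\<rho> / 2 ^ j / 4 \<le> \<rho> / 2 ^ Suc j" using quarter(2)[OF rj(1)] by metis
    qed (use rj(1) \<tau> in auto)
    also have "(\<rho> / 2 ^ j) powr (s - 1/2) = \<rho> powr (s - 1/2) * q ^ j"
    proof -
      have "\<rho> / 2 ^ j = \<rho> * (1/2) ^ j" by (simp add: power_one_over)
      then have "(\<rho> / 2 ^ j) powr (s - 1/2) = \<rho> powr (s - 1/2) * ((1/2) ^ j) powr (s - 1/2)"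
        using \<rho> by (simp only: powr_mult)
      also have "((1/2::real) ^ j) powr (s - 1/2) = ((1/2) powr real j) powr (s - 1/2)"
        by (subst powr_realpow) simp_all
      also have "\<dots> = q powr real j"
        unfolding q_def powr_powr by (simp only: mult.commute)
      also have "\<dots> = q ^ j" by (rule powr_realpow[OF q(1)])
      finally show ?thesis .
    qed
    finally show ?thesis by (simp add: H_def mult_ac)
  qed
  have part: "\<bar>a 0 - a n\<bar> \<le> H * \<rho> powr (s - 1/2) / (1 - q)" for n
  proof -
    have "a 0 - a n = (\<Sum>j<n. a j - a (Suc j))" by (rule sum_lessThan_telescope'[symmetric])
    also have "\<bar>\<dots>\<bar> \<le> (\<Sum>j<n. H * \<rho> powr (s - 1/2) * q ^ j)"
      by (rule order_trans[OF sum_abs]) (intro sum_mono step)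
    also have "\<dots> = H * \<rho> powr (s - 1/2) * (\<Sum>j<n. q ^ j)" by (simp add: sum_distrib_left)
    also have "\<dots> \<le> H * \<rho> powr (s - 1/2) * (1 / (1 - q))"
    proof (intro mult_left_mono)
      have "(\<Sum>j<n. q ^ j) \<le> (\<Sum>j. q ^ j)"
        using q by (intro sum_le_suminf summable_geometric) auto
      then show "(\<Sum>j<n. q ^ j) \<le> 1 / (1 - q)" using q by (simp add: suminf_geometric)
    qed (use H in auto)
    finally show ?thesis by simp
  qed
  \<comment> \<open>The Lipschitz constant of \<open>f\<close>, which its energy does not bound,
    serves to identify the limit and does not enter the estimate.\<close>
  have lim: "a \<longlonglongrightarrow> f x"
  proof (rule Lim_null[THEN iffD2], rule Lim_null_comparison)
    show "(\<lambda>j. 2 * L * \<rho> * (1/2) ^ j) \<longlonglongrightarrow> 0"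
      by (intro tendsto_mult_right_zero LIMSEQ_realpow_zero) auto
    have "\<bar>a j - f x\<bar> \<le> 2 * L * \<rho> * (1/2) ^ j" for j
    proof -
      let ?D = "tangent_ball x (\<rho> / 2 ^ j)"
      let ?b = "2 * L * (\<rho> / 2 ^ j)"
      have m: "emeasure lborel ?D = ennreal (unit_ball_vol (real DIM('a)) * (\<rho> / 2 ^ j) ^ DIM('a))"
        unfolding tangent_ball_def using rj(1)[of j] by (intro emeasure_lborel_ball) simp
      have fin: "emeasure lborel ?D < \<infinity>" by (simp add: m)
      have Dm: "?D \<in> sets borel" by (simp add: tangent_ball_def)
      have em: "emeasure lborel ?D = ennreal (measure lborel ?D)"
        using fin by (intro emeasure_eq_ennreal_measure) simp
      have mpos: "measure lborel ?D > 0"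
        using rj(1)[of j] by (simp add: measure_def m)
      have "ennreal ((a j - f x)\<^sup>2 * measure lborel ?D) \<le> (\<integral>\<^sup>+y. ennreal ((f y - f x)\<^sup>2) * indicator ?D y \<partial>lborel)"
        unfolding a_def by (rule avg_Jensen[OF ft(3) Dm K fin mpos])
      also have "\<dots> \<le> (\<integral>\<^sup>+y. ennreal (?b\<^sup>2) * indicator ?D y \<partial>lborel)"
      proof (intro nn_integral_mono)
        fix y
        show "ennreal ((f y - f x)\<^sup>2) * indicator ?D y \<le> ennreal (?b\<^sup>2) * indicator ?D y"
        proof (cases "y \<in> ?D")
          case True
          then have "dist y x \<le> 2 * (\<rho> / 2 ^ j)"
            using tangent_ball_dist(2)[OF rj(1) nx, of j] dist_triangle[of y x "(1 - \<rho> / 2 ^ j / norm x) *\<^sub>R x"]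
            unfolding tangent_ball_def by (simp add: dist_commute)
          then have "L * norm (y - x) \<le> L * (2 * (\<rho> / 2 ^ j))"
            using L(1) by (intro mult_left_mono) (auto simp: dist_norm)
          then have "\<bar>f y - f x\<bar> \<le> L * (2 * (\<rho> / 2 ^ j))" by (rule order_trans[OF L(2)])
          then have "\<bar>f y - f x\<bar> \<le> ?b" by (simp only: mult_ac)
          then have "(f y - f x)\<^sup>2 \<le> ?b\<^sup>2" using power_mono[of "\<bar>f y - f x\<bar>" ?b 2] by simp
          then show ?thesis by (intro mult_right_mono ennreal_leI) auto
        qed simp
      qed
      also have "\<dots> = ennreal (?b\<^sup>2 * measure lborel ?D)"
        by (subst nn_integral_cmult_indicator) (simp_all add: Dm em ennreal_mult)
      finally have "(a j - f x)\<^sup>2 * measure lborel ?D \<le> ?b\<^sup>2 * measure lborel ?D"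
        by (simp add: ennreal_le_iff)
      then have "(a j - f x)\<^sup>2 \<le> ?b\<^sup>2" using mpos by simp
      then have "\<bar>a j - f x\<bar> \<le> \<bar>?b\<bar>" by (simp only: abs_le_square_iff)
      also have "\<bar>?b\<bar> = 2 * L * \<rho> * (1/2) ^ j"
        using L(1) \<rho> by (simp add: abs_mult power_one_over)
      finally show ?thesis .
    qed
    then show "\<forall>\<^sub>F j in sequentially. norm (a j - f x) \<le> 2 * L * \<rho> * (1/2) ^ j" by simp
  qed
  have "(\<lambda>n. \<bar>a 0 - a n\<bar>) \<longlonglongrightarrow> \<bar>a 0 - f x\<bar>" by (intro tendsto_intros lim)
  then have "\<bar>a 0 - f x\<bar> \<le> H * \<rho> powr (s - 1/2) / (1 - q)"
    by (rule LIMSEQ_le_const2) (use part in auto)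
  then show ?thesis by (simp add: a_def H_def q_def abs_minus_commute)
qed

text \<open>With \<open>d = norm (x - y)\<close>, pass from \<open>f x\<close> to the average on the
  tangent ball of radius d at x, from there to the tangent ball at y, and back to
  \<open>f y\<close>. The centres are at most \<open>3 * d\<close> apart, so the ball of radius
  \<open>4 * d\<close> about the first one contains both; this is why \<open>avg_ball_diff\<close>
  admits radii down to \<open>R / 4\<close>.\<close>

lemma rtest_Hoelder:
  fixes ty :: "'a::euclidean_space itself"
  assumes s: "1/2 < s" "s < 1" and \<delta>: "\<delta> > 0"
  shows "\<exists>C\<ge>0. \<forall>f \<in> (rtest :: ('a \<Rightarrow> real) set). \<forall>G\<ge>0. gag s unitB f \<le> ennreal G \<longrightarrow>
    (\<forall>x y. \<delta> \<le> norm x \<longrightarrow> norm x \<le> 1 \<longrightarrow> \<delta> \<le> norm y \<longrightarrow> norm y \<le> 1 \<longrightarrow> norm (x - y) \<le> \<delta> / 2 \<longrightarrow>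
      \<bar>f x - f y\<bar> \<le> C * sqrt G * norm (x - y) powr (s - 1/2))"
proof -
  define \<tau> where "\<tau> = \<delta> / 2"
  have \<tau>: "\<tau> > 0" and \<tau>2: "2 * \<tau> = \<delta>" using \<delta> by (simp_all add: \<tau>_def)
  define A where "A = sqrt (osc_const DIM('a) / \<tau> ^ (DIM('a) - 1))"
  have A: "A \<ge> 0" using \<tau> by (simp add: A_def osc_const_def)
  define q where "q = (1/2::real) powr (s - 1/2)"
  have q: "0 < q" "q < 1"
    using powr_less_mono2[of "s - 1/2" "1/2" "1::real"] s by (simp_all add: q_def)
  \<comment> \<open>Two geometric tails, one for each end point, and the comparison of the two
    tangent balls inside a ball of radius \<open>4 * d\<close>.\<close>
  define C where "C = 2 * (A / (1 - q)) + A * 4 powr (s - 1/2)"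
  have C: "C \<ge> 0" using A q by (simp add: C_def)
  have "\<bar>f x - f y\<bar> \<le> C * sqrt G * norm (x - y) powr (s - 1/2)"
    if f: "f \<in> rtest" and G: "G \<ge> 0" "gag s unitB f \<le> ennreal G"
      and x: "\<delta> \<le> norm x" "norm x \<le> 1" and y: "\<delta> \<le> norm y" "norm y \<le> 1" and d: "norm (x - y) \<le> \<delta> / 2"
    for f :: "'a \<Rightarrow> real" and G x y
  proof (cases "x = y")
    case False
    note ft = rtest_props[OF f]
    obtain K where K: "\<And>x. \<bar>f x\<bar> \<le> K" using ft(5) by blast
    define d where "d = norm (x - y)"
    have dp: "d > 0" "d \<le> \<tau>" using False d by (simp_all add: d_def \<tau>_def)
    have xy0: "norm x > 0" "norm y > 0" using x y \<delta> by linarith+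
    have sq: "sqrt (osc_const DIM('a) * G / \<tau> ^ (DIM('a) - 1)) = A * sqrt G"
      unfolding A_def real_sqrt_mult[symmetric] by (simp add: mult_ac)
    have 1: "\<bar>f x - avg (tangent_ball x d) f\<bar> \<le> A * sqrt G * d powr (s - 1/2) / (1 - q)"
      using avg_tangent_ball[OF f G(2,1) s \<tau> _ x(2) dp] x(1) \<tau>2 unfolding sq q_def by simp
    have 2: "\<bar>f y - avg (tangent_ball y d) f\<bar> \<le> A * sqrt G * d powr (s - 1/2) / (1 - q)"
      using avg_tangent_ball[OF f G(2,1) s \<tau> _ y(2) dp] y(1) \<tau>2 unfolding sq q_def by simp
    let ?c = "\<lambda>x. (1 - d / norm x) *\<^sub>R x"
    have dx: "d \<le> norm x" "d \<le> norm y" using dp x y \<tau>_def \<tau> by linarith+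
    have cc: "dist (?c x) (?c y) \<le> 3 * d"
    proof -
      have "dist (?c x) (?c y) \<le> dist (?c x) x + dist x y + dist y (?c y)"
        using dist_triangle[of "?c x" "?c y" x] dist_triangle[of x "?c y" y] by linarith
      then show ?thesis
        using tangent_ball_dist(2)[OF dp(1) dx(1)] tangent_ball_dist(2)[OF dp(1) dx(2)]
        by (simp add: dist_commute d_def dist_norm)
    qed
    have "\<bar>avg (ball (?c x) d) f - avg (ball (?c y) d) f\<bar>
      \<le> sqrt (osc_const DIM('a) * G / \<tau> ^ (DIM('a) - 1)) * (4 * d) powr (s - 1/2)"
    proof (rule avg_ball_diff[OF ft(3,2) K G(2,1) s, where c="?c x"])
      show "\<tau> \<le> norm (?c x)"
        using tangent_ball_dist(1)[OF dp(1) dx(1)] dp x by (simp add: \<tau>_def)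
      show "ball (?c x) d \<subseteq> unitB \<inter> ball (?c x) (4 * d)"
        using tangent_ball_subset[OF dp(1) dx(1) x(2)] dp unfolding tangent_ball_def by (auto intro: less_le_trans)
      have "ball (?c y) d \<subseteq> ball (?c x) (4 * d)"
      proof
        fix z assume "z \<in> ball (?c y) d"
        then have "dist (?c x) z < 3 * d + d" using cc dist_triangle[of "?c x" z "?c y"] unfolding mem_ball by linarith
        then show "z \<in> ball (?c x) (4 * d)" by simp
      qed
      then show "ball (?c y) d \<subseteq> unitB \<inter> ball (?c x) (4 * d)"
        using tangent_ball_subset[OF dp(1) dx(2) y(2)] unfolding tangent_ball_def by blast
    qed (use dp \<tau> in auto)
    then have 3: "\<bar>avg (tangent_ball x d) f - avg (tangent_ball y d) f\<bar> \<le> A * sqrt G * (4 powr (s - 1/2) * d powr (s - 1/2))"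
      using dp unfolding sq tangent_ball_def by (simp add: powr_mult)
    have "\<bar>f x - f y\<bar> \<le> A * sqrt G * d powr (s - 1/2) / (1 - q) + A * sqrt G * (4 powr (s - 1/2) * d powr (s - 1/2))
        + A * sqrt G * d powr (s - 1/2) / (1 - q)"
      using 1 2 3 by linarith
    also have "\<dots> = C * sqrt G * d powr (s - 1/2)"
      by (simp add: C_def algebra_simps add_divide_distrib)
    finally show ?thesis by (simp add: d_def)
  qed simp
  with C show ?thesis by blast
qed

text \<open>Walk outwards from \<open>x\<close> to the unit sphere, where \<open>f\<close> vanishes, in steps of length at most \<open>\<delta> / 2\<close>.\<close>
lemma rtest_bounded_away_from_0:
  fixes ty :: "'a::euclidean_space itself"
  assumes s: "1/2 < s" "s < 1" and \<delta>: "\<delta> > 0"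
  shows "\<exists>C\<ge>0. \<forall>f \<in> (rtest :: ('a \<Rightarrow> real) set). \<forall>G\<ge>0. gag s unitB f \<le> ennreal G \<longrightarrow>
    (\<forall>x. \<delta> \<le> norm x \<longrightarrow> \<bar>f x\<bar> \<le> C * sqrt G)"
proof -
  obtain C where C: "C \<ge> 0" and H: "\<And>f G x y. f \<in> (rtest :: ('a \<Rightarrow> real) set) \<Longrightarrow> G \<ge> 0 \<Longrightarrow> gag s unitB f \<le> ennreal G \<Longrightarrow>
     \<delta> \<le> norm x \<Longrightarrow> norm x \<le> 1 \<Longrightarrow> \<delta> \<le> norm y \<Longrightarrow> norm y \<le> 1 \<Longrightarrow> norm (x - y) \<le> \<delta> / 2 \<Longrightarrow>
      \<bar>f x - f y\<bar> \<le> C * sqrt G * norm (x - y) powr (s - 1/2)"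
    using rtest_Hoelder[OF s \<delta>, where 'a='a] by blast
  obtain n :: nat where n: "1 \<le> real n * (\<delta> / 2)"
    using ex_less_of_nat_mult[of "\<delta> / 2" 1] \<delta> by (auto intro: less_imp_le)
  have main: "\<bar>f x\<bar> \<le> real n * C * sqrt G"
    if f: "f \<in> rtest" and G: "G \<ge> 0" "gag s unitB f \<le> ennreal G" and x: "\<delta> \<le> norm x" "norm x \<le> 1" "1 \<le> norm x + real n * (\<delta> / 2)"
    for f :: "'a \<Rightarrow> real" and G x n
    using x
  proof (induction n arbitrary: x)
    case 0
    then show ?case using rtest_props(4)[OF f, of x] by simp
  next
    case (Suc n)
    have x0: "norm x > 0" using Suc.prems \<delta> by linarith
    \<comment> \<open>The cap makes the last step end on the sphere; a step of length at most 1
      costs no more than \<open>C * sqrt G\<close>.\<close>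
    define r where "r = min 1 (norm x + \<delta> / 2)"
    define y where "y = (r / norm x) *\<^sub>R x"
    have r: "norm x \<le> r" "r \<le> 1" "r - norm x \<le> \<delta> / 2" "r - norm x \<le> 1"
      using Suc.prems \<delta> unfolding r_def min_def by (auto simp: not_le)
    have "r > 0" using x0 r by linarith
    then have ny: "norm y = r" using x0 by (simp add: y_def)
    have "x - y = ((norm x - r) / norm x) *\<^sub>R x"
      using x0 by (simp add: y_def diff_divide_distrib scaleR_diff_left)
    then have nxy: "norm (x - y) = r - norm x" using x0 r by (simp add: abs_div)
    have "1 \<le> r + real n * (\<delta> / 2)"
    proof (cases "1 \<le> norm x + \<delta> / 2")
      case True
      then show ?thesis using \<delta> by (simp add: r_def min_def)
    next
      case False
      have "real (Suc n) * (\<delta> / 2) = \<delta> / 2 + real n * (\<delta> / 2)"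
        by (simp only: of_nat_Suc distrib_right mult_1)
      then show ?thesis
        using False Suc.prems(3) by (simp only: r_def min_def if_not_P if_False add.assoc)
    qed
    then have "\<bar>f y\<bar> \<le> real n * C * sqrt G"
      using Suc.IH[of y] Suc.prems r ny by simp
    moreover have "\<bar>f x - f y\<bar> \<le> C * sqrt G"
    proof -
      have "\<bar>f x - f y\<bar> \<le> C * sqrt G * norm (x - y) powr (s - 1/2)"
        using H[OF f G, of x y] Suc.prems r ny nxy by simp
      also have "\<dots> \<le> C * sqrt G * 1"
        using nxy r s C G powr_mono2[of "s - 1/2" "norm (x - y)" 1] by (intro mult_left_mono) auto
      finally show ?thesis by simp
    qed
    ultimately show ?case by (simp add: distrib_right)
  qed
  have "\<bar>f x\<bar> \<le> (real n * C) * sqrt G" if "f \<in> rtest" "G \<ge> 0" "gag s unitB f \<le> ennreal G" "\<delta> \<le> norm x"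
    for f :: "'a \<Rightarrow> real" and G x
  proof (cases "norm x \<le> 1")
    case True
    have "1 \<le> norm x + real n * (\<delta> / 2)" using n by (rule add_increasing[OF norm_ge_zero])
    then show ?thesis by (rule main[OF that True])
  next
    case False
    then show ?thesis using rtest_props(4)[OF that(1), of x] C that(2) by simp
  qed
  then show ?thesis using C by (intro exI[of _ "real n * C"]) auto
qed

section \<open>The energy space\<close>

lemma rtest_lincomb:
  assumes "f \<in> rtest" "g \<in> rtest"
  shows "(\<lambda>x. a * f x + b * g x) \<in> rtest"
proof -
  have "radial (\<lambda>x. a * f x + b * g x)"
    unfolding radial_def
  proof (intro allI impI)
    fix x y :: 'a assume "norm x = norm y"
    then have "f x = f y" "g x = g y" using assms unfolding rtest_def radial_def by blast+
    then show "a * f x + b * g x = a * f y + b * g y" by simp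
  qed
  with assms show ?thesis
    by (simp add: rtest_def Cc_inf_lincomb)
qed

lemma bump_rtest: "bump \<in> rtest"
  by (simp add: rtest_def bump_Cc_inf radial_bump)

text \<open>Boundedness and the Lipschitz condition together give
  \<open>(f x - f y)\<^sup>2 \<le> B * min 1 ((norm (x - y))\<^sup>2)\<close>, integrable against
  the kernel by \<open>frac_ker_truncated_finite\<close>. Uniformity in x serves twice: test
  functions have finite energy, and \<open>bump\<close> is usable as a cut-off.\<close>

lemma frac_energy_pointwise_finite:
  fixes f :: "'a::euclidean_space \<Rightarrow> real"
  assumes f: "f \<in> Cc_inf U" and s: "0 < s" "s < 1"
  shows "\<exists>C\<ge>0. \<forall>x. (\<integral>\<^sup>+y. ennreal ((f x - f y)\<^sup>2 * frac_ker s (x - y)) \<partial>lborel) \<le> ennreal C"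
proof -
  have [measurable]: "f \<in> borel_measurable borel" by (rule Cc_inf_measurable[OF f])
  obtain L where L: "L > 0" "\<And>x y. \<bar>f x - f y\<bar> \<le> L * norm (x - y)" by (rule Cc_inf_Lipschitz[OF f]) blast
  obtain K where K: "K > 0" "\<And>x. \<bar>f x\<bar> \<le> K" using Cc_inf_bounded[OF f] by blast
  define B where "B = max (L\<^sup>2) ((2 * K)\<^sup>2)"
  have B: "B \<ge> 0" by (simp add: B_def le_max_iff_disj)
  let ?m = "\<lambda>z::'a. min 1 ((norm z)\<^sup>2)"
  have le: "(f x - f y)\<^sup>2 \<le> B * ?m (x - y)" for x y
  proof -
    have "\<bar>f x - f y\<bar> \<le> 2 * K" using K(2)[of x] K(2)[of y] by linarith
    then have "\<bar>f x - f y\<bar>\<^sup>2 \<le> (2 * K)\<^sup>2" by (intro power_mono) auto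
    then have 1: "(f x - f y)\<^sup>2 \<le> B * 1" by (simp add: B_def)
    have "\<bar>f x - f y\<bar>\<^sup>2 \<le> (L * norm (x - y))\<^sup>2" using L(2) by (intro power_mono) auto
    also have "\<dots> \<le> B * (norm (x - y))\<^sup>2"
      unfolding power_mult_distrib by (intro mult_right_mono) (auto simp: B_def)
    finally have 2: "(f x - f y)\<^sup>2 \<le> B * (norm (x - y))\<^sup>2" by simp
    from 1 2 show ?thesis by (simp add: min_def)
  qed
  define I where "I = (\<integral>\<^sup>+z. ennreal (?m z * frac_ker s (z::'a)) \<partial>lborel)"
  have I: "I < \<infinity>" unfolding I_def by (rule frac_ker_truncated_finite[OF s])
  have "(\<integral>\<^sup>+y. ennreal ((f x - f y)\<^sup>2 * frac_ker s (x - y)) \<partial>lborel) \<le> ennreal (B * enn2real I)" for x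
  proof -
    have "(\<integral>\<^sup>+y. ennreal ((f x - f y)\<^sup>2 * frac_ker s (x - y)) \<partial>lborel)
        \<le> (\<integral>\<^sup>+y. ennreal B * ennreal (?m (y - x) * frac_ker s (y - x)) \<partial>lborel)"
    proof (rule nn_integral_mono)
      fix y
      have "(f x - f y)\<^sup>2 * frac_ker s (x - y) \<le> B * ?m (x - y) * frac_ker s (x - y)"
        by (intro mult_right_mono le) simp
      then show "ennreal ((f x - f y)\<^sup>2 * frac_ker s (x - y)) \<le> ennreal B * ennreal (?m (y - x) * frac_ker s (y - x))"
        using B by (simp add: frac_ker_minus[of s x] norm_minus_commute[of x] mult.assoc ennreal_leI flip: ennreal_mult)
    qed
    also have "\<dots> = ennreal B * (\<integral>\<^sup>+y. ennreal (?m (y + (- x)) * frac_ker s (y + (- x))) \<partial>lborel)"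
      by (subst nn_integral_cmult) simp_all
    also have "\<dots> = ennreal B * I"
      unfolding I_def by (subst nn_integral_lborel_translate) simp_all
    also have "\<dots> = ennreal (B * enn2real I)"
      using B I by (simp add: ennreal_mult less_top)
    finally show ?thesis .
  qed
  then show ?thesis using B by (intro exI[of _ "B * enn2real I"]) auto
qed

text \<open>The conditions of \<open>Hrad\<close> without approximability, so that norms of
  differences make sense before membership in the completion is known.\<close>

definition Hfin :: "real \<Rightarrow> ('a::euclidean_space \<Rightarrow> real) \<Rightarrow> bool" where
  "Hfin s u \<longleftrightarrow> u \<in> borel_measurable borel \<and> (\<forall>x. x \<notin> unitB \<longrightarrow> u x = 0) \<and> Hsq s u < \<infinity>"

text \<open>The squared norm as a real number. The Bochner integral of a non-integrable function is
  0 by default, so this is meaningful only together with \<open>Hfin\<close>.\<close>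

definition Hn :: "real \<Rightarrow> ('a::euclidean_space \<Rightarrow> real) \<Rightarrow> real" where
  "Hn s u = (\<integral>z. (dif u z)\<^sup>2 \<partial>pairM s)"

lemma Hn_nonneg [simp]: "0 \<le> Hn s u"
  by (simp add: Hn_def)

lemma Hfin_iff_L2fun:
  assumes s: "0 < s" "s < 1"
  shows "Hfin s u \<longleftrightarrow> u \<in> borel_measurable borel \<and> (\<forall>x. x \<notin> unitB \<longrightarrow> u x = 0) \<and> L2fun (pairM s) (dif u)"
proof -
  have "Hsq s u < \<infinity> \<longleftrightarrow> L2fun (pairM s) (dif u)" if [measurable]: "u \<in> borel_measurable borel" and "\<forall>x. x \<notin> unitB \<longrightarrow> u x = 0"
    using that by (subst Hsq_pair[OF that(1) s]) (auto simp: L2fun_iff_nn_integral)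
  then show ?thesis by (auto simp: Hfin_def)
qed

lemma Hfin_L2fun: "0 < s \<Longrightarrow> s < 1 \<Longrightarrow> Hfin s u \<Longrightarrow> L2fun (pairM s) (dif u)"
  by (simp add: Hfin_iff_L2fun)

lemma Hsq_eq_Hn:
  assumes "0 < s" "s < 1" "Hfin s u"
  shows "Hsq s u = ennreal (Hn s u)"
proof -
  have "Hsq s u = (\<integral>\<^sup>+z. ennreal ((dif u z)\<^sup>2) \<partial>pairM s)"
    using assms by (intro Hsq_pair) (auto simp: Hfin_def)
  also have "\<dots> = ennreal (Hn s u)"
    unfolding Hn_def by (rule L2fun_nn_integral[OF Hfin_L2fun[OF assms]])
  finally show ?thesis .
qed

lemma dif_lincomb: "dif (\<lambda>x. a * u x + b * v x) = (\<lambda>z. a * dif u z + b * dif v z)"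
  "dif (\<lambda>x. u x - v x) = (\<lambda>z. dif u z - dif v z)"
  by (auto simp: dif_def algebra_simps)

lemma Hfin_lincomb:
  assumes s: "0 < s" "s < 1" and "Hfin s u" "Hfin s v"
  shows "Hfin s (\<lambda>x. a * u x + b * v x)"
  using assms L2fun_lincomb[of "pairM s" "dif u" "dif v" a b] unfolding Hfin_iff_L2fun[OF s]
  by (auto simp: dif_lincomb)

lemma Hfin_diff: "0 < s \<Longrightarrow> s < 1 \<Longrightarrow> Hfin s u \<Longrightarrow> Hfin s v \<Longrightarrow> Hfin s (\<lambda>x. u x - v x)"
  using Hfin_lincomb[of s u v 1 "-1"] by simp

lemma Hn_diff_le:
  assumes s: "0 < s" "s < 1" and "Hfin s u" "Hfin s v"
  shows "Hn s (\<lambda>x. u x - v x) \<le> 2 * Hn s u + 2 * Hn s v"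
  unfolding Hn_def dif_lincomb by (intro integral_square_diff_le Hfin_L2fun assms)

lemma Hn_minus: "Hn s (\<lambda>x. v x - u x) = Hn s (\<lambda>x. u x - v x)"
  by (simp add: Hn_def dif_lincomb power2_commute)

lemma Hn_scale: "Hn s (\<lambda>x. c * u x) = c\<^sup>2 * Hn s u"
proof -
  have "dif (\<lambda>x. c * u x) = (\<lambda>z. c * dif u z)" by (auto simp: dif_def right_diff_distrib)
  then show ?thesis by (simp add: Hn_def power_mult_distrib)
qed

lemma square_sum_le:
  fixes a b e :: real
  assumes "e > 0"
  shows "(a + b)\<^sup>2 \<le> (1 + e) * a\<^sup>2 + (1 + 1 / e) * b\<^sup>2"
proof -
  have "0 \<le> (e * a - b)\<^sup>2 / e" using assms by simp
  also have "\<dots> = (1 + e) * a\<^sup>2 + (1 + 1 / e) * b\<^sup>2 - (a + b)\<^sup>2"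
    using assms by (simp add: field_simps power2_eq_square)
  finally show ?thesis by simp
qed

text \<open>The weighted form keeps the coefficient of \<open>Hn s v\<close> as close to 1 as
  desired: approximation by test functions must not spoil the sharp constant.\<close>

lemma Hn_le_near:
  assumes s: "0 < s" "s < 1" and uv: "Hfin s u" "Hfin s v" and e: "e > 0"
  shows "Hn s u \<le> (1 + e) * Hn s v + (1 + 1 / e) * Hn s (\<lambda>x. u x - v x)"
proof -
  have L: "L2fun (pairM s) (dif u)" "L2fun (pairM s) (dif v)" by (intro Hfin_L2fun s uv)+
  note D = L2fun_diff[OF L]
  have "a\<^sup>2 \<le> (1 + e) * b\<^sup>2 + (1 + 1 / e) * (a - b)\<^sup>2" for a b :: real
    using square_sum_le[OF e, of b "a - b"] by simp
  then have "Hn s u \<le> (\<integral>z. (1 + e) * (dif v z)\<^sup>2 + (1 + 1 / e) * (dif u z - dif v z)\<^sup>2 \<partial>pairM s)"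
    unfolding Hn_def using L D by (intro integral_mono) (auto simp: L2fun_def)
  then show ?thesis using L D by (simp add: Hn_def dif_lincomb L2fun_def)
qed

lemma Hfin_L2_lborel:
  assumes s: "0 < s" "s < 1" and u: "Hfin s u"
  shows "L2fun lborel u" "(\<integral>x. (u x)\<^sup>2 \<partial>lborel) \<le> Hn s u"
proof -
  have m [measurable]: "u \<in> borel_measurable borel" using u by (simp add: Hfin_def)
  have "(\<integral>\<^sup>+x. ennreal ((u x)\<^sup>2) \<partial>lborel) = (\<integral>\<^sup>+x. ennreal ((u x)\<^sup>2) * indicator unitB x \<partial>lborel)"
    using u by (intro nn_integral_cong) (auto simp: Hfin_def indicator_def)
  also have "\<dots> \<le> Hsq s u" by (simp add: Hsq_def)
  also have "\<dots> = ennreal (Hn s u)" by (rule Hsq_eq_Hn[OF s u])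
  finally have le: "(\<integral>\<^sup>+x. ennreal ((u x)\<^sup>2) \<partial>lborel) \<le> ennreal (Hn s u)" .
  then show 1: "L2fun lborel u"
    by (subst L2fun_iff_nn_integral) (auto intro: le_less_trans)
  show "(\<integral>x. (u x)\<^sup>2 \<partial>lborel) \<le> Hn s u"
    using le by (simp add: L2fun_nn_integral[OF 1])
qed

lemma Hfin_gag:
  fixes u :: "'a::euclidean_space \<Rightarrow> real"
  assumes s: "0 < s" "s < 1" and u: "Hfin s u"
  shows "Qf s unitB u \<le> ennreal (Hn s u)" "gag s unitB u \<le> ennreal (2 / cNs DIM('a) s * Hn s u)"
proof -
  have c: "cNs DIM('a) s > 0" by (rule cNs_pos[OF s])
  show Q: "Qf s unitB u \<le> ennreal (Hn s u)"
    unfolding Hsq_eq_Hn[OF s u, symmetric] by (simp add: Hsq_def)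
  have "gag s unitB u = ennreal (2 / cNs DIM('a) s) * Qf s unitB u"
    using c by (simp add: Qf_gag mult.assoc[symmetric] flip: ennreal_mult)
  also have "\<dots> \<le> ennreal (2 / cNs DIM('a) s) * ennreal (Hn s u)"
    by (intro mult_left_mono Q) simp
  finally show "gag s unitB u \<le> ennreal (2 / cNs DIM('a) s * Hn s u)"
    using c by (subst ennreal_mult) auto
qed

lemma rtest_Hfin:
  fixes f :: "'a::euclidean_space \<Rightarrow> real"
  assumes s: "0 < s" "s < 1" and f: "f \<in> rtest"
  shows "Hfin s f"
proof -
  have fC: "f \<in> Cc_inf unitB" using f by (simp add: rtest_def)
  have m [measurable]: "f \<in> borel_measurable borel" by (rule Cc_inf_measurable[OF fC])
  obtain K where K: "K > 0" "\<And>x. \<bar>f x\<bar> \<le> K" using Cc_inf_bounded[OF fC] by blast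
  obtain C where C: "C \<ge> 0" "\<And>x. (\<integral>\<^sup>+y. ennreal ((f x - f y)\<^sup>2 * frac_ker s (x - y)) \<partial>lborel) \<le> ennreal C"
    using frac_energy_pointwise_finite[OF fC s] by blast
  have "gag s unitB f \<le> (\<integral>\<^sup>+x. ennreal C * indicator (unitB::'a set) x \<partial>lborel)"
    unfolding gag_def
  proof (intro nn_integral_mono mult_right_mono)
    fix x :: 'a
    have "(\<integral>\<^sup>+y. ennreal ((f x - f y)\<^sup>2 * frac_ker s (x - y)) * indicator unitB y \<partial>lborel)
       \<le> (\<integral>\<^sup>+y. ennreal ((f x - f y)\<^sup>2 * frac_ker s (x - y)) \<partial>lborel)"
      by (intro nn_integral_mono) (auto simp: indicator_def)
    then show "(\<integral>\<^sup>+y. ennreal ((f x - f y)\<^sup>2 * frac_ker s (x - y)) * indicator unitB y \<partial>lborel) \<le> ennreal C"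
      using C(2) order_trans by blast
  qed simp
  also have "\<dots> < \<infinity>"
    by (simp add: nn_integral_cmult emeasure_lborel_ball ennreal_mult_less_top)
  finally have "Qf s unitB f < \<infinity>"
    by (simp add: Qf_gag ennreal_mult_less_top)
  moreover have "(\<integral>\<^sup>+x. ennreal ((f x)\<^sup>2) * indicator unitB x \<partial>lborel) < \<infinity>"
  proof -
    have "(\<integral>\<^sup>+x. ennreal ((f x)\<^sup>2) * indicator unitB x \<partial>lborel) \<le> (\<integral>\<^sup>+x. ennreal (K\<^sup>2) * indicator (unitB::'a set) x \<partial>lborel)"
      using power_mono[OF K(2) abs_ge_zero, where n=2] by (intro nn_integral_mono mult_right_mono ennreal_leI) auto
    also have "\<dots> < \<infinity>"
      by (simp add: nn_integral_cmult emeasure_lborel_ball ennreal_mult_less_top)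
    finally show ?thesis .
  qed
  ultimately show ?thesis
    using m Cc_inf_outside[OF fC] by (auto simp: Hfin_def Hsq_def)
qed

section \<open>The completion and its approximation by radial test functions\<close>

lemma Hrad_iff:
  assumes s: "0 < s" "s < 1"
  shows "u \<in> Hrad s \<longleftrightarrow> Hfin s u \<and> (\<forall>e>0. \<exists>\<phi>\<in>rtest. Hn s (\<lambda>x. \<phi> x - u x) < e)"
proof
  assume u: "u \<in> Hrad s"
  then have fin: "Hfin s u" by (auto simp: Hrad_def Hfin_def)
  obtain \<phi> where \<phi>: "\<And>k. \<phi> k \<in> rtest" "(\<lambda>k. Hsq s (\<lambda>x. \<phi> k x - u x)) \<longlonglongrightarrow> 0"
    using u by (auto simp: Hrad_def rtest_def)
  have "\<exists>\<psi>\<in>rtest. Hn s (\<lambda>x. \<psi> x - u x) < e" if e: "e > 0" for e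
  proof -
    have "\<forall>\<^sub>F k in sequentially. Hsq s (\<lambda>x. \<phi> k x - u x) < ennreal e"
      using order_tendstoD(2)[OF \<phi>(2)] e by simp
    then obtain k where "Hsq s (\<lambda>x. \<phi> k x - u x) < ennreal e"
      by (auto simp: eventually_sequentially)
    then have "Hn s (\<lambda>x. \<phi> k x - u x) < e"
      using Hsq_eq_Hn[OF s Hfin_diff[OF s rtest_Hfin[OF s \<phi>(1)] fin]] by (simp add: ennreal_less_iff)
    then show ?thesis using \<phi>(1) by blast
  qed
  with fin show "Hfin s u \<and> (\<forall>e>0. \<exists>\<phi>\<in>rtest. Hn s (\<lambda>x. \<phi> x - u x) < e)" by blast
next
  assume *: "Hfin s u \<and> (\<forall>e>0. \<exists>\<phi>\<in>rtest. Hn s (\<lambda>x. \<phi> x - u x) < e)"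
  then have "\<forall>k. \<exists>\<phi>\<in>rtest. Hn s (\<lambda>x. \<phi> x - u x) < 1 / real (Suc k)" by simp
  then obtain \<phi> where \<phi>: "\<And>k. \<phi> k \<in> rtest" "\<And>k. Hn s (\<lambda>x. \<phi> k x - u x) < 1 / real (Suc k)" by metis
  have "(\<lambda>k. Hn s (\<lambda>x. \<phi> k x - u x)) \<longlonglongrightarrow> 0"
    by (rule tendsto_sandwich[OF _ _ tendsto_const LIMSEQ_inverse_real_of_nat])
       (use \<phi>(2) in \<open>auto simp: inverse_eq_divide less_imp_le\<close>)
  then have "(\<lambda>k. ennreal (Hn s (\<lambda>x. \<phi> k x - u x))) \<longlonglongrightarrow> ennreal 0" by (rule tendsto_ennrealI)
  then have "(\<lambda>k. Hsq s (\<lambda>x. \<phi> k x - u x)) \<longlonglongrightarrow> 0"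
    using * by (simp add: Hsq_eq_Hn[OF s Hfin_diff[OF s rtest_Hfin[OF s \<phi>(1)]]])
  then show "u \<in> Hrad s"
    using * \<phi>(1) unfolding Hrad_def Hfin_def rtest_def by auto
qed

lemma Hrad_Hfin: "0 < s \<Longrightarrow> s < 1 \<Longrightarrow> u \<in> Hrad s \<Longrightarrow> Hfin s u"
  by (simp add: Hrad_iff)

lemma Hrad_lincomb:
  assumes s: "0 < s" "s < 1" and u: "u \<in> Hrad s" and v: "v \<in> Hrad s"
  shows "(\<lambda>x. a * u x + b * v x) \<in> Hrad s"
  unfolding Hrad_iff[OF s]
proof (intro conjI allI impI)
  have F: "Hfin s u" "Hfin s v" using u v s by (auto intro: Hrad_Hfin)
  then show "Hfin s (\<lambda>x. a * u x + b * v x)" by (rule Hfin_lincomb[OF s])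
  fix e :: real assume e: "e > 0"
  define d where "d = e / (4 * (a\<^sup>2 + b\<^sup>2 + 1))"
  have ab: "a\<^sup>2 + b\<^sup>2 + 1 > 0" by (simp add: add_nonneg_pos)
  have d: "d > 0" using e ab by (simp add: d_def)
  obtain \<phi> \<psi> where p: "\<phi> \<in> rtest" "Hn s (\<lambda>x. \<phi> x - u x) < d" "\<psi> \<in> rtest" "Hn s (\<lambda>x. \<psi> x - v x) < d"
    using u v d unfolding Hrad_iff[OF s] by blast
  have D: "Hfin s (\<lambda>x. \<phi> x - u x)" "Hfin s (\<lambda>x. \<psi> x - v x)"
    by (rule Hfin_diff[OF s rtest_Hfin[OF s p(1)] F(1)], rule Hfin_diff[OF s rtest_Hfin[OF s p(3)] F(2)])
  have S: "Hfin s (\<lambda>x. c * w x)" if "Hfin s w" for c and w :: "'a \<Rightarrow> real"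
    using Hfin_lincomb[OF s that that, of c 0] by simp
  have "Hn s (\<lambda>x. (a * \<phi> x + b * \<psi> x) - (a * u x + b * v x)) = Hn s (\<lambda>x. a * (\<phi> x - u x) - (- b) * (\<psi> x - v x))"
    by (simp add: algebra_simps)
  also have "\<dots> \<le> 2 * Hn s (\<lambda>x. a * (\<phi> x - u x)) + 2 * Hn s (\<lambda>x. (- b) * (\<psi> x - v x))"
    by (intro Hn_diff_le s S D)
  also have "\<dots> = 2 * (a\<^sup>2 * Hn s (\<lambda>x. \<phi> x - u x)) + 2 * (b\<^sup>2 * Hn s (\<lambda>x. \<psi> x - v x))"
    using Hn_scale[of s a "\<lambda>x. \<phi> x - u x"] Hn_scale[of s "- b" "\<lambda>x. \<psi> x - v x"] by simp
  also have "\<dots> \<le> 2 * (a\<^sup>2 * d) + 2 * (b\<^sup>2 * d)"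
    using p by (intro add_mono mult_left_mono) auto
  also have "\<dots> < 4 * (a\<^sup>2 + b\<^sup>2 + 1) * d"
  proof -
    have "0 \<le> a\<^sup>2 * d" "0 \<le> b\<^sup>2 * d" using d by simp_all
    moreover have "4 * (a\<^sup>2 + b\<^sup>2 + 1) * d = 4 * (a\<^sup>2 * d) + 4 * (b\<^sup>2 * d) + 4 * d" by (simp add: algebra_simps)
    ultimately show ?thesis using d by linarith
  qed
  also have "\<dots> = e" using ab by (simp add: d_def)
  finally show "\<exists>w\<in>rtest. Hn s (\<lambda>x. w x - (a * u x + b * v x)) < e"
    using rtest_lincomb[OF p(1,3), of a b] by (intro bexI[of _ "\<lambda>x. a * \<phi> x + b * \<psi> x"]) auto
qed

lemma Hrad_diff: "0 < s \<Longrightarrow> s < 1 \<Longrightarrow> u \<in> Hrad s \<Longrightarrow> v \<in> Hrad s \<Longrightarrow> (\<lambda>x. u x - v x) \<in> Hrad s"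
  using Hrad_lincomb[of s u v 1 "-1"] by simp

lemma rtest_Hrad:
  assumes s: "0 < s" "s < 1" and "\<phi> \<in> rtest"
  shows "\<phi> \<in> Hrad s"
  unfolding Hrad_iff[OF s]
proof (intro conjI allI impI rtest_Hfin assms)
  fix e :: real assume "e > 0"
  then show "\<exists>\<psi>\<in>rtest. Hn s (\<lambda>x. \<psi> x - \<phi> x) < e"
    using assms by (intro bexI[of _ \<phi>]) (auto simp: Hn_def dif_def)
qed

text \<open>Stands in for weak closedness of the completion. The functions \<open>dif \<psi>\<close>
  of test functions form a linear subspace of \<open>L\<^sup>2\<close> for \<open>pairM s\<close>,
  so Mazur's argument turns a bounded sequence converging almost everywhere into approximants in
  norm.\<close>

lemma Hrad_AE_limit:
  assumes s: "0 < s" "s < 1" and \<phi>: "\<And>k. \<phi> k \<in> rtest"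
    and m: "u \<in> borel_measurable borel" and out: "\<And>x. x \<notin> unitB \<Longrightarrow> u x = 0"
    and ae: "AE x in lborel. (\<lambda>k. \<phi> k x) \<longlonglongrightarrow> u x" and C: "\<And>k. Hn s (\<phi> k) \<le> C"
  shows "u \<in> Hrad s" "Hn s u \<le> C"
proof -
  have L: "L2fun (pairM s) (dif \<psi>)" if "\<psi> \<in> rtest" for \<psi> :: "'a \<Rightarrow> real"
    by (intro Hfin_L2fun rtest_Hfin s that)
  have md: "dif u \<in> borel_measurable (pairM s)" using m by measurable
  note aed = AE_pairM_dif_tendsto[OF ae, of s]
  note FC = C[unfolded Hn_def]
  note Fatou = L2_Fatou[OF L[OF \<phi>] md aed FC]
  show "Hn s u \<le> C" using Fatou(2) by (simp add: Hn_def)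
  show "u \<in> Hrad s"
    unfolding Hrad_iff[OF s]
  proof (intro conjI allI impI)
    show "Hfin s u" using m out Fatou(1) by (simp add: Hfin_iff_L2fun[OF s])
    fix e :: real assume e: "e > 0"
    have "\<exists>g\<in>dif ` rtest. (\<integral>z. (dif u z - g z)\<^sup>2 \<partial>pairM s) < e"
    proof (rule L2_Mazur[where F="\<lambda>k. dif (\<phi> k)", OF _ _ _ md aed FC e])
      fix g h :: "'a \<times> 'a \<Rightarrow> real" and t assume "g \<in> dif ` rtest" "h \<in> dif ` rtest"
      then obtain a b where "a \<in> rtest" "b \<in> rtest" "g = dif a" "h = dif b" by auto
      then show "(\<lambda>x. g x + t * h x) \<in> dif ` rtest"
        using rtest_lincomb[of a b 1 t] dif_lincomb(1)[of 1 a t b] by (intro image_eqI[of _ _ "\<lambda>x. 1 * a x + t * b x"]) auto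
    qed (use L \<phi> in auto)
    then show "\<exists>\<psi>\<in>rtest. Hn s (\<lambda>x. \<psi> x - u x) < e"
      by (auto simp: Hn_def dif_lincomb power2_commute)
  qed
qed

text \<open>The norm dominates the \<open>L\<^sup>2\<close>-norm, so a subsequence of any
  approximating sequence converges almost everywhere.\<close>

lemma Hrad_approx_AE:
  assumes s: "0 < s" "s < 1" and u: "u \<in> Hrad s"
  shows "\<exists>\<psi>. (\<forall>k. \<psi> k \<in> rtest) \<and> (\<lambda>k. Hn s (\<lambda>x. \<psi> k x - u x)) \<longlonglongrightarrow> 0 \<and> (AE x in lborel. (\<lambda>k. \<psi> k x) \<longlonglongrightarrow> u x)"
proof -
  have fin: "Hfin s u" by (rule Hrad_Hfin[OF s u])
  have "\<forall>k. \<exists>\<phi>\<in>rtest. Hn s (\<lambda>x. \<phi> x - u x) < 1 / real (Suc k)" using u unfolding Hrad_iff[OF s] by simp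
  then obtain \<phi> where \<phi>: "\<And>k. \<phi> k \<in> rtest" "\<And>k. Hn s (\<lambda>x. \<phi> k x - u x) < 1 / real (Suc k)" by metis
  have lim: "(\<lambda>k. Hn s (\<lambda>x. \<phi> k x - u x)) \<longlonglongrightarrow> 0"
    by (rule tendsto_sandwich[OF _ _ tendsto_const LIMSEQ_inverse_real_of_nat])
       (use \<phi>(2) in \<open>auto simp: inverse_eq_divide less_imp_le\<close>)
  have D: "Hfin s (\<lambda>x. \<phi> k x - u x)" for k by (rule Hfin_diff[OF s rtest_Hfin[OF s \<phi>(1)] fin])
  note L = Hfin_L2_lborel[OF s D]
  have "(\<lambda>k. \<integral>x. (\<phi> k x - u x)\<^sup>2 \<partial>lborel) \<longlonglongrightarrow> 0"
    by (rule tendsto_sandwich[OF _ _ tendsto_const lim]) (use L(2) in auto)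
  then have "(\<lambda>k. \<integral>x. norm ((\<phi> k x - u x)\<^sup>2) \<partial>lborel) \<longlonglongrightarrow> 0" by simp
  then obtain r :: "nat \<Rightarrow> nat" where r: "strict_mono r" "AE x in lborel. (\<lambda>k. (\<phi> (r k) x - u x)\<^sup>2) \<longlonglongrightarrow> 0"
    using tendsto_L1_AE_subseq[of lborel "\<lambda>k x. (\<phi> k x - u x)\<^sup>2"] L2fun_integrable[OF L(1)] by blast
  have "AE x in lborel. (\<lambda>k. \<phi> (r k) x) \<longlonglongrightarrow> u x"
    using r(2)
  proof (rule eventually_mono)
    fix x assume "(\<lambda>k. (\<phi> (r k) x - u x)\<^sup>2) \<longlonglongrightarrow> 0"
    then have "(\<lambda>k. sqrt ((\<phi> (r k) x - u x)\<^sup>2)) \<longlonglongrightarrow> sqrt 0" by (rule tendsto_real_sqrt)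
    then show "(\<lambda>k. \<phi> (r k) x) \<longlonglongrightarrow> u x"
      by (simp add: tendsto_rabs_zero_iff LIM_zero_iff)
  qed
  moreover have "(\<lambda>k. Hn s (\<lambda>x. \<phi> (r k) x - u x)) \<longlonglongrightarrow> 0"
    using LIMSEQ_subseq_LIMSEQ[OF lim r(1)] by (simp add: o_def)
  ultimately show ?thesis using \<phi>(1) by (intro exI[of _ "\<lambda>k. \<phi> (r k)"]) auto
qed

section \<open>Compactness and localization\<close>

lemma crit_gt_2: "s > 0 \<Longrightarrow> real n > 2 * s \<Longrightarrow> crit n s > 2"
  by (simp add: crit_def field_simps)

text \<open>The pointwise bound for test functions passes to almost every point along an
  approximating sequence; the exceptional set depends on u, the constant does not.\<close>

lemma Hrad_bounded_away_from_0:
  fixes ty :: "'a::euclidean_space itself"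
  assumes s: "1/2 < s" "s < 1" and \<delta>: "\<delta> > 0"
  shows "\<exists>C\<ge>0. \<forall>u \<in> (Hrad s :: ('a \<Rightarrow> real) set). AE x in lborel. \<delta> \<le> norm x \<longrightarrow> (u x)\<^sup>2 \<le> C * Hn s u"
proof -
  have s0: "0 < s" using s by simp
  note S = s0 s(2)
  obtain C where C: "C \<ge> 0" and B: "\<And>f G x. f \<in> (rtest :: ('a \<Rightarrow> real) set) \<Longrightarrow> G \<ge> 0 \<Longrightarrow> gag s unitB f \<le> ennreal G \<Longrightarrow>
     \<delta> \<le> norm x \<Longrightarrow> \<bar>f x\<bar> \<le> C * sqrt G"
    using rtest_bounded_away_from_0[OF s \<delta>, where 'a='a] by blast
  define c where "c = 2 / cNs DIM('a) s"
  have c: "c > 0" using cNs_pos[OF S] by (simp add: c_def)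
  have rt: "(\<psi> x)\<^sup>2 \<le> C\<^sup>2 * c * Hn s \<psi>" if "\<psi> \<in> rtest" "\<delta> \<le> norm x" for \<psi> :: "'a \<Rightarrow> real" and x
  proof -
    have "\<bar>\<psi> x\<bar> \<le> C * sqrt (c * Hn s \<psi>)"
      using Hfin_gag(2)[OF S rtest_Hfin[OF S that(1)]] c by (intro B that) (auto simp: c_def)
    then have "\<bar>\<psi> x\<bar>\<^sup>2 \<le> (C * sqrt (c * Hn s \<psi>))\<^sup>2" by (intro power_mono) auto
    then show ?thesis using c by (simp add: power_mult_distrib)
  qed
  have "AE x in lborel. \<delta> \<le> norm x \<longrightarrow> (u x)\<^sup>2 \<le> (2 * (C\<^sup>2 * c)) * Hn s u" if u: "u \<in> Hrad s" for u :: "'a \<Rightarrow> real"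
  proof -
    obtain \<psi> where \<psi>: "\<And>k. \<psi> k \<in> rtest" "(\<lambda>k. Hn s (\<lambda>x. \<psi> k x - u x)) \<longlonglongrightarrow> 0" "AE x in lborel. (\<lambda>k. \<psi> k x) \<longlonglongrightarrow> u x"
      using Hrad_approx_AE[OF S u] by blast
    show ?thesis
      using \<psi>(3)
    proof (rule eventually_mono, intro impI)
      fix x assume x: "(\<lambda>k. \<psi> k x) \<longlonglongrightarrow> u x" "\<delta> \<le> norm x"
      have "(\<lambda>k. (\<psi> k x)\<^sup>2) \<longlonglongrightarrow> (u x)\<^sup>2" by (intro tendsto_intros x)
      moreover have "(\<lambda>k. C\<^sup>2 * c * (2 * Hn s u + 2 * Hn s (\<lambda>x. \<psi> k x - u x))) \<longlonglongrightarrow> C\<^sup>2 * c * (2 * Hn s u + 2 * 0)"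
        by (intro tendsto_intros \<psi>)
      moreover have "(\<psi> k x)\<^sup>2 \<le> C\<^sup>2 * c * (2 * Hn s u + 2 * Hn s (\<lambda>x. \<psi> k x - u x))" for k
      proof -
        have "Hn s (\<psi> k) \<le> 2 * Hn s u + 2 * Hn s (\<lambda>x. \<psi> k x - u x)"
          using Hn_le_near[OF S rtest_Hfin[OF S \<psi>(1)] Hrad_Hfin[OF S u], of 1 k] by simp
        then have "C\<^sup>2 * c * Hn s (\<psi> k) \<le> C\<^sup>2 * c * (2 * Hn s u + 2 * Hn s (\<lambda>x. \<psi> k x - u x))"
          using c by (intro mult_left_mono) auto
        with rt[OF \<psi>(1) x(2)] show ?thesis by (rule order_trans)
      qed
      ultimately have "(u x)\<^sup>2 \<le> C\<^sup>2 * c * (2 * Hn s u + 2 * 0)"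
        by (intro LIMSEQ_le[where X="\<lambda>k. (\<psi> k x)\<^sup>2"]) auto
      then show "(u x)\<^sup>2 \<le> (2 * (C\<^sup>2 * c)) * Hn s u" by (simp add: mult_ac)
    qed
  qed
  then show ?thesis using C c by (intro exI[of _ "2 * (C\<^sup>2 * c)"]) auto
qed

text \<open>On a closed annulus the Hoelder bound is equicontinuity and the bound away from the
  origin is uniform boundedness, which is what Arzela--Ascoli asks for.\<close>

lemma rtest_precompact_annulus:
  fixes \<phi> :: "nat \<Rightarrow> 'a::euclidean_space \<Rightarrow> real"
  assumes s: "1/2 < s" "s < 1" and \<phi>: "\<And>k. \<phi> k \<in> rtest" and G: "\<And>k. gag s unitB (\<phi> k) \<le> ennreal G" "G \<ge> 0"
    and \<delta>: "\<delta> > 0"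
  shows "\<exists>k. strict_mono (k :: nat \<Rightarrow> nat) \<and> (\<forall>x. \<delta> \<le> norm x \<longrightarrow> norm x \<le> 1 \<longrightarrow> convergent (\<lambda>j. \<phi> (k j) x))"
proof -
  obtain C where C: "C \<ge> 0" and B: "\<And>f G x. f \<in> (rtest :: ('a \<Rightarrow> real) set) \<Longrightarrow> G \<ge> 0 \<Longrightarrow> gag s unitB f \<le> ennreal G \<Longrightarrow>
     \<delta> \<le> norm x \<Longrightarrow> \<bar>f x\<bar> \<le> C * sqrt G"
    using rtest_bounded_away_from_0[OF s \<delta>, where 'a='a] by blast
  obtain D where D: "D \<ge> 0" and H: "\<And>f G x y. f \<in> (rtest :: ('a \<Rightarrow> real) set) \<Longrightarrow> G \<ge> 0 \<Longrightarrow> gag s unitB f \<le> ennreal G \<Longrightarrow>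
     \<delta> \<le> norm x \<Longrightarrow> norm x \<le> 1 \<Longrightarrow> \<delta> \<le> norm y \<Longrightarrow> norm y \<le> 1 \<Longrightarrow> norm (x - y) \<le> \<delta> / 2 \<Longrightarrow>
      \<bar>f x - f y\<bar> \<le> D * sqrt G * norm (x - y) powr (s - 1/2)"
    using rtest_Hoelder[OF s \<delta>, where 'a='a] by blast
  define E where "E = D * sqrt G + 1"
  have E: "E > 0" using D G by (simp add: E_def add_nonneg_pos)
  let ?S = "cball 0 1 - ball (0::'a) \<delta>"
  have S: "compact ?S" by (intro compact_diff) auto
  have M: "norm (\<phi> n x) \<le> C * sqrt G" if "x \<in> ?S" for n x
    using B[OF \<phi> G(2) G(1), of x] that by simp
  have eq: "\<exists>d>0. \<forall>n y. y \<in> ?S \<and> norm (x - y) < d \<longrightarrow> norm (\<phi> n x - \<phi> n y) < e" if x: "x \<in> ?S" and e: "e > 0" for x e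
  proof -
    \<comment> \<open>The first entry is the range of the Hoelder bound, the second solves
      \<open>E * d powr (s - 1/2) = e / 2\<close>.\<close>
    define d where "d = min (\<delta> / 2) ((e / (2 * E)) powr (1 / (s - 1/2)))"
    have d: "d > 0" using \<delta> e E by (simp add: d_def)
    have "norm (\<phi> n x - \<phi> n y) < e" if y: "y \<in> ?S" "norm (x - y) < d" for n y
    proof -
      have "norm (x - y) powr (s - 1/2) \<le> d powr (s - 1/2)" using y s by (intro powr_mono2) auto
      also have "\<dots> \<le> ((e / (2 * E)) powr (1 / (s - 1/2))) powr (s - 1/2)"
        using s d by (intro powr_mono2) (auto simp: d_def)
      also have "\<dots> = e / (2 * E)" using s e E unfolding powr_powr by simp
      finally have "E * norm (x - y) powr (s - 1/2) \<le> E * (e / (2 * E))" using E by (intro mult_left_mono) auto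
      also have "\<dots> < e" using E e by simp
      finally have "E * norm (x - y) powr (s - 1/2) < e" .
      moreover have "\<bar>\<phi> n x - \<phi> n y\<bar> \<le> D * sqrt G * norm (x - y) powr (s - 1/2)"
        by (rule H[OF \<phi> G(2) G(1)]) (use x y in \<open>auto simp: d_def\<close>)
      moreover have "D * sqrt G * norm (x - y) powr (s - 1/2) \<le> E * norm (x - y) powr (s - 1/2)"
        by (intro mult_right_mono) (auto simp: E_def)
      ultimately show ?thesis by simp
    qed
    with d show ?thesis by blast
  qed
  obtain g k where gk: "continuous_on ?S g" "strict_mono (k :: nat \<Rightarrow> nat)"
      "\<And>e. 0 < e \<Longrightarrow> \<exists>N. \<forall>n x. n \<ge> N \<and> x \<in> ?S \<longrightarrow> norm (\<phi> (k n) x - g x) < e"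
    using Arzela_Ascoli[OF S M eq] by blast
  have "convergent (\<lambda>j. \<phi> (k j) x)" if "\<delta> \<le> norm x" "norm x \<le> 1" for x
  proof -
    have "(\<lambda>j. \<phi> (k j) x) \<longlonglongrightarrow> g x"
      by (rule LIMSEQ_I) (use gk(3) that in fastforce)
    then show ?thesis by (auto simp: convergent_def)
  qed
  with gk(2) show ?thesis by blast
qed

text \<open>Diagonal sequence over the annuli with inner radii \<open>1 / real (Suc i)\<close>. The
  origin, a single null point, is left out, and the limit is set to 0 there.\<close>

lemma rtest_precompact:
  fixes \<phi> :: "nat \<Rightarrow> 'a::euclidean_space \<Rightarrow> real"
  assumes s: "1/2 < s" "s < 1" and \<phi>: "\<And>k. \<phi> k \<in> rtest" and G: "\<And>k. gag s unitB (\<phi> k) \<le> ennreal G" "G \<ge> 0"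
  shows "\<exists>k u. strict_mono (k :: nat \<Rightarrow> nat) \<and> u \<in> borel_measurable borel \<and> (\<forall>x. x \<notin> unitB \<longrightarrow> u x = 0)
    \<and> (\<forall>x. x \<noteq> 0 \<longrightarrow> (\<lambda>j. \<phi> (k j) x) \<longlonglongrightarrow> u x)"
proof -
  let ?P = "\<lambda>i r. \<forall>x. 1 / real (Suc i) \<le> norm x \<longrightarrow> norm x \<le> 1 \<longrightarrow> convergent (\<lambda>j. \<phi> (r j) x)"
  have "\<exists>k. strict_mono (k :: nat \<Rightarrow> nat) \<and> (\<forall>i. ?P i (id \<circ> k))"
  proof (rule subsequence_diagonalization_lemma[where P="?P" and r=id])
    fix i and r :: "nat \<Rightarrow> nat"
    show "\<exists>k. strict_mono (k :: nat \<Rightarrow> nat) \<and> ?P i (r \<circ> k)"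
      using rtest_precompact_annulus[of s "\<lambda>j. \<phi> (r j)" G "1 / real (Suc i)", OF s \<phi> G] by simp
  next
    fix i and r k1 k2 :: "nat \<Rightarrow> nat" and N
    assume 1: "?P i (r \<circ> k1)" and 2: "\<And>j. N \<le> j \<Longrightarrow> \<exists>j'. j \<le> j' \<and> k2 j = k1 j'"
    show "?P i (r \<circ> k2)"
    proof (intro allI impI)
      fix x :: 'a assume "1 / real (Suc i) \<le> norm x" "norm x \<le> 1"
      then obtain l where l: "(\<lambda>j. \<phi> ((r \<circ> k1) j) x) \<longlonglongrightarrow> l" using 1 by (auto simp: convergent_def)
      have "(\<lambda>j. \<phi> ((r \<circ> k2) j) x) \<longlonglongrightarrow> l"
      proof (rule LIMSEQ_I)
        fix e :: real assume "e > 0"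
        then obtain M where M: "\<And>j. j \<ge> M \<Longrightarrow> norm (\<phi> ((r \<circ> k1) j) x - l) < e"
          using LIMSEQ_D[OF l] by blast
        have "norm (\<phi> ((r \<circ> k2) j) x - l) < e" if "j \<ge> max M N" for j
          using 2[of j] M that by (metis comp_apply max.bounded_iff order_trans)
        then show "\<exists>M. \<forall>j\<ge>M. norm (\<phi> ((r \<circ> k2) j) x - l) < e" by blast
      qed
      then show "convergent (\<lambda>j. \<phi> ((r \<circ> k2) j) x)" by (auto simp: convergent_def)
    qed
  qed blast
  then obtain k :: "nat \<Rightarrow> nat" where k: "strict_mono k" "\<And>i. ?P i k" by auto
  define u where "u x = (if x = 0 then 0 else lim (\<lambda>j. \<phi> (k j) x))" for x
  have conv: "(\<lambda>j. \<phi> (k j) x) \<longlonglongrightarrow> u x" if x: "x \<noteq> 0" for x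
  proof -
    have "convergent (\<lambda>j. \<phi> (k j) x)"
    proof (cases "norm x \<le> 1")
      case True
      obtain i where "inverse (real (Suc i)) < norm x" using reals_Archimedean[of "norm x"] x by auto
      then show ?thesis using k(2)[of i] True by (simp add: inverse_eq_divide)
    next
      case False
      then show ?thesis using rtest_props(4)[OF \<phi>, of x] by (simp add: convergent_const)
    qed
    then show ?thesis using x by (simp add: u_def convergent_LIMSEQ_iff)
  qed
  have "u x = 0" if "x \<notin> unitB" for x
  proof -
    have "x \<noteq> 0" using that by auto
    from conv[OF this] show ?thesis
      using rtest_props(4)[OF \<phi> that] by (simp add: LIMSEQ_const_iff)
  qed
  moreover have "u \<in> borel_measurable borel"
  proof (rule borel_measurable_LIMSEQ_real)
    show "(\<lambda>j. if x = 0 then 0 else \<phi> (k j) x) \<longlonglongrightarrow> u x" for x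
      using conv[of x] by (auto simp: u_def)
    have [measurable]: "\<phi> (k j) \<in> borel_measurable borel" for j by (rule rtest_props(3)[OF \<phi>])
    show "(\<lambda>x. if x = 0 then 0 else \<phi> (k j) x) \<in> borel_measurable borel" for j by measurable
  qed
  ultimately show ?thesis using k(1) conv by blast
qed

text \<open>Here the energy on the ball is made to control an energy on the whole space. With b =
  \<open>bump\<close>, split \<open>b x * f x - b y * f y\<close> into
  \<open>b x * (f x - f y)\<close> and \<open>f y * (b x - b y)\<close>: the first costs 1 + e
  because \<open>b x \<le> 1\<close>, the second only the \<open>L\<^sup>2\<close>-norm, since
  \<open>(b x - b y)\<^sup>2\<close> integrated against the kernel is bounded uniformly.\<close>

lemma gag_bump_le:
  fixes ty :: "'a::euclidean_space itself"
  assumes s: "0 < s" "s < 1" and e: "e > 0"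
  shows "\<exists>C\<ge>0. \<forall>f \<in> (rtest :: ('a \<Rightarrow> real) set).
     gag s UNIV (\<lambda>x. bump x * f x) \<le> ennreal (1 + e) * gag s unitB f + ennreal C * (\<integral>\<^sup>+x. ennreal ((f x)\<^sup>2) \<partial>lborel)"
proof -
  let ?b = "bump :: 'a \<Rightarrow> real"
  have [measurable]: "?b \<in> borel_measurable borel" by (rule Cc_inf_measurable[OF bump_Cc_inf])
  obtain B where B: "B \<ge> 0" "\<And>x. (\<integral>\<^sup>+y. ennreal ((?b x - ?b y)\<^sup>2 * frac_ker s (x - y)) \<partial>lborel) \<le> ennreal B"
    using frac_energy_pointwise_finite[OF bump_Cc_inf s] by blast
  define d where "d = 1 + 1 / e"
  have d: "d > 0" using e by (simp add: d_def add_pos_pos)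
  have "gag s UNIV (\<lambda>x. bump x * f x) \<le> ennreal (1 + e) * gag s unitB f + ennreal (2 * d * B) * (\<integral>\<^sup>+x. ennreal ((f x)\<^sup>2) \<partial>lborel)"
    if f: "f \<in> rtest" for f :: "'a \<Rightarrow> real"
  proof -
    note out = rtest_props(4)[OF f]
    have [measurable]: "f \<in> borel_measurable borel" by (rule rtest_props(3)[OF f])
    let ?k = "\<lambda>x y :: 'a. (?b x - ?b y)\<^sup>2 * frac_ker s (x - y)"
    let ?g = "\<lambda>x y. ennreal ((f x - f y)\<^sup>2 * frac_ker s (x - y)) * indicator unitB y * indicator unitB x"
    have pt: "ennreal ((?b x * f x - ?b y * f y)\<^sup>2 * frac_ker s (x - y))
       \<le> ennreal (1 + e) * ?g x y + ennreal d * (ennreal ((f x)\<^sup>2) * ennreal (?k x y) + ennreal ((f y)\<^sup>2) * ennreal (?k x y))" for x y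
    proof -
      define i :: real where "i = indicator unitB y * indicator unitB x"
      have "(?b x * f x - ?b y * f y)\<^sup>2 \<le> (1 + e) * ((f x - f y)\<^sup>2 * i) + d * ((f x)\<^sup>2 * (?b x - ?b y)\<^sup>2 + (f y)\<^sup>2 * (?b x - ?b y)\<^sup>2)"
      proof (cases "x \<in> unitB \<and> y \<in> unitB")
        case True
        have "?b x * f x - ?b y * f y = ?b x * (f x - f y) + f y * (?b x - ?b y)" by (simp add: algebra_simps)
        then have "(?b x * f x - ?b y * f y)\<^sup>2 \<le> (1 + e) * (?b x * (f x - f y))\<^sup>2 + d * (f y * (?b x - ?b y))\<^sup>2"
          using square_sum_le[OF e] unfolding d_def by metis
        also have "\<dots> \<le> (1 + e) * (1 * (f x - f y)\<^sup>2) + d * ((f x)\<^sup>2 * (?b x - ?b y)\<^sup>2 + (f y)\<^sup>2 * (?b x - ?b y)\<^sup>2)"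
          unfolding power_mult_distrib using e d power_le_one[OF bump_range, of x 2]
          by (intro add_mono mult_left_mono mult_right_mono) auto
        finally show ?thesis using True by (simp add: i_def)
      next
        \<comment> \<open>At a point outside the ball both functions vanish, so such a pair only
          produces a term of the second kind; no energy across the boundary is involved.\<close>
        case False
        then consider "x \<notin> unitB" | "y \<notin> unitB" by blast
        then have "(?b x * f x - ?b y * f y)\<^sup>2 \<le> 1 * ((f x)\<^sup>2 * (?b x - ?b y)\<^sup>2 + (f y)\<^sup>2 * (?b x - ?b y)\<^sup>2)"
        proof cases
          case 1
          then have "?b x = 0" "f x = 0" using out bump_outside[of x] by auto
          then show ?thesis by (simp add: power_mult_distrib mult.commute)
        next
          case 2
          then have "?b y = 0" "f y = 0" using out bump_outside[of y] by auto
          then show ?thesis by (simp add: power_mult_distrib mult.commute)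
        qed
        also have "\<dots> \<le> d * ((f x)\<^sup>2 * (?b x - ?b y)\<^sup>2 + (f y)\<^sup>2 * (?b x - ?b y)\<^sup>2)"
          using e by (intro mult_right_mono) (auto simp: d_def)
        finally show ?thesis using False by (auto simp: i_def)
      qed
      then have "(?b x * f x - ?b y * f y)\<^sup>2 * frac_ker s (x - y)
        \<le> ((1 + e) * ((f x - f y)\<^sup>2 * i) + d * ((f x)\<^sup>2 * (?b x - ?b y)\<^sup>2 + (f y)\<^sup>2 * (?b x - ?b y)\<^sup>2)) * frac_ker s (x - y)"
        by (intro mult_right_mono) auto
      also have "\<dots> = (1 + e) * ((f x - f y)\<^sup>2 * frac_ker s (x - y) * i) + d * ((f x)\<^sup>2 * ?k x y + (f y)\<^sup>2 * ?k x y)"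
        by (simp add: algebra_simps)
      finally have "ennreal ((?b x * f x - ?b y * f y)\<^sup>2 * frac_ker s (x - y))
        \<le> ennreal ((1 + e) * ((f x - f y)\<^sup>2 * frac_ker s (x - y) * i) + d * ((f x)\<^sup>2 * ?k x y + (f y)\<^sup>2 * ?k x y))"
        by (rule ennreal_leI)
      also have "\<dots> = ennreal (1 + e) * ?g x y + ennreal d * (ennreal ((f x)\<^sup>2) * ennreal (?k x y) + ennreal ((f y)\<^sup>2) * ennreal (?k x y))"
        using e d by (auto simp: i_def indicator_def ennreal_mult[symmetric] ennreal_plus[symmetric] simp del: ennreal_plus)
      finally show ?thesis .
    qed
    have K1: "(\<integral>\<^sup>+x. \<integral>\<^sup>+y. ennreal ((f x)\<^sup>2) * ennreal (?k x y) \<partial>lborel \<partial>lborel) \<le> ennreal B * (\<integral>\<^sup>+x. ennreal ((f x)\<^sup>2) \<partial>lborel)"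
    proof -
      have "(\<integral>\<^sup>+x. \<integral>\<^sup>+y. ennreal ((f x)\<^sup>2) * ennreal (?k x y) \<partial>lborel \<partial>lborel) = (\<integral>\<^sup>+x. ennreal ((f x)\<^sup>2) * (\<integral>\<^sup>+y. ennreal (?k x y) \<partial>lborel) \<partial>lborel)"
        by (rule nn_integral_cong, rule nn_integral_cmult) simp
      also have "\<dots> \<le> (\<integral>\<^sup>+x. ennreal ((f x)\<^sup>2) * ennreal B \<partial>lborel)"
        by (intro nn_integral_mono mult_left_mono B(2)) simp
      also have "\<dots> = ennreal B * (\<integral>\<^sup>+x. ennreal ((f x)\<^sup>2) \<partial>lborel)"
        by (subst nn_integral_multc) (simp_all add: mult.commute)
      finally show ?thesis .
    qed
    have "(\<integral>\<^sup>+x. \<integral>\<^sup>+y. ennreal ((f y)\<^sup>2) * ennreal (?k x y) \<partial>lborel \<partial>lborel) = (\<integral>\<^sup>+y. \<integral>\<^sup>+x. ennreal ((f y)\<^sup>2) * ennreal (?k x y) \<partial>lborel \<partial>lborel)"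
      by (rule lborel_pair.Fubini') simp
    also have "\<dots> = (\<integral>\<^sup>+x. \<integral>\<^sup>+y. ennreal ((f x)\<^sup>2) * ennreal (?k x y) \<partial>lborel \<partial>lborel)"
    proof (rule nn_integral_cong, rule nn_integral_cong)
      fix x y :: 'a
      have "?k y x = ?k x y" using frac_ker_minus[of s x y] by (simp add: power2_commute)
      then show "ennreal ((f x)\<^sup>2) * ennreal (?k y x) = ennreal ((f x)\<^sup>2) * ennreal (?k x y)" by simp
    qed
    finally have K2: "(\<integral>\<^sup>+x. \<integral>\<^sup>+y. ennreal ((f y)\<^sup>2) * ennreal (?k x y) \<partial>lborel \<partial>lborel) \<le> ennreal B * (\<integral>\<^sup>+x. ennreal ((f x)\<^sup>2) \<partial>lborel)"
      using K1 by simp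
    have gg: "(\<integral>\<^sup>+x. \<integral>\<^sup>+y. ?g x y \<partial>lborel \<partial>lborel) = gag s unitB f"
      unfolding gag_def by (rule nn_integral_cong, rule nn_integral_multc) simp
    have "gag s UNIV (\<lambda>x. bump x * f x) = (\<integral>\<^sup>+x. \<integral>\<^sup>+y. ennreal ((?b x * f x - ?b y * f y)\<^sup>2 * frac_ker s (x - y)) \<partial>lborel \<partial>lborel)"
      by (simp add: gag_def)
    also have "\<dots> \<le> (\<integral>\<^sup>+x. \<integral>\<^sup>+y. ennreal (1 + e) * ?g x y + ennreal d * (ennreal ((f x)\<^sup>2) * ennreal (?k x y) + ennreal ((f y)\<^sup>2) * ennreal (?k x y)) \<partial>lborel \<partial>lborel)"
      by (rule nn_integral_mono, rule nn_integral_mono) (rule pt)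
    also have "\<dots> = (\<integral>\<^sup>+x. ennreal (1 + e) * (\<integral>\<^sup>+y. ?g x y \<partial>lborel) + ennreal d * ((\<integral>\<^sup>+y. ennreal ((f x)\<^sup>2) * ennreal (?k x y) \<partial>lborel) + (\<integral>\<^sup>+y. ennreal ((f y)\<^sup>2) * ennreal (?k x y) \<partial>lborel)) \<partial>lborel)"
      by (rule nn_integral_cong) (subst nn_integral_add, simp, simp, subst nn_integral_cmult, simp, subst nn_integral_cmult, simp, subst nn_integral_add, simp, simp, rule refl)
    also have "\<dots> = ennreal (1 + e) * gag s unitB f + ennreal d * ((\<integral>\<^sup>+x. \<integral>\<^sup>+y. ennreal ((f x)\<^sup>2) * ennreal (?k x y) \<partial>lborel \<partial>lborel) + (\<integral>\<^sup>+x. \<integral>\<^sup>+y. ennreal ((f y)\<^sup>2) * ennreal (?k x y) \<partial>lborel \<partial>lborel))"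
      unfolding gg[symmetric]
      by (subst nn_integral_add, simp, simp, subst nn_integral_cmult, simp, subst nn_integral_cmult, simp, subst nn_integral_add, simp, simp, rule refl)
    also have "\<dots> \<le> ennreal (1 + e) * gag s unitB f + ennreal d * (ennreal B * (\<integral>\<^sup>+x. ennreal ((f x)\<^sup>2) \<partial>lborel) + ennreal B * (\<integral>\<^sup>+x. ennreal ((f x)\<^sup>2) \<partial>lborel))"
      by (intro add_left_mono mult_left_mono add_mono K1 K2) simp
    also have "\<dots> = ennreal (1 + e) * gag s unitB f + ennreal (2 * d * B) * (\<integral>\<^sup>+x. ennreal ((f x)\<^sup>2) \<partial>lborel)"
    proof -
      have "ennreal d * (ennreal B + ennreal B) = ennreal (2 * d * B)"
        using d B(1) by (simp flip: ennreal_plus ennreal_mult)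
      then show ?thesis by (simp add: distrib_right[symmetric] mult.assoc[symmetric])
    qed
    finally show ?thesis .
  qed
  then show ?thesis using d B(1) by (intro exI[of _ "2 * d * B"]) auto
qed

section \<open>Concentration at the origin\<close>

text \<open>By homogeneity the sum may be taken to be 1, and \<open>z \<le> z powr q\<close> for z
  between 0 and 1. With q = 2 / p this leads from p-th powers to squared norms.\<close>

lemma powr_add_le_add_powr:
  fixes x y q :: real
  assumes "0 \<le> x" "0 \<le> y" "0 < q" "q \<le> 1"
  shows "(x + y) powr q \<le> x powr q + y powr q"
proof (cases "x + y = 0")
  case True
  then show ?thesis using assms by (simp add: add_nonneg_eq_0_iff)
next
  case False
  then have t: "x + y > 0" using assms by simp
  have le: "z / (x + y) \<le> (z / (x + y)) powr q" if "0 \<le> z" "z \<le> x + y" for z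
  proof (cases "z = 0")
    case True then show ?thesis by simp
  next
    case False
    have "(z / (x + y)) powr 1 \<le> (z / (x + y)) powr q"
      using that t False assms by (intro powr_mono') auto
    then show ?thesis using that t False by simp
  qed
  have "1 = x / (x + y) + y / (x + y)" using t by (simp add: add_divide_distrib[symmetric])
  also have "\<dots> \<le> (x / (x + y)) powr q + (y / (x + y)) powr q"
    using assms by (intro add_mono le) auto
  also have "\<dots> = (x powr q + y powr q) / (x + y) powr q"
    using assms t by (simp add: powr_divide add_divide_distrib)
  finally show ?thesis using t by (simp add: le_divide_eq)
qed

lemma Lp_Fatou:
  fixes p :: real and f :: "'a \<Rightarrow> real"
  assumes [measurable]: "\<And>k. F k \<in> borel_measurable M"
    and ae: "AE x in M. (\<lambda>k. F k x) \<longlonglongrightarrow> f x" and p: "p > 0"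
  shows "(\<integral>\<^sup>+x. ennreal (\<bar>f x\<bar> powr p) \<partial>M) \<le> liminf (\<lambda>k. \<integral>\<^sup>+x. ennreal (\<bar>F k x\<bar> powr p) \<partial>M)"
proof -
  have "(\<integral>\<^sup>+x. ennreal (\<bar>f x\<bar> powr p) \<partial>M) = (\<integral>\<^sup>+x. liminf (\<lambda>k. ennreal (\<bar>F k x\<bar> powr p)) \<partial>M)"
  proof (rule nn_integral_cong_AE)
    show "AE x in M. ennreal (\<bar>f x\<bar> powr p) = liminf (\<lambda>k. ennreal (\<bar>F k x\<bar> powr p))"
      using ae
    proof (rule eventually_mono)
      fix x assume x: "(\<lambda>k. F k x) \<longlonglongrightarrow> f x"
      have "(\<lambda>k. \<bar>F k x\<bar> powr p) \<longlonglongrightarrow> \<bar>f x\<bar> powr p"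
        using p by (intro tendsto_powr' tendsto_rabs x tendsto_const) auto
      then have "(\<lambda>k. ennreal (\<bar>F k x\<bar> powr p)) \<longlonglongrightarrow> ennreal (\<bar>f x\<bar> powr p)" by (rule tendsto_ennrealI)
      then show "ennreal (\<bar>f x\<bar> powr p) = liminf (\<lambda>k. ennreal (\<bar>F k x\<bar> powr p))"
        by (intro lim_imp_Liminf[symmetric]) simp_all
    qed
  qed
  also have "\<dots> \<le> liminf (\<lambda>k. \<integral>\<^sup>+x. ennreal (\<bar>F k x\<bar> powr p) \<partial>M)"
    by (rule nn_integral_liminf) simp
  finally show ?thesis .
qed

text \<open>The cut-off function competes in \<open>S_sob\<close>, and \<open>gag_bump_le\<close>
  bounds its energy. The estimate is put on the integral itself, with values in
  \<open>ennreal\<close>, so that Fatou's lemma can carry it to the completion.\<close>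

lemma rtest_local_Sobolev:
  fixes ty :: "'a::euclidean_space itself"
  assumes s: "0 < s" "s < 1" and N: "real DIM('a) > 2 * s" and Sb: "S_sob s TYPE('a) > 0" and e: "e > 0"
  shows "\<exists>C\<ge>0. \<forall>f \<in> (rtest :: ('a \<Rightarrow> real) set).
    (\<integral>\<^sup>+x. ennreal (\<bar>bump x * f x\<bar> powr crit DIM('a) s) \<partial>lborel)
      \<le> ennreal ((((1 + e) * Hn s f + C * (\<integral>x. (f x)\<^sup>2 \<partial>lborel)) / S_sob s TYPE('a)) powr (crit DIM('a) s / 2))"
proof -
  define p where "p = crit DIM('a) s"
  define T where "T = S_sob s TYPE('a)"
  have p: "p > 2" unfolding p_def by (rule crit_gt_2[OF s(1) N])
  have T: "T > 0" using Sb by (simp add: T_def)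
  obtain C0 where C0: "C0 \<ge> 0" "\<And>f. f \<in> (rtest :: ('a \<Rightarrow> real) set) \<Longrightarrow>
     gag s UNIV (\<lambda>x. bump x * f x) \<le> ennreal (1 + e) * gag s unitB f + ennreal C0 * (\<integral>\<^sup>+x. ennreal ((f x)\<^sup>2) \<partial>lborel)"
    using gag_bump_le[OF s e, where 'a='a] by blast
  define c where "c = cNs DIM('a) s / 2"
  have c: "c > 0" using cNs_pos[OF s] by (simp add: c_def)
  have "(\<integral>\<^sup>+x. ennreal (\<bar>bump x * f x\<bar> powr p) \<partial>lborel)
      \<le> ennreal ((((1 + e) * Hn s f + c * C0 * (\<integral>x. (f x)\<^sup>2 \<partial>lborel)) / T) powr (p / 2))" if f: "f \<in> rtest" for f :: "'a \<Rightarrow> real"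
  proof -
    define X where "X = (1 + e) * Hn s f + c * C0 * (\<integral>x. (f x)\<^sup>2 \<partial>lborel)"
    have X: "X \<ge> 0" using e c C0 by (simp add: X_def)
    let ?w = "\<lambda>x. bump x * f x"
    have fin: "Hfin s f" by (rule rtest_Hfin[OF s f])
    have w: "?w \<in> Cc_inf UNIV" using bump_mult_Cc_inf[OF rtest_props(1)[OF f], of UNIV] by simp
    have [measurable]: "?w \<in> borel_measurable borel" by (rule Cc_inf_measurable[OF w])
    have "Qf s UNIV ?w = ennreal c * gag s UNIV ?w" by (simp add: Qf_gag c_def)
    also have "\<dots> \<le> ennreal c * (ennreal (1 + e) * gag s unitB f + ennreal C0 * (\<integral>\<^sup>+x. ennreal ((f x)\<^sup>2) \<partial>lborel))"
      by (intro mult_left_mono C0 f) simp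
    also have "\<dots> = ennreal (1 + e) * Qf s unitB f + ennreal (c * C0 * (\<integral>x. (f x)\<^sup>2 \<partial>lborel))"
      using c C0 by (simp add: distrib_left Qf_gag c_def[symmetric] mult_ac L2fun_nn_integral[OF Hfin_L2_lborel(1)[OF s fin]] flip: ennreal_mult)
    also have "\<dots> \<le> ennreal (1 + e) * ennreal (Hn s f) + ennreal (c * C0 * (\<integral>x. (f x)\<^sup>2 \<partial>lborel))"
      by (intro add_right_mono mult_left_mono Hfin_gag(1)[OF s fin]) simp
    also have "\<dots> = ennreal X"
      using e c C0 by (simp add: X_def flip: ennreal_mult ennreal_plus)
    finally have "Qf s UNIV ?w \<le> ennreal X" .
    then have QX: "enn2real (Qf s UNIV ?w) \<le> X"
      using X by (intro enn2real_leI)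
    obtain K where K: "K > 0" "\<And>x. \<bar>?w x\<bar> \<le> K" using Cc_inf_bounded[OF w] by blast
    have "(\<integral>\<^sup>+x. ennreal (\<bar>?w x\<bar> powr p) \<partial>lborel) \<le> (\<integral>\<^sup>+x. ennreal (K powr p) * indicator (unitB::'a set) x \<partial>lborel)"
    proof (rule nn_integral_mono)
      fix x :: 'a
      show "ennreal (\<bar>?w x\<bar> powr p) \<le> ennreal (K powr p) * indicator unitB x"
        using rtest_props(4)[OF f, of x] K p by (cases "x \<in> unitB") (auto intro!: ennreal_leI powr_mono2)
    qed
    also have "\<dots> < \<infinity>" by (simp add: nn_integral_cmult emeasure_lborel_ball ennreal_mult_less_top)
    finally have Jfin: "(\<integral>\<^sup>+x. ennreal (\<bar>?w x\<bar> powr p) \<partial>lborel) < \<infinity>" .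
    define J where "J = enn2real (\<integral>\<^sup>+x. ennreal (\<bar>?w x\<bar> powr p) \<partial>lborel)"
    have J: "(\<integral>\<^sup>+x. ennreal (\<bar>?w x\<bar> powr p) \<partial>lborel) = ennreal J" "J \<ge> 0"
      using Jfin by (simp_all add: J_def less_top)
    have Lp: "Lp_sq p UNIV ?w = J powr (2 / p)" by (simp add: Lp_sq_def J_def)
    have "J \<le> (X / T) powr (p / 2)"
    \<comment> \<open>If the integral is 0, the quotient has denominator 0 and gives no information,
      but the bound is then trivial.\<close>
    proof (cases "J = 0")
      case False
      then have J0: "J > 0" using J by simp
      have nz: "\<exists>x. ?w x \<noteq> 0"
      proof (rule ccontr)
        assume "\<not> ?thesis"
        then have w0: "?w x = 0" for x by blast
        have "J = 0" unfolding J_def w0 using p by simp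
        then show False using False by simp
      qed
      have "T \<le> enn2real (Qf s UNIV ?w) / Lp_sq (crit DIM('a) s) UNIV ?w"
        unfolding T_def S_sob_def
      proof (rule cINF_lower)
        show "bdd_below ((\<lambda>u. enn2real (Qf s UNIV u) / Lp_sq (crit DIM('a) s) UNIV u) ` {u \<in> Cc_inf (UNIV::'a set). \<exists>x. u x \<noteq> 0})"
          by (intro bdd_belowI[of _ 0]) (auto simp: Lp_sq_def)
        show "?w \<in> {u \<in> Cc_inf UNIV. \<exists>x. u x \<noteq> 0}" using w nz by blast
      qed
      also have "\<dots> \<le> X / J powr (2 / p)"
        unfolding p_def[symmetric] Lp using QX by (intro divide_right_mono) auto
      finally have "J powr (2 / p) \<le> X / T" using J0 T by (simp add: field_simps)
      then have "(J powr (2 / p)) powr (p / 2) \<le> (X / T) powr (p / 2)"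
        using p by (intro powr_mono2) auto
      then show ?thesis using J0 p by (simp add: powr_powr)
    qed simp
    then show ?thesis unfolding J(1) X_def by (rule ennreal_leI)
  qed
  then show ?thesis using c C0 unfolding p_def T_def by (intro exI[of _ "c * C0"]) auto
qed

lemma Hrad_local_Sobolev:
  fixes ty :: "'a::euclidean_space itself"
  assumes s: "0 < s" "s < 1" and N: "real DIM('a) > 2 * s" and Sb: "S_sob s TYPE('a) > 0" and e: "e > 0"
  shows "\<exists>C\<ge>0. \<forall>u \<in> (Hrad s :: ('a \<Rightarrow> real) set).
    (\<integral>\<^sup>+x. ennreal (\<bar>bump x * u x\<bar> powr crit DIM('a) s) \<partial>lborel)
      \<le> ennreal ((((1 + e) * Hn s u + C * (\<integral>x. (u x)\<^sup>2 \<partial>lborel)) / S_sob s TYPE('a)) powr (crit DIM('a) s / 2))"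
proof -
  define p where "p = crit DIM('a) s"
  define T where "T = S_sob s TYPE('a)"
  have p: "p > 2" unfolding p_def by (rule crit_gt_2[OF s(1) N])
  have T: "T > 0" using Sb by (simp add: T_def)
  \<comment> \<open>Two factors 1 + d will arise, one from the cut-off and one from the
    approximation by test functions; their product must not exceed 1 + e.\<close>
  define d where "d = min 1 (e / 3)"
  have d: "d > 0" "d \<le> 1" "3 * d \<le> e" using e by (auto simp: d_def)
  have d2: "(1 + d) * (1 + d) \<le> 1 + e"
  proof -
    have "d * d \<le> d" using d by (simp add: mult_left_le)
    moreover have "(1 + d) * (1 + d) = 1 + 2 * d + d * d" by (simp add: algebra_simps)
    ultimately show ?thesis using d by linarith
  qed
  obtain C where C: "C \<ge> 0" "\<And>f. f \<in> (rtest :: ('a \<Rightarrow> real) set) \<Longrightarrow>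
      (\<integral>\<^sup>+x. ennreal (\<bar>bump x * f x\<bar> powr p) \<partial>lborel)
      \<le> ennreal ((((1 + d) * Hn s f + C * (\<integral>x. (f x)\<^sup>2 \<partial>lborel)) / T) powr (p / 2))"
    using rtest_local_Sobolev[OF s N Sb d(1)] unfolding p_def T_def by blast
  have "(\<integral>\<^sup>+x. ennreal (\<bar>bump x * u x\<bar> powr p) \<partial>lborel)
      \<le> ennreal ((((1 + e) * Hn s u + (2 * C) * (\<integral>x. (u x)\<^sup>2 \<partial>lborel)) / T) powr (p / 2))" if u: "u \<in> Hrad s" for u :: "'a \<Rightarrow> real"
  proof -
    have fu: "Hfin s u" by (rule Hrad_Hfin[OF s u])
    obtain \<psi> where \<psi>: "\<And>k. \<psi> k \<in> rtest" "(\<lambda>k. Hn s (\<lambda>x. \<psi> k x - u x)) \<longlonglongrightarrow> 0" "AE x in lborel. (\<lambda>k. \<psi> k x) \<longlonglongrightarrow> u x"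
      using Hrad_approx_AE[OF s u] by blast
    have f\<psi>: "Hfin s (\<psi> k)" for k by (rule rtest_Hfin[OF s \<psi>(1)])
    define D where "D k = Hn s (\<lambda>x. \<psi> k x - u x)" for k
    define l where "l = (\<integral>x. (u x)\<^sup>2 \<partial>lborel)"
    define Y where "Y k = (1 + d) * ((1 + d) * Hn s u + (1 + 1 / d) * D k) + C * (2 * l + 2 * D k)" for k
    define Z where "Z = (1 + d) * ((1 + d) * Hn s u + (1 + 1 / d) * 0) + C * (2 * l + 2 * 0)"
    have YZ: "Y \<longlonglongrightarrow> Z" unfolding Y_def Z_def by (intro tendsto_intros \<psi>(2)[folded D_def])
    have Y0: "Y k \<ge> 0" for k using d C by (simp add: Y_def D_def l_def)
    have le: "(\<integral>\<^sup>+x. ennreal (\<bar>bump x * \<psi> k x\<bar> powr p) \<partial>lborel) \<le> ennreal ((Y k / T) powr (p / 2))" for k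
    proof -
      have "Hn s (\<psi> k) \<le> (1 + d) * Hn s u + (1 + 1 / d) * D k"
        unfolding D_def by (rule Hn_le_near[OF s f\<psi> fu d(1)])
      moreover have "(\<integral>x. (\<psi> k x)\<^sup>2 \<partial>lborel) \<le> 2 * l + 2 * D k"
      proof -
        note L = Hfin_L2_lborel[OF s fu] Hfin_L2_lborel[OF s Hfin_diff[OF s fu f\<psi>]]
        have "(\<integral>x. (\<psi> k x)\<^sup>2 \<partial>lborel) = (\<integral>x. (u x - (u x - \<psi> k x))\<^sup>2 \<partial>lborel)" by simp
        also have "\<dots> \<le> 2 * l + 2 * (\<integral>x. (u x - \<psi> k x)\<^sup>2 \<partial>lborel)"
          unfolding l_def by (rule integral_square_diff_le[OF L(1) L(3)])
        also have "\<dots> \<le> 2 * l + 2 * D k"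
          using L(4)[of k] Hn_minus[of s u "\<psi> k"] by (simp add: D_def)
        finally show ?thesis .
      qed
      ultimately have "(1 + d) * Hn s (\<psi> k) + C * (\<integral>x. (\<psi> k x)\<^sup>2 \<partial>lborel) \<le> Y k"
        unfolding Y_def using d C by (intro add_mono mult_left_mono) auto
      moreover have "0 \<le> (1 + d) * Hn s (\<psi> k) + C * (\<integral>x. (\<psi> k x)\<^sup>2 \<partial>lborel)" using d C by simp
      ultimately have "(((1 + d) * Hn s (\<psi> k) + C * (\<integral>x. (\<psi> k x)\<^sup>2 \<partial>lborel)) / T) powr (p / 2) \<le> (Y k / T) powr (p / 2)"
        using T p by (intro powr_mono2 divide_right_mono) auto
      then show ?thesis using C(2)[OF \<psi>(1)] ennreal_leI order_trans by blast
    qed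
    have [measurable]: "bump \<in> borel_measurable (borel :: 'a measure)" "\<psi> k \<in> borel_measurable borel" for k
      using Cc_inf_measurable[OF bump_Cc_inf] f\<psi> by (auto simp: Hfin_def)
    have "(\<integral>\<^sup>+x. ennreal (\<bar>bump x * u x\<bar> powr p) \<partial>lborel) \<le> liminf (\<lambda>k. \<integral>\<^sup>+x. ennreal (\<bar>bump x * \<psi> k x\<bar> powr p) \<partial>lborel)"
    proof (rule Lp_Fatou)
      show "AE x in lborel. (\<lambda>k. bump x * \<psi> k x) \<longlonglongrightarrow> bump x * u x"
        using \<psi>(3) by (rule eventually_mono) (intro tendsto_intros)
    qed (use p in auto)
    also have "\<dots> \<le> liminf (\<lambda>k. ennreal ((Y k / T) powr (p / 2)))"
      by (intro Liminf_mono always_eventually allI le)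
    also have "\<dots> = ennreal ((Z / T) powr (p / 2))"
    proof (rule lim_imp_Liminf)
      have "(\<lambda>k. (Y k / T) powr (p / 2)) \<longlonglongrightarrow> (Z / T) powr (p / 2)"
        using T p Y0 by (intro tendsto_powr' tendsto_divide YZ tendsto_const) auto
      then show "(\<lambda>k. ennreal ((Y k / T) powr (p / 2))) \<longlonglongrightarrow> ennreal ((Z / T) powr (p / 2))"
        by (rule tendsto_ennrealI)
    qed simp
    also have "\<dots> \<le> ennreal ((((1 + e) * Hn s u + (2 * C) * l) / T) powr (p / 2))"
    proof (rule ennreal_leI, rule powr_mono2)
      have "Z = ((1 + d) * (1 + d)) * Hn s u + (2 * C) * l" by (simp add: Z_def mult_ac)
      also have "\<dots> \<le> (1 + e) * Hn s u + (2 * C) * l" by (intro add_right_mono mult_right_mono d2) simp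
      finally show "Z / T \<le> ((1 + e) * Hn s u + (2 * C) * l) / T" using T by (intro divide_right_mono) auto
      show "0 \<le> Z / T" using T d C by (simp add: Z_def l_def)
    qed (use p in simp)
    finally show ?thesis unfolding l_def .
  qed
  then show ?thesis using C(1) unfolding p_def T_def by (intro exI[of _ "2 * C"]) auto
qed

text \<open>Since radial functions are bounded away from the origin by their energy, a null sequence in \<open>L\<^sup>2\<close> can
  only concentrate at the origin, where the Sobolev constant of the whole space applies.\<close>
lemma Hrad_concentration:
  fixes v :: "nat \<Rightarrow> 'a::euclidean_space \<Rightarrow> real"
  assumes s: "1/2 < s" "s < 1" and N: "real DIM('a) > 2 * s" and Sb: "S_sob s TYPE('a) > 0"
    and v: "\<And>k. v k \<in> Hrad s" and M: "\<And>k. Hn s (v k) \<le> M"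
    and l: "(\<lambda>k. \<integral>x. (v k x)\<^sup>2 \<partial>lborel) \<longlonglongrightarrow> 0" and e: "e > 0"
  shows "\<forall>\<^sub>F k in sequentially. S_sob s TYPE('a) * Lp_sq (crit DIM('a) s) unitB (v k) \<le> Hn s (v k) + e"
proof -
  have s0: "0 < s" using s by simp
  note S = s0 s(2)
  define p where "p = crit DIM('a) s"
  define T where "T = S_sob s TYPE('a)"
  have p: "p > 2" unfolding p_def by (rule crit_gt_2[OF s0 N])
  have T: "T > 0" using Sb by (simp add: T_def)
  have M0: "M \<ge> 0" using order_trans[OF Hn_nonneg M[of 0]] .
  \<comment> \<open>Two factors 1 + d again, from the cut-off and from dividing by
    \<open>bump\<close>; their product exceeds 1 by at most \<open>3 * d\<close>, and
    \<open>3 * d * M \<le> e / 2\<close>.\<close>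
  define d where "d = min 1 (e / (6 * (M + 1)))"
  have d: "d > 0" "d \<le> 1" using e M0 by (auto simp: d_def)
  have dM: "3 * d * M \<le> e / 2"
  proof -
    have "3 * d * M \<le> 3 * (e / (6 * (M + 1))) * (M + 1)"
      using d M0 e by (intro mult_mono) (auto simp: d_def)
    also have "\<dots> = e / 2" using M0 by (simp add: field_simps)
    finally show ?thesis .
  qed
  obtain C where C: "C \<ge> 0" "\<And>u. u \<in> (Hrad s :: ('a \<Rightarrow> real) set) \<Longrightarrow>
      (\<integral>\<^sup>+x. ennreal (\<bar>bump x * u x\<bar> powr p) \<partial>lborel)
      \<le> ennreal ((((1 + d) * Hn s u + C * (\<integral>x. (u x)\<^sup>2 \<partial>lborel)) / T) powr (p / 2))"
    using Hrad_local_Sobolev[OF S N Sb d(1)] unfolding p_def T_def by blast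
  \<comment> \<open>Near the origin \<open>bump\<close> exceeds \<open>\<theta>\<close>; replacing
    \<open>v k\<close> by its product with \<open>bump\<close> there costs
    \<open>\<theta> powr (- p)\<close> in the integral, which after the power 2 / p becomes
    \<open>\<theta> powr (- 2) = 1 + d\<close>.\<close>
  define \<theta> where "\<theta> = (1 + d) powr (- 1 / 2)"
  have \<theta>: "0 < \<theta>" "\<theta> < 1"
    using d powr_less_mono[of "- 1 / 2" 0 "1 + d"] by (auto simp: \<theta>_def)
  have \<theta>2: "\<theta> powr (- 2) = 1 + d" using d by (simp add: \<theta>_def powr_powr)
  have "isCont (bump :: 'a \<Rightarrow> real) 0"
    using Cc_inf_continuous[OF bump_Cc_inf[where 'a='a], of UNIV] by (simp add: continuous_on_eq_continuous_at)
  then have "\<forall>\<^sub>F x in at (0::'a). \<theta> < bump x"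
    unfolding isCont_def using \<theta>(2) by (intro order_tendstoD(1)[where y="bump (0::'a)"]) simp_all
  then obtain \<delta> where \<delta>0: "\<delta> > 0" "\<forall>x::'a. x \<noteq> 0 \<and> dist x 0 < \<delta> \<longrightarrow> \<theta> < bump x"
    unfolding eventually_at by blast
  have \<delta>: "\<delta> > 0" "\<theta> < bump x" if "norm x < \<delta>" for x :: 'a
    using \<delta>0 that \<theta>(2) by (cases "x = 0"; simp)+
  obtain B where B: "B \<ge> 0" "\<And>u. u \<in> (Hrad s :: ('a \<Rightarrow> real) set) \<Longrightarrow> AE x in lborel. \<delta> \<le> norm x \<longrightarrow> (u x)\<^sup>2 \<le> B * Hn s u"
    using Hrad_bounded_away_from_0[OF s \<delta>0(1), where 'a='a] by blast
  \<comment> \<open>Away from the origin \<open>(v k x)\<^sup>2 \<le> B * M\<close>, so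
    \<open>\<bar>v k x\<bar> powr p\<close> is at most \<open>b * (v k x)\<^sup>2\<close>, and
    convergence in \<open>L\<^sup>2\<close> makes that region negligible.\<close>
  define b where "b = (B * M) powr ((p - 2) / 2)"
  define l' where "l' k = (\<integral>x. (v k x)\<^sup>2 \<partial>lborel)" for k
  have l'0: "l' k \<ge> 0" for k by (simp add: l'_def)
  define X where "X k = (1 + d) * Hn s (v k) + C * l' k" for k
  have X0: "X k \<ge> 0" for k using d C l'0[of k] by (simp add: X_def)
  have vm [measurable]: "v k \<in> borel_measurable borel" for k
    using Hrad_Hfin[OF S v] by (simp add: Hfin_def)
  have [measurable]: "bump \<in> borel_measurable (borel :: 'a measure)"
    by (rule Cc_inf_measurable[OF bump_Cc_inf])
  have key: "T * Lp_sq p unitB (v k) \<le> (1 + d) * X k + T * (b * l' k) powr (2 / p)" for k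
  proof -
    have "(\<integral>\<^sup>+x. ennreal (\<bar>v k x\<bar> powr p) * indicator unitB x \<partial>lborel)
      \<le> (\<integral>\<^sup>+x. ennreal (\<theta> powr (- p)) * ennreal (\<bar>bump x * v k x\<bar> powr p) + ennreal b * ennreal ((v k x)\<^sup>2) \<partial>lborel)"
    proof (rule nn_integral_mono_AE)
      show "AE x in lborel. ennreal (\<bar>v k x\<bar> powr p) * indicator unitB x
          \<le> ennreal (\<theta> powr (- p)) * ennreal (\<bar>bump x * v k x\<bar> powr p) + ennreal b * ennreal ((v k x)\<^sup>2)"
        using B(2)[OF v[of k]]
      proof (rule eventually_mono)
        fix x assume x: "\<delta> \<le> norm x \<longrightarrow> (v k x)\<^sup>2 \<le> B * Hn s (v k)"
        have "\<bar>v k x\<bar> powr p \<le> \<theta> powr (- p) * \<bar>bump x * v k x\<bar> powr p + b * (v k x)\<^sup>2"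
        proof (cases "norm x < \<delta>")
          case True
          have "\<theta> * \<bar>v k x\<bar> \<le> bump x * \<bar>v k x\<bar>"
            using \<delta>(2)[OF True] by (intro mult_right_mono) auto
          then have "\<theta> * \<bar>v k x\<bar> \<le> \<bar>bump x * v k x\<bar>" using bump_range(1)[of x] by (simp add: abs_mult)
          then have "(\<theta> * \<bar>v k x\<bar>) powr p \<le> \<bar>bump x * v k x\<bar> powr p" using \<theta> p by (intro powr_mono2) auto
          then have "\<theta> powr (- p) * (\<theta> powr p * \<bar>v k x\<bar> powr p) \<le> \<theta> powr (- p) * \<bar>bump x * v k x\<bar> powr p"
            using \<theta> by (intro mult_left_mono) (auto simp: powr_mult)
          moreover have "\<theta> powr (- p) * \<theta> powr p = 1" using \<theta> by (simp flip: powr_add)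
          ultimately have "\<bar>v k x\<bar> powr p \<le> \<theta> powr (- p) * \<bar>bump x * v k x\<bar> powr p"
            by (simp add: mult.assoc[symmetric])
          moreover have "0 \<le> b * (v k x)\<^sup>2" by (simp add: b_def)
          ultimately show ?thesis by linarith
        next
          case False
          have "\<bar>v k x\<bar> powr p \<le> b * (v k x)\<^sup>2"
          proof (cases "v k x = 0")
            case False
            have "(v k x)\<^sup>2 \<le> B * M"
              using x \<open>\<not> norm x < \<delta>\<close> mult_left_mono[OF M[of k] B(1)] by simp
            then have "((v k x)\<^sup>2) powr ((p - 2) / 2) \<le> b" unfolding b_def using p by (intro powr_mono2) auto
            moreover have "((v k x)\<^sup>2) powr ((p - 2) / 2) = \<bar>v k x\<bar> powr (p - 2)"
            proof -
              have "(v k x)\<^sup>2 = \<bar>v k x\<bar> powr 2" using False by simp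
              moreover have "2 * ((p - 2) / 2) = p - 2" by simp
              ultimately show ?thesis by (simp only: powr_powr)
            qed
            ultimately have "\<bar>v k x\<bar> powr (p - 2) * (v k x)\<^sup>2 \<le> b * (v k x)\<^sup>2" by (intro mult_right_mono) auto
            moreover have "\<bar>v k x\<bar> powr p = \<bar>v k x\<bar> powr (p - 2) * (v k x)\<^sup>2"
            proof -
              have "(v k x)\<^sup>2 = \<bar>v k x\<bar> powr 2" using False by simp
              then show ?thesis by (simp only: powr_add[symmetric]) simp
            qed
            ultimately show ?thesis by simp
          qed simp
          then show ?thesis using \<theta> by (simp add: add_increasing)
        qed
        then have "ennreal (\<bar>v k x\<bar> powr p) \<le> ennreal (\<theta> powr (- p) * \<bar>bump x * v k x\<bar> powr p + b * (v k x)\<^sup>2)"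
          by (rule ennreal_leI)
        also have "\<dots> = ennreal (\<theta> powr (- p)) * ennreal (\<bar>bump x * v k x\<bar> powr p) + ennreal b * ennreal ((v k x)\<^sup>2)"
          by (simp add: b_def ennreal_mult ennreal_plus)
        finally show "ennreal (\<bar>v k x\<bar> powr p) * indicator unitB x
          \<le> ennreal (\<theta> powr (- p)) * ennreal (\<bar>bump x * v k x\<bar> powr p) + ennreal b * ennreal ((v k x)\<^sup>2)"
          by (auto simp: indicator_def)
      qed
    qed
    also have "\<dots> = ennreal (\<theta> powr (- p)) * (\<integral>\<^sup>+x. ennreal (\<bar>bump x * v k x\<bar> powr p) \<partial>lborel) + ennreal b * (\<integral>\<^sup>+x. ennreal ((v k x)\<^sup>2) \<partial>lborel)"
      by (subst nn_integral_add, simp, simp, subst nn_integral_cmult, simp, subst nn_integral_cmult, simp, rule refl)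
    also have "\<dots> \<le> ennreal (\<theta> powr (- p)) * ennreal ((X k / T) powr (p / 2)) + ennreal b * ennreal (l' k)"
      unfolding l'_def L2fun_nn_integral[OF Hfin_L2_lborel(1)[OF S Hrad_Hfin[OF S v]]]
      by (intro add_right_mono mult_left_mono) (simp_all add: X_def l'_def C(2)[OF v])
    also have "\<dots> = ennreal (\<theta> powr (- p) * (X k / T) powr (p / 2) + b * l' k)"
      using l'0[of k] by (simp add: b_def ennreal_mult ennreal_plus)
    finally have "enn2real (\<integral>\<^sup>+x. ennreal (\<bar>v k x\<bar> powr p) * indicator unitB x \<partial>lborel) \<le> \<theta> powr (- p) * (X k / T) powr (p / 2) + b * l' k"
      using l'0[of k] by (intro enn2real_leI) (auto simp: b_def)
    then have "Lp_sq p unitB (v k) \<le> (\<theta> powr (- p) * (X k / T) powr (p / 2) + b * l' k) powr (2 / p)"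
      unfolding Lp_sq_def using p by (intro powr_mono2) auto
    also have "\<dots> \<le> (\<theta> powr (- p) * (X k / T) powr (p / 2)) powr (2 / p) + (b * l' k) powr (2 / p)"
      using p l'0[of k] by (intro powr_add_le_add_powr) (auto simp: b_def)
    also have "(\<theta> powr (- p) * (X k / T) powr (p / 2)) powr (2 / p) = (1 + d) * (X k / T)"
      using p T X0[of k] by (simp add: powr_mult powr_powr \<theta>2 powr_one_gt_zero_iff)
    finally have "T * Lp_sq p unitB (v k) \<le> T * ((1 + d) * (X k / T) + (b * l' k) powr (2 / p))"
      using T by (intro mult_left_mono) auto
    also have "\<dots> = (1 + d) * X k + T * (b * l' k) powr (2 / p)"
      using T by (simp add: distrib_left)
    finally show ?thesis .
  qed
  have "(\<lambda>k. (1 + d) * (C * l' k) + T * (b * l' k) powr (2 / p)) \<longlonglongrightarrow> (1 + d) * (C * 0) + T * (b * 0) powr (2 / p)"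
    using p l'0 by (intro tendsto_intros tendsto_powr' l[folded l'_def]) (auto simp: b_def)
  then have "\<forall>\<^sub>F k in sequentially. (1 + d) * (C * l' k) + T * (b * l' k) powr (2 / p) < e / 2"
    using e p by (intro order_tendstoD(2)) auto
  then show ?thesis
  proof (rule eventually_mono)
    fix k assume k: "(1 + d) * (C * l' k) + T * (b * l' k) powr (2 / p) < e / 2"
    have "(1 + d) * X k = Hn s (v k) + (2 * d + d * d) * Hn s (v k) + (1 + d) * (C * l' k)"
      by (simp add: X_def algebra_simps)
    also have "(2 * d + d * d) * Hn s (v k) \<le> (3 * d) * M"
      using d M mult_left_le[of d d] by (intro mult_mono) auto
    finally have "(1 + d) * X k \<le> Hn s (v k) + e / 2 + (1 + d) * (C * l' k)" using dM by simp
    then show "S_sob s TYPE('a) * Lp_sq (crit DIM('a) s) unitB (v k) \<le> Hn s (v k) + e"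
      using key[of k] k unfolding T_def[symmetric] p_def[symmetric] by simp
  qed
qed

section \<open>Minimizing sequences\<close>

locale frac_minimization =
  fixes s :: real and h :: "'a::euclidean_space \<Rightarrow> real"
  assumes s_gt: "1/2 < s" and s_lt: "s < 1" and dim: "real DIM('a) > 2 * s"
    and h_meas: "set_borel_measurable lborel unitB h"
    and h_bdd: "\<exists>C. AE x in lborel. x \<in> unitB \<longrightarrow> \<bar>h x\<bar> \<le> C"
    and S_pos: "0 < S_rad s h" and S_less: "S_rad s h < S_sob s TYPE('a)"
begin

definition p where "p = crit DIM('a) s"

definition A :: "('a \<Rightarrow> real) \<Rightarrow> real" where
  "A u = enn2real (Qf s unitB u) + (LINT x:unitB|lborel. h x * (u x)\<^sup>2)"

definition Lp :: "('a \<Rightarrow> real) \<Rightarrow> real" where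
  "Lp u = Lp_sq p unitB u"

abbreviation S where "S \<equiv> S_rad s h"

definition hB where "hB x = indicator unitB x * h x"

definition hbound where "hbound = (SOME C. C \<ge> 0 \<and> (AE x in lborel. \<bar>hB x\<bar> \<le> C))"

text \<open>The extra 1 accounts for the squared \<open>L\<^sup>2\<close>-norm contained in
  \<open>Hn\<close> but not in \<open>A\<close>, and makes the constant strictly positive.\<close>

definition hplus where "hplus = hbound + 1"

lemma s_pos: "0 < s" using s_gt by simp

lemmas ss = s_pos s_lt

lemma p_gt: "p > 2"
  unfolding p_def by (rule crit_gt_2[OF s_pos dim])

lemma hB_meas [measurable]: "hB \<in> borel_measurable borel"
  using h_meas by (simp add: set_borel_measurable_def hB_def[abs_def])

lemma hbound: "hbound \<ge> 0" "AE x in lborel. \<bar>hB x\<bar> \<le> hbound"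
proof -
  obtain C where C: "AE x in lborel. x \<in> unitB \<longrightarrow> \<bar>h x\<bar> \<le> C" using h_bdd by blast
  have "AE x in lborel. \<bar>hB x\<bar> \<le> max 0 C"
    using C by (rule eventually_mono) (auto simp: hB_def indicator_def)
  then have "\<exists>C. C \<ge> 0 \<and> (AE x in lborel. \<bar>hB x\<bar> \<le> C)" by (intro exI[of _ "max 0 C"]) auto
  from someI_ex[OF this] show "hbound \<ge> 0" "AE x in lborel. \<bar>hB x\<bar> \<le> hbound"
    unfolding hbound_def by blast+
qed

lemma hB_L2fun:
  assumes u: "L2fun lborel u"
  shows "L2fun lborel (\<lambda>x. hB x * u x)"
proof -
  have [measurable]: "u \<in> borel_measurable borel" using u by (simp add: L2fun_def)
  have "integrable lborel (\<lambda>x. (hB x * u x)\<^sup>2)"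
  proof (rule Bochner_Integration.integrable_bound)
    show "integrable lborel (\<lambda>x. hbound\<^sup>2 * (u x)\<^sup>2)" using u by (simp add: L2fun_def)
    show "AE x in lborel. norm ((hB x * u x)\<^sup>2) \<le> norm (hbound\<^sup>2 * (u x)\<^sup>2)"
      using hbound(2)
    proof (rule eventually_mono)
      fix x assume "\<bar>hB x\<bar> \<le> hbound"
      then have "(hB x)\<^sup>2 \<le> hbound\<^sup>2" using power_mono[of "\<bar>hB x\<bar>" hbound 2] by simp
      then have "(hB x)\<^sup>2 * (u x)\<^sup>2 \<le> hbound\<^sup>2 * (u x)\<^sup>2" by (intro mult_right_mono) auto
      then show "norm ((hB x * u x)\<^sup>2) \<le> norm (hbound\<^sup>2 * (u x)\<^sup>2)" by (simp add: power_mult_distrib)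
    qed
  qed simp
  then show ?thesis by (simp add: L2fun_def)
qed

lemma hB_integrable: "L2fun lborel u \<Longrightarrow> integrable lborel (\<lambda>x. hB x * (u x)\<^sup>2)"
  using L2fun_mult[OF hB_L2fun, of u u] by (simp add: power2_eq_square mult.assoc)

lemma hB_integral_bound:
  assumes u: "L2fun lborel u"
  shows "\<bar>\<integral>x. hB x * (u x)\<^sup>2 \<partial>lborel\<bar> \<le> hbound * (\<integral>x. (u x)\<^sup>2 \<partial>lborel)"
proof -
  have "\<bar>\<integral>x. hB x * (u x)\<^sup>2 \<partial>lborel\<bar> \<le> (\<integral>x. \<bar>hB x * (u x)\<^sup>2\<bar> \<partial>lborel)" by (rule integral_abs_bound)
  also have "\<dots> \<le> (\<integral>x. hbound * (u x)\<^sup>2 \<partial>lborel)"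
  proof (rule integral_mono_AE)
    show "AE x in lborel. \<bar>hB x * (u x)\<^sup>2\<bar> \<le> hbound * (u x)\<^sup>2"
      using hbound(2) by (rule eventually_mono) (simp add: abs_mult mult_right_mono)
  qed (use hB_integrable[OF u] u in \<open>auto simp: L2fun_def\<close>)
  also have "\<dots> = hbound * (\<integral>x. (u x)\<^sup>2 \<partial>lborel)" by simp
  finally show ?thesis .
qed

lemma A_eq:
  assumes u: "Hfin s u"
  shows "A u = Hn s u + (\<integral>x. hB x * (u x)\<^sup>2 \<partial>lborel) - (\<integral>x. (u x)\<^sup>2 \<partial>lborel)"
    and "A u \<ge> (\<integral>x. hB x * (u x)\<^sup>2 \<partial>lborel)"
proof -
  note L = Hfin_L2_lborel(1)[OF ss u]
  have "ennreal (Hn s u) = (\<integral>\<^sup>+x. ennreal ((u x)\<^sup>2) * indicator unitB x \<partial>lborel) + Qf s unitB u"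
    using Hsq_eq_Hn[OF ss u] by (simp add: Hsq_def)
  also have "(\<integral>\<^sup>+x. ennreal ((u x)\<^sup>2) * indicator unitB x \<partial>lborel) = (\<integral>\<^sup>+x. ennreal ((u x)\<^sup>2) \<partial>lborel)"
    using u by (intro nn_integral_cong) (auto simp: Hfin_def indicator_def)
  also have "\<dots> = ennreal (\<integral>x. (u x)\<^sup>2 \<partial>lborel)" by (rule L2fun_nn_integral[OF L])
  finally have eq: "ennreal (Hn s u) = ennreal (\<integral>x. (u x)\<^sup>2 \<partial>lborel) + Qf s unitB u" .
  have Q: "Qf s unitB u = ennreal (enn2real (Qf s unitB u))"
    using Hfin_gag(1)[OF ss u] by (intro ennreal_enn2real[symmetric]) (auto intro: le_less_trans)
  have "ennreal (Hn s u) = ennreal ((\<integral>x. (u x)\<^sup>2 \<partial>lborel) + enn2real (Qf s unitB u))"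
    using eq Q by (subst ennreal_plus) auto
  then have "Hn s u = (\<integral>x. (u x)\<^sup>2 \<partial>lborel) + enn2real (Qf s unitB u)"
    by (subst (asm) ennreal_inj) auto
  moreover have "(LINT x:unitB|lborel. h x * (u x)\<^sup>2) = (\<integral>x. hB x * (u x)\<^sup>2 \<partial>lborel)"
    by (simp add: set_lebesgue_integral_def hB_def mult.assoc)
  ultimately show "A u = Hn s u + (\<integral>x. hB x * (u x)\<^sup>2 \<partial>lborel) - (\<integral>x. (u x)\<^sup>2 \<partial>lborel)"
    and "A u \<ge> (\<integral>x. hB x * (u x)\<^sup>2 \<partial>lborel)"
    by (simp_all add: A_def)
qed

lemma Rq_eq: "Rq s h u = A u / Lp u"
  by (simp add: Rq_def A_def Lp_def p_def)

section \<open>The critical norm, its finiteness, and coercivity\<close>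

definition Jp :: "('a \<Rightarrow> real) \<Rightarrow> ennreal" where
  "Jp u = (\<integral>\<^sup>+x. ennreal (\<bar>u x\<bar> powr p) \<partial>lborel)"

text \<open>The volume of the ball comes from integrating the constant 1 in \<open>L2_le_Lp\<close>,
  the added 1 from the normalised p-th power.\<close>

definition vol :: real where "vol = unit_ball_vol (real DIM('a)) + 1"

lemma Lp_Jp:
  assumes "Hfin s u"
  shows "Lp u = (enn2real (Jp u)) powr (2 / p)"
proof -
  have "(\<integral>\<^sup>+x. ennreal (\<bar>u x\<bar> powr p) * indicator unitB x \<partial>lborel) = Jp u"
    unfolding Jp_def using assms p_gt by (intro nn_integral_cong) (auto simp: Hfin_def indicator_def)
  then show ?thesis by (simp add: Lp_def Lp_sq_def)
qed

lemma Jp_eq_0: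
  assumes "Hfin s u" "Jp u = 0"
  shows "AE x in lborel. u x = 0"
proof -
  have [measurable]: "u \<in> borel_measurable borel" using assms by (simp add: Hfin_def)
  have "AE x in lborel. ennreal (\<bar>u x\<bar> powr p) = 0"
    using assms(2) unfolding Jp_def by (subst (asm) nn_integral_0_iff_AE) auto
  then show ?thesis
  proof (rule eventually_mono)
    fix x assume "ennreal (\<bar>u x\<bar> powr p) = 0"
    then have "\<bar>u x\<bar> powr p \<le> 0" by (simp only: ennreal_eq_0_iff)
    then have "\<bar>u x\<bar> powr p = 0" using powr_ge_zero order_antisym by blast
    then show "u x = 0" by simp
  qed
qed

lemma Lp_nonneg: "0 \<le> Lp u"
  by (simp add: Lp_def Lp_sq_def)

text \<open>Instead of Hoelder's inequality: integrate \<open>(u / m)\<^sup>2 \<le> 1 + (\<bar>u\<bar> / m) powr p\<close>, where \<open>m\<close> is the \<open>L\<^sup>p\<close>-norm of \<open>u\<close>.\<close>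
lemma L2_le_Lp:
  assumes u: "Hfin s u" and fin: "Jp u < \<infinity>"
  shows "(\<integral>x. (u x)\<^sup>2 \<partial>lborel) \<le> vol * Lp u"
proof (cases "Jp u = 0")
  case True
  have "(\<integral>x. (u x)\<^sup>2 \<partial>lborel) = 0"
    using Jp_eq_0[OF u True] by (intro integral_eq_zero_AE) (auto elim: eventually_mono)
  then show ?thesis by (simp add: vol_def Lp_nonneg)
next
  case False
  have [measurable]: "u \<in> borel_measurable borel" using u by (simp add: Hfin_def)
  define J where "J = enn2real (Jp u)"
  have J: "Jp u = ennreal J" "J > 0"
    using fin False by (simp_all add: J_def less_top enn2real_positive_iff zero_less_iff_neq_zero)
  define m where "m = J powr (1 / p)"
  have m: "m > 0" using J by (simp add: m_def)
  have m2: "m\<^sup>2 = Lp u"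
    by (simp add: m_def Lp_Jp[OF u] J_def[symmetric] power2_eq_square flip: powr_add)
  have mp: "m powr p = J" using J p_gt by (simp add: m_def powr_powr)
  have pt: "(u x)\<^sup>2 \<le> m\<^sup>2 * (indicator unitB x + \<bar>u x\<bar> powr p / J)" for x
  proof (cases "x \<in> unitB")
    case True
    have "(\<bar>u x\<bar> / m)\<^sup>2 \<le> 1 + (\<bar>u x\<bar> / m) powr p"
    proof (cases "\<bar>u x\<bar> / m \<le> 1")
      case True
      then have "(\<bar>u x\<bar> / m)\<^sup>2 \<le> 1" using m by (intro power_le_one) auto
      then show ?thesis by (simp add: add_increasing2)
    next
      case False
      then have "(\<bar>u x\<bar> / m) powr 2 \<le> (\<bar>u x\<bar> / m) powr p" using p_gt by (intro powr_mono) auto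
      then show ?thesis using False by simp
    qed
    also have "(\<bar>u x\<bar> / m) powr p = \<bar>u x\<bar> powr p / J" using m by (simp add: powr_divide mp)
    finally have "m\<^sup>2 * (\<bar>u x\<bar> / m)\<^sup>2 \<le> m\<^sup>2 * (1 + \<bar>u x\<bar> powr p / J)" by (intro mult_left_mono) auto
    then show ?thesis using True m by (simp add: power_divide)
  next
    case False
    then show ?thesis using u p_gt by (simp add: Hfin_def)
  qed
  have "ennreal (\<integral>x. (u x)\<^sup>2 \<partial>lborel) = (\<integral>\<^sup>+x. ennreal ((u x)\<^sup>2) \<partial>lborel)"
    by (rule L2fun_nn_integral[OF Hfin_L2_lborel(1)[OF ss u], symmetric])
  also have "\<dots> \<le> (\<integral>\<^sup>+x. ennreal (m\<^sup>2) * (indicator unitB x + ennreal (1 / J) * ennreal (\<bar>u x\<bar> powr p)) \<partial>lborel)"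
  proof (rule nn_integral_mono)
    fix x
    have "ennreal ((u x)\<^sup>2) \<le> ennreal (m\<^sup>2 * (indicator unitB x + 1 / J * \<bar>u x\<bar> powr p))"
      using pt[of x] by (intro ennreal_leI) simp
    also have "\<dots> = ennreal (m\<^sup>2) * (indicator unitB x + ennreal (1 / J) * ennreal (\<bar>u x\<bar> powr p))"
      using J(2) by (auto simp: indicator_def ennreal_mult[symmetric] ennreal_1[symmetric] ennreal_plus[symmetric] simp del: ennreal_1 ennreal_plus)
    finally show "ennreal ((u x)\<^sup>2) \<le> ennreal (m\<^sup>2) * (indicator unitB x + ennreal (1 / J) * ennreal (\<bar>u x\<bar> powr p))" .
  qed
  also have "\<dots> = ennreal (m\<^sup>2) * (ennreal (unit_ball_vol (real DIM('a))) + ennreal (1 / J) * ennreal J)"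
    unfolding J(1)[symmetric] Jp_def
    by (simp add: nn_integral_cmult nn_integral_add emeasure_lborel_ball)
  also have "\<dots> = ennreal (m\<^sup>2 * vol)"
  proof -
    have "ennreal (1 / J) * ennreal J = 1"
      using J(2) by (subst ennreal_mult[symmetric]) auto
    moreover have "ennreal (unit_ball_vol (real DIM('a))) + 1 = ennreal vol"
      by (simp add: vol_def)
    moreover have "vol \<ge> 0" by (simp add: vol_def)
    ultimately show ?thesis by (simp add: ennreal_mult)
  qed
  finally have "(\<integral>x. (u x)\<^sup>2 \<partial>lborel) \<le> m\<^sup>2 * vol"
    by (subst (asm) ennreal_le_iff) (auto simp: vol_def)
  then show ?thesis by (simp add: m2 mult.commute)
qed

lemma vol_pos: "vol > 0"
  by (simp add: vol_def add_pos_pos)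

text \<open>A real infimum is known to be a lower bound only for sets bounded below. If the p-th
  power integral is infinite, \<open>enn2real\<close> makes \<open>Lp u\<close> equal to 0 and the
  quotient is 0; otherwise \<open>L2_le_Lp\<close> absorbs a negative \<open>h\<close>.\<close>

lemma Rq_bdd_below: "bdd_below (Rq s h ` {u \<in> Hrad s. \<not> (AE x in lborel. u x = 0)})"
proof (rule bdd_belowI2)
  fix u :: "'a \<Rightarrow> real" assume "u \<in> {u \<in> Hrad s. \<not> (AE x in lborel. u x = 0)}"
  then have u: "Hfin s u" "\<not> (AE x in lborel. u x = 0)" by (auto intro: Hrad_Hfin[OF ss])
  show "- (hbound * vol) \<le> Rq s h u"
  proof (cases "Jp u < \<infinity>")
    case False
    then have "Lp u = 0" using p_gt by (simp add: Lp_Jp[OF u(1)] less_top[symmetric])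
    then show ?thesis using hbound(1) vol_pos by (simp add: Rq_eq)
  next
    case True
    have "Jp u \<noteq> 0" using Jp_eq_0[OF u(1)] u(2) by blast
    then have "enn2real (Jp u) > 0" using True by (simp add: enn2real_positive_iff zero_less_iff_neq_zero)
    then have L: "Lp u > 0" by (simp add: Lp_Jp[OF u(1)])
    have "hbound * (\<integral>x. (u x)\<^sup>2 \<partial>lborel) \<le> hbound * (vol * Lp u)"
      by (intro mult_left_mono L2_le_Lp u True hbound)
    then have "- (hbound * vol) * Lp u \<le> A u"
      using A_eq(2)[OF u(1)] hB_integral_bound[OF Hfin_L2_lborel(1)[OF ss u(1)]] by (simp add: mult.assoc)
    then show ?thesis using L by (simp add: Rq_eq le_divide_eq)
  qed
qed

text \<open>The critical embedding is read off from S > 0: for u not almost everywhere 0, an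
  infinite integral would make \<open>Lp u\<close>, hence the quotient, equal to 0 by convention,
  below the infimum.\<close>

lemma Hrad_Jp_finite:
  assumes u: "u \<in> Hrad s"
  shows "Jp u < \<infinity>" and "S * Lp u \<le> A u"
proof -
  have fu: "Hfin s u" by (rule Hrad_Hfin[OF ss u])
  have "Jp u < \<infinity> \<and> S * Lp u \<le> A u"
  proof (cases "AE x in lborel. u x = 0")
    case True
    have "Jp u = (\<integral>\<^sup>+x. 0 \<partial>(lborel :: 'a measure))"
      unfolding Jp_def using True p_gt by (intro nn_integral_cong_AE) (auto elim: eventually_mono)
    then have J: "Jp u = 0" by simp
    have "(\<integral>x. hB x * (u x)\<^sup>2 \<partial>lborel) = 0"
      using True by (intro integral_eq_zero_AE) (auto elim: eventually_mono)
    then show ?thesis using J A_eq(2)[OF fu] p_gt by (simp add: Lp_Jp[OF fu])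
  next
    case False
    have SR: "S \<le> A u / Lp u"
      unfolding S_rad_def Rq_eq[symmetric] using u False by (intro cINF_lower Rq_bdd_below) auto
    have "Lp u \<noteq> 0" using SR S_pos by auto
    then have "Lp u > 0" using Lp_nonneg[of u] by simp
    moreover have "Jp u < \<infinity>"
    proof (rule ccontr)
      assume "\<not> ?thesis"
      then have "Lp u = 0" using p_gt by (simp add: Lp_Jp[OF fu] less_top[symmetric])
      then show False using \<open>Lp u \<noteq> 0\<close> by simp
    qed
    ultimately show ?thesis using SR by (simp add: le_divide_eq)
  qed
  then show "Jp u < \<infinity>" "S * Lp u \<le> A u" by auto
qed

text \<open>Coercivity whatever the sign of \<open>h\<close>: the squared
  \<open>L\<^sup>2\<close>-norm needed to compensate \<open>h\<close> is at most
  \<open>vol * Lp u\<close>, which S > 0 bounds by a multiple of \<open>A u\<close>.\<close>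

lemma A_bounds:
  assumes u: "u \<in> Hrad s"
  shows "Hn s u \<le> (1 + hplus * vol / S) * A u" and "A u \<le> hplus * Hn s u"
    and "(\<integral>x. (u x)\<^sup>2 \<partial>lborel) \<le> vol * Lp u"
proof -
  have fu: "Hfin s u" by (rule Hrad_Hfin[OF ss u])
  note L = Hfin_L2_lborel[OF ss fu]
  define l where "l = (\<integral>x. (u x)\<^sup>2 \<partial>lborel)"
  have l: "l \<ge> 0" "l \<le> Hn s u" using L(2) by (simp_all add: l_def)
  show lL: "(\<integral>x. (u x)\<^sup>2 \<partial>lborel) \<le> vol * Lp u" by (rule L2_le_Lp[OF fu Hrad_Jp_finite(1)[OF u]])
  have hb: "\<bar>\<integral>x. hB x * (u x)\<^sup>2 \<partial>lborel\<bar> \<le> hbound * l" using hB_integral_bound[OF L(1)] by (simp add: l_def)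
  have "Hn s u \<le> A u + hplus * l"
    using A_eq(1)[OF fu] hb unfolding l_def[symmetric] by (simp add: hplus_def distrib_right)
  also have "hplus * l \<le> hplus * (vol * (A u / S))"
  proof (intro mult_left_mono)
    have "vol * Lp u \<le> vol * (A u / S)"
      using Hrad_Jp_finite(2)[OF u] S_pos vol_pos by (intro mult_left_mono) (auto simp: le_divide_eq mult.commute)
    then show "l \<le> vol * (A u / S)" using lL by (simp add: l_def)
  qed (use hbound in \<open>simp add: hplus_def\<close>)
  finally show "Hn s u \<le> (1 + hplus * vol / S) * A u" by (simp add: algebra_simps)
  have "A u \<le> Hn s u + hbound * l"
    using A_eq(1)[OF fu] hb l unfolding l_def[symmetric] by simp
  also have "hbound * l \<le> hbound * Hn s u" using l hbound by (intro mult_left_mono) auto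
  finally show "A u \<le> hplus * Hn s u" by (simp add: hplus_def distrib_right)
qed

lemma A_scale:
  assumes u: "Hfin s u"
  shows "A (\<lambda>x. c * u x) = c\<^sup>2 * A u"
proof -
  have "Hfin s (\<lambda>x. c * u x)" using Hfin_lincomb[OF ss u u, of c 0] by simp
  from A_eq(1)[OF this] A_eq(1)[OF u] show ?thesis
    by (simp add: Hn_scale power_mult_distrib mult.left_commute[of _ "c\<^sup>2"] right_diff_distrib distrib_left)
qed

lemma Lp_scale:
  assumes u: "Hfin s u" and c: "c > 0"
  shows "Lp (\<lambda>x. c * u x) = c\<^sup>2 * Lp u"
proof -
  have [measurable]: "u \<in> borel_measurable borel" using u by (simp add: Hfin_def)
  have fin: "Hfin s (\<lambda>x. c * u x)" using Hfin_lincomb[OF ss u u, of c 0] by simp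
  have "Jp (\<lambda>x. c * u x) = ennreal (c powr p) * Jp u"
    unfolding Jp_def using c by (subst nn_integral_cmult[symmetric]) (auto simp: abs_mult powr_mult ennreal_mult)
  then have "enn2real (Jp (\<lambda>x. c * u x)) = c powr p * enn2real (Jp u)" by (simp add: enn2real_mult)
  then have "Lp (\<lambda>x. c * u x) = (c powr p) powr (2 / p) * Lp u"
    using c by (simp add: Lp_Jp[OF fin] Lp_Jp[OF u] powr_mult)
  also have "(c powr p) powr (2 / p) = c\<^sup>2" using c p_gt by (simp add: powr_powr)
  finally show ?thesis .
qed

lemma bump_not_AE_0: "\<not> (AE x in lborel. bump (x::'a) = 0)"
proof
  assume "AE x in lborel. bump (x::'a) = 0"
  then have "AE x in lborel. bump x \<noteq> (0::real) \<longrightarrow> (x::'a) \<in> {}" by (rule eventually_mono) auto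
  moreover have "bump x \<noteq> 0" if "x \<in> ball 0 (1/2)" for x :: 'a
  proof -
    have "(norm x)\<^sup>2 < (1/2)\<^sup>2" using that by (intro power_strict_mono) auto
    then have "1 - 4 * (x \<bullet> x) > 0" by (simp add: power2_norm_eq_inner power_divide)
    then show ?thesis by (simp add: bump_def flat_exp_def)
  qed
  ultimately have "AE x in lborel. x \<notin> ball (0::'a) (1/2)" by (auto elim: eventually_mono)
  then have "ball (0::'a) (1/2) \<in> null_sets lborel" by (subst AE_iff_null_sets) auto
  then have "emeasure lborel (ball (0::'a) (1/2)) = 0" by (rule null_setsD1)
  then show False using unit_ball_vol_pos[of "real DIM('a)"] by (simp add: emeasure_lborel_ball del: unit_ball_vol_pos)
qed

text \<open>\<open>A\<close> and \<open>Lp\<close> are homogeneous of degree two, so near-minimisers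
  can be rescaled to \<open>A\<close> equal to 1; \<open>A\<close> is positive on them because the
  quotient is at least S > 0. \<open>bump\<close> shows that there are competitors at all.\<close>

lemma minimizing_sequence_exists:
  "\<exists>u. (\<forall>k::nat. u k \<in> Hrad s \<and> A (u k) = 1) \<and> (\<lambda>k. Rq s h (u k)) \<longlonglongrightarrow> S"
proof -
  let ?V = "{u :: 'a \<Rightarrow> real. u \<in> Hrad s \<and> \<not> (AE x in lborel. u x = 0)}"
  have "(bump :: 'a \<Rightarrow> real) \<in> Hrad s" by (rule rtest_Hrad[OF ss bump_rtest])
  with bump_not_AE_0 have "bump \<in> ?V" by simp
  then have ne: "?V \<noteq> {}" by blast
  have "\<exists>u\<in>?V. Rq s h u < S + 1 / real (Suc k)" for k
  proof -
    have "Inf (Rq s h ` ?V) < S + 1 / real (Suc k)" by (simp add: S_rad_def)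
    from cInf_lessD[OF _ this] ne show ?thesis by auto
  qed
  then have "\<forall>k. \<exists>u. u \<in> ?V \<and> Rq s h u < S + 1 / real (Suc k)" by blast
  from choice[OF this] obtain u where "\<forall>k. u k \<in> ?V \<and> Rq s h (u k) < S + 1 / real (Suc k)" ..
  then have u: "\<And>k. u k \<in> ?V" "\<And>k. Rq s h (u k) < S + 1 / real (Suc k)" by blast+
  have uH: "u k \<in> Hrad s" and uf: "Hfin s (u k)" for k using u(1)[of k] by (auto intro: Hrad_Hfin[OF ss])
  have SR: "S \<le> Rq s h (u k)" for k
    using u(1)[of k] unfolding S_rad_def by (intro cINF_lower Rq_bdd_below) auto
  have Apos: "A (u k) > 0" for k
  proof -
    have "A (u k) / Lp (u k) > 0" using SR[of k] S_pos by (simp add: Rq_eq)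
    then show ?thesis using Lp_nonneg[of "u k"] by (simp add: zero_less_divide_iff)
  qed
  define c where "c k = 1 / sqrt (A (u k))" for k
  have c: "c k > 0" "(c k)\<^sup>2 * A (u k) = 1" for k using Apos[of k] by (simp_all add: c_def power_divide)
  define w where "w k = (\<lambda>x. c k * u k x)" for k
  have "w k \<in> Hrad s" for k using Hrad_lincomb[OF ss uH[of k] uH[of k], of "c k" 0] by (simp add: w_def)
  moreover have "A (w k) = 1" for k by (simp add: w_def A_scale[OF uf] c)
  moreover have "Rq s h (w k) = Rq s h (u k)" for k
    using c(1)[of k] by (simp add: Rq_eq w_def A_scale[OF uf] Lp_scale[OF uf])
  moreover have lim: "(\<lambda>k. S + 1 / real (Suc k)) \<longlonglongrightarrow> S"
    using LIMSEQ_inverse_real_of_nat_add[of S] by (simp add: inverse_eq_divide)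
  have "(\<lambda>k. Rq s h (u k)) \<longlonglongrightarrow> S"
    by (rule tendsto_sandwich[OF _ _ tendsto_const lim]) (use SR u(2) in \<open>auto intro!: always_eventually less_imp_le\<close>)
  ultimately show ?thesis by (intro exI[of _ w]) auto
qed

text \<open>\<open>Lp_Brezis_Lieb_upper\<close> concerns p-th power integrals; since 2 / p < 1, the
  power 2 / p is subadditive and turns it into an inequality for squared norms, one-sided in the
  direction that the comparison of constants uses.\<close>

lemma Lp_Brezis_Lieb:
  assumes w: "\<And>k. w k \<in> Hrad s" and u: "u \<in> Hrad s" and ae: "AE x in lborel. (\<lambda>k. w k x) \<longlonglongrightarrow> u x"
    and P: "\<And>k. Lp (\<lambda>x. w k x - u x) \<le> P" and e: "e > 0"
  shows "\<forall>\<^sub>F k in sequentially. Lp (w k) \<le> Lp (\<lambda>x. w k x - u x) + Lp u + e"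
proof -
  have P0: "P \<ge> 0" using order_trans[OF Lp_nonneg P[of 0]] .
  \<comment> \<open>\<open>d * P\<close> and \<open>d powr (2 / p)\<close> are the two errors made
    below; d is taken so small that their sum stays under e.\<close>
  have "((\<lambda>d. d * P + d powr (2 / p)) \<longlongrightarrow> 0 * P + 0 powr (2 / p)) (at_right 0)"
    using p_gt by (intro tendsto_intros tendsto_powr') (auto simp: eventually_at_right_less intro: eventually_mono[OF eventually_at_right_less])
  then have "\<forall>\<^sub>F d in at_right 0. d * P + d powr (2 / p) < e" using e p_gt by (intro order_tendstoD(2)) auto
  then obtain d where d: "d > 0" "d * P + d powr (2 / p) < e"
    unfolding eventually_at_right_field using dense by (metis)
  have fw: "Hfin s (w k)" and fu: "Hfin s u" and v: "(\<lambda>x. w k x - u x) \<in> Hrad s" for k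
    using w u by (auto intro: Hrad_Hfin[OF ss] Hrad_diff[OF ss])
  have fv: "Hfin s (\<lambda>x. w k x - u x)" for k by (rule Hrad_Hfin[OF ss v])
  have m: "w k \<in> borel_measurable lborel" "u \<in> borel_measurable lborel" for k
    using fw fu by (auto simp: Hfin_def)
  have "p > 0" using p_gt by simp
  from Lp_Brezis_Lieb_upper[OF m ae Hrad_Jp_finite(1)[OF u, unfolded Jp_def] this d(1)]
  have "\<forall>\<^sub>F k in sequentially. Jp (w k) \<le> ennreal (1 + d) * Jp (\<lambda>x. w k x - u x) + (Jp u + ennreal d)"
    unfolding Jp_def .
  then show ?thesis
  proof (rule eventually_mono)
    fix k assume k: "Jp (w k) \<le> ennreal (1 + d) * Jp (\<lambda>x. w k x - u x) + (Jp u + ennreal d)"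
    define a b where "a = enn2real (Jp (\<lambda>x. w k x - u x))" and "b = enn2real (Jp u)"
    have ab: "Jp (\<lambda>x. w k x - u x) = ennreal a" "Jp u = ennreal b" "a \<ge> 0" "b \<ge> 0"
      using Hrad_Jp_finite(1)[OF v[of k]] Hrad_Jp_finite(1)[OF u] by (simp_all add: a_def b_def less_top)
    have "Jp (w k) \<le> ennreal ((1 + d) * a + (b + d))"
      using k d ab by (simp flip: ennreal_plus ennreal_mult)
    then have "enn2real (Jp (w k)) \<le> (1 + d) * a + (b + d)"
      using ab d by (intro enn2real_leI) auto
    then have "Lp (w k) \<le> ((1 + d) * a + (b + d)) powr (2 / p)"
      unfolding Lp_Jp[OF fw] using p_gt by (intro powr_mono2) auto
    also have "\<dots> \<le> ((1 + d) * a) powr (2 / p) + (b powr (2 / p) + d powr (2 / p))"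
      using ab d p_gt by (intro order_trans[OF powr_add_le_add_powr] add_left_mono powr_add_le_add_powr) auto
    also have "((1 + d) * a) powr (2 / p) = (1 + d) powr (2 / p) * a powr (2 / p)" using ab d by (simp add: powr_mult)
    also have "\<dots> \<le> (1 + d) * a powr (2 / p)"
      using powr_mono[of "2 / p" 1 "1 + d"] d p_gt by (intro mult_right_mono) auto
    finally have "Lp (w k) \<le> (1 + d) * Lp (\<lambda>x. w k x - u x) + (Lp u + d powr (2 / p))"
      by (simp add: Lp_Jp[OF fv] Lp_Jp[OF fu] a_def b_def)
    moreover have "d * Lp (\<lambda>x. w k x - u x) \<le> d * P" using d P[of k] by (intro mult_left_mono) auto
    ultimately show "Lp (w k) \<le> Lp (\<lambda>x. w k x - u x) + Lp u + e"
      using d(2) by (simp add: distrib_right)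
  qed
qed

text \<open>Compactness is known for test functions, so each \<open>w k\<close> is replaced by one
  at squared distance below \<open>1 / real (Suc k)\<close>. The limit of those belongs to the
  completion, and the differences tend to 0 in \<open>L\<^sup>2\<close>, hence almost everywhere
  along a further subsequence.\<close>

lemma subsequence_AE_limit:
  fixes w :: "nat \<Rightarrow> 'a \<Rightarrow> real"
  assumes w: "\<And>k. w k \<in> Hrad s" and M: "\<And>k. Hn s (w k) \<le> M"
  shows "\<exists>r u. strict_mono (r :: nat \<Rightarrow> nat) \<and> u \<in> Hrad s \<and> (AE x in lborel. (\<lambda>k. w (r k) x) \<longlonglongrightarrow> u x)"
proof -
  have M0: "M \<ge> 0" using order_trans[OF Hn_nonneg M[of 0]] .
  have fw: "Hfin s (w k)" for k by (rule Hrad_Hfin[OF ss w])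
  have "\<forall>k. \<exists>\<phi>\<in>rtest. Hn s (\<lambda>x. \<phi> x - w k x) < 1 / real (Suc k)"
    using w unfolding Hrad_iff[OF ss] by simp
  then obtain \<phi> where \<phi>: "\<And>k. \<phi> k \<in> rtest" "\<And>k. Hn s (\<lambda>x. \<phi> k x - w k x) < 1 / real (Suc k)" by metis
  have f\<phi>: "Hfin s (\<phi> k)" for k by (rule rtest_Hfin[OF ss \<phi>(1)])
  have H\<phi>: "Hn s (\<phi> k) \<le> 2 * M + 2" for k
  proof -
    have "Hn s (\<lambda>x. \<phi> k x - w k x) < 1 / real (Suc k)" by (rule \<phi>(2))
    also have "\<dots> \<le> 1" by simp
    finally show ?thesis
      using Hn_le_near[OF ss f\<phi> fw, of 1 k k] M[of k] by simp
  qed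
  define G where "G = 2 / cNs DIM('a) s * (2 * M + 2)"
  have G0: "G \<ge> 0" using M0 cNs_pos[OF ss, of "DIM('a)"] by (simp add: G_def)
  have G: "gag s unitB (\<phi> k) \<le> ennreal G" for k
  proof -
    have "2 / cNs DIM('a) s * Hn s (\<phi> k) \<le> G"
      unfolding G_def using cNs_pos[OF ss, of "DIM('a)"] by (intro mult_left_mono H\<phi>) auto
    then have "ennreal (2 / cNs DIM('a) s * Hn s (\<phi> k)) \<le> ennreal G" by (rule ennreal_leI)
    with Hfin_gag(2)[OF ss f\<phi>[of k]] show ?thesis by (rule order_trans)
  qed
  obtain r u where r: "strict_mono (r :: nat \<Rightarrow> nat)" and u: "u \<in> borel_measurable borel" "\<forall>x. x \<notin> unitB \<longrightarrow> u x = 0"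
      "\<forall>x. x \<noteq> 0 \<longrightarrow> (\<lambda>j. \<phi> (r j) x) \<longlonglongrightarrow> u x"
    using rtest_precompact[of s \<phi> G, OF s_gt s_lt \<phi>(1) G G0] by blast
  have ae: "AE x in lborel. (\<lambda>j. \<phi> (r j) x) \<longlonglongrightarrow> u x"
    using AE_lborel_singleton[of "0::'a"] by (rule eventually_mono) (use u(3) in blast)
  have uH: "u \<in> Hrad s"
    by (rule Hrad_AE_limit(1)[OF ss \<phi>(1) u(1) _ ae H\<phi>]) (use u(2) in blast)
  have D: "Hfin s (\<lambda>x. \<phi> k x - w k x)" for k by (rule Hfin_diff[OF ss f\<phi> fw])
  note L = Hfin_L2_lborel[OF ss D]
  have lim: "(\<lambda>k. \<integral>x. (\<phi> k x - w k x)\<^sup>2 \<partial>lborel) \<longlonglongrightarrow> 0"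
  proof (rule tendsto_sandwich[OF _ _ tendsto_const LIMSEQ_inverse_real_of_nat])
    have "(\<integral>x. (\<phi> k x - w k x)\<^sup>2 \<partial>lborel) \<le> inverse (real (Suc k))" for k
      using L(2)[of k] \<phi>(2)[of k] unfolding inverse_eq_divide by linarith
    then show "\<forall>\<^sub>F k in sequentially. (\<integral>x. (\<phi> k x - w k x)\<^sup>2 \<partial>lborel) \<le> inverse (real (Suc k))" by simp
  qed simp
  have "(\<lambda>k. \<integral>x. norm ((\<phi> (r k) x - w (r k) x)\<^sup>2) \<partial>lborel) \<longlonglongrightarrow> 0"
    using LIMSEQ_subseq_LIMSEQ[OF lim r] by (simp add: o_def)
  then obtain t :: "nat \<Rightarrow> nat" where t: "strict_mono t" "AE x in lborel. (\<lambda>k. (\<phi> (r (t k)) x - w (r (t k)) x)\<^sup>2) \<longlonglongrightarrow> 0"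
    using tendsto_L1_AE_subseq[of lborel "\<lambda>k x. (\<phi> (r k) x - w (r k) x)\<^sup>2"] L2fun_integrable[OF L(1)] by blast
  have "AE x in lborel. (\<lambda>k. w (r (t k)) x) \<longlonglongrightarrow> u x"
    using t(2) ae
  proof eventually_elim
    case (elim x)
    then have "(\<lambda>k. sqrt ((\<phi> (r (t k)) x - w (r (t k)) x)\<^sup>2)) \<longlonglongrightarrow> sqrt 0" by (intro tendsto_real_sqrt)
    then have 1: "(\<lambda>k. \<phi> (r (t k)) x - w (r (t k)) x) \<longlonglongrightarrow> 0" by (simp add: tendsto_rabs_zero_iff)
    have 2: "(\<lambda>k. \<phi> (r (t k)) x) \<longlonglongrightarrow> u x"
      using LIMSEQ_subseq_LIMSEQ[OF elim(2) t(1)] by (simp add: o_def)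
    from tendsto_diff[OF 2 1] show ?case by simp
  qed
  moreover have "strict_mono (\<lambda>k. r (t k))" using strict_mono_o[OF r t(1)] by (simp add: o_def)
  ultimately show ?thesis using uH by (intro exI[of _ "\<lambda>k. r (t k)"] exI[of _ u] conjI)
qed

text \<open>Writing \<open>v k = w k - u\<close>, both \<open>A\<close> and \<open>Lp\<close> split asymptotically. As \<open>A\<close> controls \<open>Lp\<close> with constant \<open>S\<close> on \<open>u\<close>
  but with the strictly larger Sobolev constant on the concentrating part \<open>v k\<close>, no mass can be left in \<open>v k\<close>.\<close>
lemma minimizing_sequence_AE_limit:
  assumes w: "\<And>k. w k \<in> Hrad s" and A1: "\<And>k. A (w k) = 1" and R: "(\<lambda>k. Rq s h (w k)) \<longlonglongrightarrow> S"
    and u: "u \<in> Hrad s" and ae: "AE x in lborel. (\<lambda>k. w k x) \<longlonglongrightarrow> u x"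
  shows "(\<lambda>k. Hn s (\<lambda>x. w k x - u x)) \<longlonglongrightarrow> 0" "A u = 1" "S * Lp u = 1"
proof -
  define T where "T = S_sob s TYPE('a)"
  have T: "T > S" "T > 0" using S_less S_pos by (simp_all add: T_def)
  define v where "v k = (\<lambda>x. w k x - u x)" for k
  define M where "M = 1 + hplus * vol / S"
  have M: "Hn s (w k) \<le> M" for k using A_bounds(1)[OF w[of k]] by (simp add: M_def A1)
  have fw: "Hfin s (w k)" and fu: "Hfin s u" for k using w u by (auto intro: Hrad_Hfin[OF ss])
  have vH: "v k \<in> Hrad s" for k unfolding v_def by (rule Hrad_diff[OF ss w u])
  have fv: "Hfin s (v k)" for k by (rule Hrad_Hfin[OF ss vH])
  note L2w = Hfin_L2_lborel(1)[OF ss fw] and L2u = Hfin_L2_lborel(1)[OF ss fu] and L2v = Hfin_L2_lborel(1)[OF ss fv]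
  define M' where "M' = 2 * M + 2 * Hn s u"
  have Mv: "Hn s (v k) \<le> M'" for k
    using Hn_diff_le[OF ss fw[of k] fu] M[of k] by (simp add: v_def M'_def)
  define P where "P = hplus * M' / S"
  have hp: "hplus > 0" using hbound(1) by (simp add: hplus_def)
  have P: "Lp (v k) \<le> P" for k
  proof -
    have "S * Lp (v k) \<le> hplus * M'"
      using Hrad_Jp_finite(2)[OF vH[of k]] A_bounds(2)[OF vH[of k]] mult_left_mono[OF Mv[of k], of hplus] hp by linarith
    then show ?thesis using S_pos by (simp add: P_def le_divide_eq mult.commute)
  qed
  have aev: "AE x in lborel. (\<lambda>k. v k x) \<longlonglongrightarrow> 0"
    using ae by (rule eventually_mono) (simp add: v_def LIM_zero)
  have vm [measurable]: "v k \<in> borel_measurable borel" for k using fv by (simp add: Hfin_def)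
  have l0: "(\<lambda>k. \<integral>x. (v k x)\<^sup>2 \<partial>lborel) \<longlonglongrightarrow> 0"
  proof -
    \<comment> \<open>Lebesgue measure restricted to the ball, because
      \<open>L2_tendsto_0_of_Lp_bounded\<close> asks for a finite measure.\<close>
    let ?D = "density lborel (indicator (unitB :: 'a set)) :: 'a measure"
    have D: "(\<integral>\<^sup>+x. f x \<partial>?D) = (\<integral>\<^sup>+x. f x \<partial>lborel)" if [measurable]: "f \<in> borel_measurable borel" and "\<And>x. x \<notin> unitB \<Longrightarrow> f x = 0" for f :: "'a \<Rightarrow> ennreal"
      using that by (subst nn_integral_density) (auto intro!: nn_integral_cong simp: indicator_def)
    have v0: "v k x = 0" if "x \<notin> unitB" for k x using fv that by (simp add: Hfin_def)
    have "(\<lambda>k. \<integral>\<^sup>+x. ennreal ((v k x)\<^sup>2) \<partial>?D) \<longlonglongrightarrow> 0"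
    proof (rule L2_tendsto_0_of_Lp_bounded[OF _ _ _ _ p_gt])
      show "emeasure ?D (space ?D) < \<infinity>"
        by (simp add: emeasure_density emeasure_lborel_ball)
      show "AE x in ?D. (\<lambda>k. v k x) \<longlonglongrightarrow> 0" using aev by (subst AE_density) (auto elim: eventually_mono)
      show "(\<integral>\<^sup>+x. ennreal (\<bar>v k x\<bar> powr p) \<partial>?D) \<le> ennreal (P powr (p / 2))" for k
      proof -
        define J where "J = enn2real (Jp (v k))"
        have J: "Jp (v k) = ennreal J" "J \<ge> 0" using Hrad_Jp_finite(1)[OF vH[of k]] by (simp_all add: J_def less_top)
        have "J powr (2 / p) \<le> P" using P[of k] by (simp add: Lp_Jp[OF fv] J_def)
        then have "(J powr (2 / p)) powr (p / 2) \<le> P powr (p / 2)" using p_gt by (intro powr_mono2) auto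
        then have "J \<le> P powr (p / 2)" using J p_gt by (simp add: powr_powr)
        then have "Jp (v k) \<le> ennreal (P powr (p / 2))" unfolding J(1) by (rule ennreal_leI)
        then show ?thesis using p_gt v0[of _ k] unfolding Jp_def by (subst D) auto
      qed
    qed simp
    then have "(\<lambda>k. \<integral>\<^sup>+x. ennreal ((v k x)\<^sup>2) \<partial>lborel) \<longlonglongrightarrow> ennreal 0" using v0 by (subst (asm) D) auto
    then show ?thesis unfolding L2fun_nn_integral[OF L2v] by (subst (asm) tendsto_ennreal_iff) auto
  qed
  have "(\<lambda>k. Hn s (w k) - Hn s u - Hn s (v k)) \<longlonglongrightarrow> 0"
  proof -
    have "(\<lambda>k. (\<integral>z. (dif (w k) z)\<^sup>2 \<partial>pairM s) - (\<integral>z. (dif u z)\<^sup>2 \<partial>pairM s) - (\<integral>z. (dif (w k) z - dif u z)\<^sup>2 \<partial>pairM s)) \<longlonglongrightarrow> 0"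
      by (rule L2_Brezis_Lieb[OF Hfin_L2fun[OF ss fw] L2fun_measurable[OF Hfin_L2fun[OF ss fu]] AE_pairM_dif_tendsto[OF ae] M[unfolded Hn_def]])
    then show ?thesis by (simp add: Hn_def v_def dif_lincomb)
  qed
  \<comment> \<open>The terms of \<open>A (w k) - A u\<close> that remain after the splitting of
    \<open>Hn\<close>: the cross terms vanish by weak convergence, the quadratic ones by convergence
    in \<open>L\<^sup>2\<close>. So \<open>A (w k) - A u\<close> behaves like
    \<open>Hn s (v k)\<close>.\<close>
  moreover have "(\<lambda>k. 2 * (\<integral>x. v k x * (hB x * u x) \<partial>lborel) + (\<integral>x. hB x * (v k x)\<^sup>2 \<partial>lborel)
      - 2 * (\<integral>x. v k x * u x \<partial>lborel) - (\<integral>x. (v k x)\<^sup>2 \<partial>lborel)) \<longlonglongrightarrow> 2 * 0 + 0 - 2 * 0 - 0"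
  proof (intro tendsto_diff tendsto_add tendsto_mult tendsto_const l0)
    have lb: "(\<integral>x. (v k x)\<^sup>2 \<partial>lborel) \<le> M'" for k using Hfin_L2_lborel(2)[OF ss fv[of k]] Mv[of k] by linarith
    show "(\<lambda>k. \<integral>x. v k x * (hB x * u x) \<partial>lborel) \<longlonglongrightarrow> 0" by (rule L2_bounded_AE_weak[OF L2v hB_L2fun[OF L2u] aev lb])
    show "(\<lambda>k. \<integral>x. v k x * u x \<partial>lborel) \<longlonglongrightarrow> 0" by (rule L2_bounded_AE_weak[OF L2v L2u aev lb])
    show "(\<lambda>k. \<integral>x. hB x * (v k x)\<^sup>2 \<partial>lborel) \<longlonglongrightarrow> 0"
    proof (rule Lim_null_comparison)
      show "(\<lambda>k. hbound * (\<integral>x. (v k x)\<^sup>2 \<partial>lborel)) \<longlonglongrightarrow> 0" using l0 by (rule tendsto_mult_right_zero)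
      show "\<forall>\<^sub>F k in sequentially. norm (\<integral>x. hB x * (v k x)\<^sup>2 \<partial>lborel) \<le> hbound * (\<integral>x. (v k x)\<^sup>2 \<partial>lborel)"
        using hB_integral_bound[OF L2v] by simp
    qed
  qed
  ultimately have "(\<lambda>k. (Hn s (w k) - Hn s u - Hn s (v k)) + (2 * (\<integral>x. v k x * (hB x * u x) \<partial>lborel) + (\<integral>x. hB x * (v k x)\<^sup>2 \<partial>lborel)
      - 2 * (\<integral>x. v k x * u x \<partial>lborel) - (\<integral>x. (v k x)\<^sup>2 \<partial>lborel))) \<longlonglongrightarrow> 0 + (2 * 0 + 0 - 2 * 0 - 0)"
    by (rule tendsto_add)
  moreover have "(Hn s (w k) - Hn s u - Hn s (v k)) + (2 * (\<integral>x. v k x * (hB x * u x) \<partial>lborel) + (\<integral>x. hB x * (v k x)\<^sup>2 \<partial>lborel)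
      - 2 * (\<integral>x. v k x * u x \<partial>lborel) - (\<integral>x. (v k x)\<^sup>2 \<partial>lborel)) = 1 - A u - Hn s (v k)" for k
  proof -
    have "(\<integral>x. (w k x)\<^sup>2 \<partial>lborel) = (\<integral>x. (u x + 1 * v k x)\<^sup>2 \<partial>lborel)" by (simp add: v_def)
    also have "\<dots> = (\<integral>x. (u x)\<^sup>2 \<partial>lborel) + 2 * 1 * (\<integral>x. u x * v k x \<partial>lborel) + 1\<^sup>2 * (\<integral>x. (v k x)\<^sup>2 \<partial>lborel)"
      by (rule integral_square_lincomb[OF L2u L2v])
    finally have 1: "(\<integral>x. (w k x)\<^sup>2 \<partial>lborel) = (\<integral>x. (u x)\<^sup>2 \<partial>lborel) + 2 * (\<integral>x. v k x * u x \<partial>lborel) + (\<integral>x. (v k x)\<^sup>2 \<partial>lborel)"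
      by (simp add: mult.commute)
    have "(\<integral>x. hB x * (w k x)\<^sup>2 \<partial>lborel) = (\<integral>x. hB x * (u x)\<^sup>2 + 2 * (v k x * (hB x * u x)) + hB x * (v k x)\<^sup>2 \<partial>lborel)"
      by (intro Bochner_Integration.integral_cong) (simp_all add: v_def power2_eq_square algebra_simps)
    also have "\<dots> = (\<integral>x. hB x * (u x)\<^sup>2 \<partial>lborel) + 2 * (\<integral>x. v k x * (hB x * u x) \<partial>lborel) + (\<integral>x. hB x * (v k x)\<^sup>2 \<partial>lborel)"
      using hB_integrable[OF L2u] hB_integrable[OF L2v[of k]] L2fun_mult[OF L2v[of k] hB_L2fun[OF L2u]] by simp
    finally have 2: "(\<integral>x. hB x * (w k x)\<^sup>2 \<partial>lborel) = (\<integral>x. hB x * (u x)\<^sup>2 \<partial>lborel) + 2 * (\<integral>x. v k x * (hB x * u x) \<partial>lborel) + (\<integral>x. hB x * (v k x)\<^sup>2 \<partial>lborel)" .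
    show ?thesis using A_eq(1)[OF fw[of k]] A_eq(1)[OF fu] 1 2 A1[of k] by simp
  qed
  ultimately have split: "(\<lambda>k. 1 - A u - Hn s (v k)) \<longlonglongrightarrow> 0" by simp
  have SLw: "(\<lambda>k. S * Lp (w k)) \<longlonglongrightarrow> 1"
  proof -
    have "(\<lambda>k. S / Rq s h (w k)) \<longlonglongrightarrow> S / S" using S_pos by (intro tendsto_divide tendsto_const R) auto
    then show ?thesis using S_pos by (simp add: Rq_eq A1)
  qed
  have SLu: "S * Lp u \<le> A u" by (rule Hrad_Jp_finite(2)[OF u])
  have conc: "\<forall>\<^sub>F k in sequentially. T * Lp (v k) \<le> Hn s (v k) + e" if "e > 0" for e
    using Hrad_concentration[OF s_gt s_lt dim _ vH Mv l0 that] T(2) by (simp add: T_def Lp_def p_def)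
  have BL: "\<forall>\<^sub>F k in sequentially. Lp (w k) \<le> Lp (v k) + Lp u + e" if "e > 0" for e
    using Lp_Brezis_Lieb[OF w u ae P[unfolded v_def] that] by (simp add: v_def)
  have Lv: "(\<lambda>k. Lp (v k)) \<longlonglongrightarrow> 0"
  proof (rule order_tendstoI)
    fix a :: real assume "a < 0"
    then show "\<forall>\<^sub>F k in sequentially. a < Lp (v k)" by (intro always_eventually allI less_le_trans[OF _ Lp_nonneg])
  next
    fix a :: real assume a: "0 < a"
    \<comment> \<open>Three errors e, from concentration, from the splitting of \<open>A\<close> and
      from \<open>S * Lp (w k) \<longlonglongrightarrow> 1\<close>, and one \<open>S * e\<close>
      from Brezis--Lieb amount to less than \<open>(4 + S) * e\<close>, which is set equal to
      \<open>(T - S) * a\<close>.\<close>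
    define e where "e = (T - S) * a / (4 + S)"
    have e: "e > 0" using a T S_pos by (simp add: e_def)
    have ea: "(4 + S) * e = (T - S) * a" using S_pos by (simp add: e_def)
    have "\<forall>\<^sub>F k in sequentially. - e < 1 - A u - Hn s (v k)" "\<forall>\<^sub>F k in sequentially. 1 - A u - Hn s (v k) < e"
      "\<forall>\<^sub>F k in sequentially. 1 - e < S * Lp (w k)"
      using e by (auto intro!: order_tendstoD[OF split] order_tendstoD[OF SLw])
    with conc[OF e] BL[OF e] show "\<forall>\<^sub>F k in sequentially. Lp (v k) < a"
    proof eventually_elim
      case (elim k)
      have "S * Lp (w k) \<le> S * (Lp (v k) + Lp u + e)" using elim(2) S_pos by (intro mult_left_mono) auto
      then have "S * Lp (w k) \<le> S * Lp (v k) + S * Lp u + S * e" by (simp add: distrib_left)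
      then have "T * Lp (v k) - S * Lp (v k) < 3 * e + S * e" using elim SLu by linarith
      also have "\<dots> \<le> (4 + S) * e" using e by (simp add: distrib_right)
      finally have "(T - S) * Lp (v k) < (T - S) * a" unfolding ea by (simp add: left_diff_distrib)
      then show ?case using T by simp
    qed
  qed
  have "1 \<le> S * Lp u + S * e" if e: "e > 0" for e
  proof (rule LIMSEQ_le[OF SLw])
    show "(\<lambda>k. S * (Lp (v k) + Lp u + e)) \<longlonglongrightarrow> S * Lp u + S * e"
      using tendsto_mult[OF tendsto_const[of S] tendsto_add[OF tendsto_add[OF Lv tendsto_const[of "Lp u"]] tendsto_const[of e]]]
      by (simp add: distrib_left)
    show "\<exists>K. \<forall>k\<ge>K. S * Lp (w k) \<le> S * (Lp (v k) + Lp u + e)"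
      using BL[OF e] S_pos unfolding eventually_sequentially by (meson less_imp_le mult_left_mono)
  qed
  then have "1 \<le> S * Lp u + e" if "e > 0" for e using that S_pos[THEN less_imp_neq] S_pos
    by (metis divide_pos_pos nonzero_mult_div_cancel_left times_divide_eq_right)
  then have SLu1: "1 \<le> S * Lp u" by (rule field_le_epsilon)
  have Hlim: "(\<lambda>k. Hn s (v k)) \<longlonglongrightarrow> 1 - A u"
    using tendsto_diff[OF tendsto_const[of "1 - A u"] split] by simp
  \<comment> \<open>This closes the chain \<open>1 \<le> S * Lp u \<le> A u \<le> 1\<close>.\<close>
  have "0 \<le> 1 - A u" by (rule LIMSEQ_le_const[OF Hlim]) simp
  then have Au: "A u = 1" using SLu SLu1 by linarith
  then show "A u = 1" .
  show "S * Lp u = 1" using SLu SLu1 Au by linarith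
  show "(\<lambda>k. Hn s (\<lambda>x. w k x - u x)) \<longlonglongrightarrow> 0" using Hlim Au by (simp add: v_def)
qed

lemma minimizing_sequence_compact:
  assumes w: "\<And>k. w k \<in> Hrad s" and A1: "\<And>k. A (w k) = 1" and R: "(\<lambda>k. Rq s h (w k)) \<longlonglongrightarrow> S"
  shows "\<exists>r u. strict_mono (r :: nat \<Rightarrow> nat) \<and> u \<in> Hrad s \<and> (\<lambda>k. Hsq s (\<lambda>x. w (r k) x - u x)) \<longlonglongrightarrow> 0
    \<and> A u = 1 \<and> S * Lp u = 1"
proof -
  have M: "Hn s (w k) \<le> 1 + hplus * vol / S" for k using A_bounds(1)[OF w[of k]] by (simp add: A1)
  obtain r u where r: "strict_mono (r :: nat \<Rightarrow> nat)" and u: "u \<in> Hrad s" and ae: "AE x in lborel. (\<lambda>k. w (r k) x) \<longlonglongrightarrow> u x"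
    using subsequence_AE_limit[of w, OF w M] by blast
  have R': "(\<lambda>k. Rq s h (w (r k))) \<longlonglongrightarrow> S" using LIMSEQ_subseq_LIMSEQ[OF R r] by (simp add: o_def)
  note lim = minimizing_sequence_AE_limit[of "\<lambda>k. w (r k)", OF w A1 R' u ae]
  have "(\<lambda>k. ennreal (Hn s (\<lambda>x. w (r k) x - u x))) \<longlonglongrightarrow> ennreal 0" by (rule tendsto_ennrealI[OF lim(1)])
  then have "(\<lambda>k. Hsq s (\<lambda>x. w (r k) x - u x)) \<longlonglongrightarrow> 0"
    by (simp add: Hsq_eq_Hn[OF ss Hrad_Hfin[OF ss Hrad_diff[OF ss w u]]])
  with r u lim(2,3) show ?thesis by (intro exI[of _ r] exI[of _ u] conjI)
qed

end

text \<open>Relative compactness is expressed for the set of members: every sequence drawn from the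
  range, in any order and with repetitions, has a subsequence converging in the space.\<close>

theorem theorem5p1:
  fixes s :: real and h :: "'a::euclidean_space \<Rightarrow> real"
  assumes "1/2 < s" and "s < 1" and "real DIM('a) > 2 * s"
    and "set_borel_measurable lborel unitB h"
    and "\<exists>C. AE x in lborel. x \<in> unitB \<longrightarrow> \<bar>h x\<bar> \<le> C"
    and "\<forall>x\<in>unitB. \<forall>y\<in>unitB. norm x = norm y \<longrightarrow> h x = h y"
    and "0 < S_rad s h" and "S_rad s h < S_sob s TYPE('a)"
  shows "(\<forall>u :: nat \<Rightarrow> 'a \<Rightarrow> real.
            (\<forall>k. u k \<in> Hrad s) \<and>
            (\<forall>k. enn2real (Qf s unitB (u k)) + (LINT x:unitB|lborel. h x * (u k x)\<^sup>2) = 1) \<and>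
            (\<lambda>k. Rq s h (u k)) \<longlonglongrightarrow> S_rad s h
          \<longrightarrow> (\<forall>w :: nat \<Rightarrow> 'a \<Rightarrow> real. (\<forall>j. w j \<in> range u) \<longrightarrow>
                (\<exists>r v. strict_mono r \<and> v \<in> Hrad s \<and>
                   (\<lambda>j. Hsq s (\<lambda>x. w (r j) x - v x)) \<longlonglongrightarrow> 0)))
       \<and> (\<exists>u \<in> Hrad s. \<not> (AE x in lborel. u x = 0) \<and> Rq s h u = S_rad s h)"
proof -
  interpret frac_minimization s h
    by unfold_locales (fact assms)+
  have compact: "\<exists>r v. strict_mono r \<and> v \<in> Hrad s \<and> (\<lambda>j. Hsq s (\<lambda>x. w (r j) x - v x)) \<longlonglongrightarrow> 0"
    if u: "\<And>k. u k \<in> Hrad s" "\<And>k. A (u k) = 1" "(\<lambda>k. Rq s h (u k)) \<longlonglongrightarrow> S" and w: "\<And>j. w j \<in> range u"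
    for u w :: "nat \<Rightarrow> 'a \<Rightarrow> real"
  proof -
    have "\<forall>j. \<exists>k. w j = u k" using w by blast
    then obtain k where k: "\<And>j. w j = u (k j)" by metis
    show ?thesis
    \<comment> \<open>If one index recurs infinitely often there is a constant subsequence;
      otherwise the indices tend to infinity and the drawn sequence is again minimising.\<close>
    proof (cases "\<exists>n. infinite {j. k j = n}")
      case True
      then obtain n where "infinite {j. k j = n}" by blast
      then obtain r :: "nat \<Rightarrow> nat" where r: "strict_mono r" "\<And>j. r j \<in> {j. k j = n}"
        using infinite_enumerate by blast
      have "Hsq s (\<lambda>x. w (r j) x - u n x) = 0" for j
        using r(2)[of j] by (simp add: k Hsq_def Qf_def)
      then show ?thesis using r(1) u(1) by (intro exI[of _ r] exI[of _ "u n"]) simp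
    next
      case False
      have "filterlim k at_top sequentially"
        unfolding filterlim_at_top
      proof
        fix Z
        have "{j. k j < Z} = (\<Union>n<Z. {j. k j = n})" by auto
        then have "finite {j. k j < Z}" using False by simp
        then have "\<forall>\<^sub>F j in cofinite. Z \<le> k j" by (simp add: eventually_cofinite not_le)
        then show "\<forall>\<^sub>F j in sequentially. Z \<le> k j" by (simp add: cofinite_eq_sequentially)
      qed
      then have "(\<lambda>j. Rq s h (w j)) \<longlonglongrightarrow> S"
        unfolding k by (rule filterlim_compose[OF u(3)])
      moreover have "w j \<in> Hrad s" "A (w j) = 1" for j using u by (simp_all add: k)
      ultimately have "\<exists>r v. strict_mono (r :: nat \<Rightarrow> nat) \<and> v \<in> Hrad s \<and> (\<lambda>j. Hsq s (\<lambda>x. w (r j) x - v x)) \<longlonglongrightarrow> 0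
          \<and> A v = 1 \<and> S * Lp v = 1"
        by (intro minimizing_sequence_compact[of w])
      then show ?thesis by (elim exE conjE) (intro exI conjI)
    qed
  qed
  obtain u where u0: "\<forall>k::nat. u k \<in> Hrad s \<and> A (u k) = 1" and u: "(\<lambda>k. Rq s h (u k)) \<longlonglongrightarrow> S"
    using minimizing_sequence_exists by blast
  obtain v where v: "v \<in> Hrad s" "A v = 1" "S * Lp v = 1"
    using minimizing_sequence_compact[of u, OF _ _ u] u0 by blast
  have "Lp v \<noteq> 0" using v(3) by auto
  then have "Rq s h v = S" using v by (simp add: Rq_eq divide_eq_eq)
  moreover have "\<not> (AE x in lborel. v x = 0)"
  proof
    assume "AE x in lborel. v x = 0"
    then have "Jp v = (\<integral>\<^sup>+x. 0 \<partial>(lborel :: 'a measure))"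
      unfolding Jp_def using p_gt by (intro nn_integral_cong_AE) (auto elim: eventually_mono)
    then have "Lp v = 0" using Lp_Jp[OF Hrad_Hfin[OF ss v(1)]] p_gt by simp
    then show False using v(3) by simp
  qed
  ultimately have ex: "\<exists>u \<in> Hrad s. \<not> (AE x in lborel. u x = 0) \<and> Rq s h u = S"
    using v(1) by (intro bexI[of _ v] conjI)
  show ?thesis
  proof (intro conjI allI impI ex, elim conjE)
    fix u w :: "nat \<Rightarrow> 'a \<Rightarrow> real"
    assume u: "\<forall>k. u k \<in> Hrad s" "(\<lambda>k. Rq s h (u k)) \<longlonglongrightarrow> S" and w: "\<forall>j. w j \<in> range u"
      and a: "\<forall>k. enn2real (Qf s unitB (u k)) + (LINT x:unitB|lborel. h x * (u k x)\<^sup>2) = 1"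
    have "\<forall>k. A (u k) = 1" unfolding A_def by (rule a)
    then show "\<exists>r v. strict_mono r \<and> v \<in> Hrad s \<and> (\<lambda>j. Hsq s (\<lambda>x. w (r j) x - v x)) \<longlonglongrightarrow> 0"
      using u w by (intro compact[of u w]) auto
  qed
qed

end
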